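(* Let $q\ge0$, $r\ge1$, let $\|\!|\cdot|\!\|$ be a norm on $V_h$ such that for some $\gamma\in(0,\pi/2)$ and a constant $M_h$ independent of $z$, $$\|\!|(z+\Delta_h)^{-1}\chi|\!\|\le\frac{M_h}{|z|}\|\!|\chi|\!\|\quad\text{for all }\chi\in V_h,\ z\in\mathbb{C}\setminus\Sigma_\gamma,$$ where $\Sigma_\gamma=\{z\in\mathbb{C}:|\arg z|\le\gamma\}$. Let $u_0\in L^2(\Omega)$ and $u_{kh}\in X^{q,r}_{k,h}$ satisfy $B(u_{kh},\varphi_{kh})=(u_0,\varphi_{kh,0}^+)_\Omega$ for all $\varphi_{kh}\in X^{q,r}_{k,h}$. Then there exists a constant $C$ independent of $k$ and $h$ such that for $m=1,\dots,M$, $$\sup_{t\in I_m}\|\!|\partial_tu_{kh}(t)|\!\|+\sup_{t\in I_m}\|\!|\Delta_hu_{kh}(t)|\!\|+k_m^{-1}\|\!|[u_{kh}]_{m-1}|\!\|\le\frac{CM_h}{t_m}\|\!|P_hu_0|\!\|,$$ where $[u_{kh}]_0:=u_{kh,0}^+-P_hu_0$.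
   Context: $\Omega\subset\mathbb{R}^d$ is a Lipschitz domain; $\mathcal{T}$ is an arbitrary (not necessarily quasi-uniform) partition of $\Omega$ into cells (triangles, tetrahedra, quadrilaterals or hexahedra), and $V_h\subset H^1_0(\Omega)$ consists of functions belonging to a fixed polynomial space ($P_r$ or $Q_r$) on each cell. $T>0$, $I=(0,T)$ partitioned by $0=t_0<\dots<t_M=T$, $I_m=(t_{m-1},t_m]$, $k_m=t_m-t_{m-1}$, $k=\max_mk_m$, $k_{\min}=\min_mk_m$, with (i) $k_{\min}\ge ck^\beta$ for constants $c,\beta>0$ independent of $k$; (ii) $\kappa^{-1}\le k_m/k_{m+1}\le\kappa$; (iii) $k\le T/4$. $X^{q,r}_{k,h}=\{v:v|_{I_m}\text{ polynomial of degree}\le q\text{ in }t\text{ with values in }V_h\}$; $v_m^\pm=\lim_{\varepsilon\to0^+}v(t_m\pm\varepsilon)$, $[v]_m=v_m^+-v_m^-$; $$B(u,\varphi)=\sum_{m=1}^M(\partial_tu,\varphi)_{I_m\times\Omega}+(\nabla u,\nabla\varphi)_{I\times\Omega}+\sum_{m=2}^M([u]_{m-1},\varphi_{m-1}^+)_\Omega+(u_0^+,\varphi_0^+)_\Omega.$$ $\Delta_h:V_h\to V_h$: $(-\Delta_hv_h,\chi)_\Omega=(\nabla v_h,\nabla\chi)_\Omega$ for all $\chi\in V_h$; $P_h:L^2(\Omega)\to V_h$ is the $L^2$-orthogonal projection. *)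

theory Defs
  imports "HOL-Analysis.Analysis"
begin

definition lipschitz_domain :: "'d::euclidean_space set \<Rightarrow> bool" where
  "lipschitz_domain \<Omega> \<longleftrightarrow> open \<Omega> \<and> connected \<Omega> \<and> bounded \<Omega> \<and> \<Omega> \<noteq> {} \<and>
     (\<forall>x\<in>frontier \<Omega>. \<exists>r>0. \<exists>e::'d. norm e = 1 \<and>
        (\<exists>(g::'d \<Rightarrow> real) L. L-lipschitz_on UNIV g \<and>
           ball x r \<inter> \<Omega> = {y \<in> ball x r. y \<bullet> e < g (y - (y \<bullet> e) *\<^sub>R e)}))"

definition monom :: "('d \<Rightarrow> nat) \<Rightarrow> 'd::euclidean_space \<Rightarrow> real" where
  "monom \<alpha> x = (\<Prod>b\<in>Basis. (x \<bullet> b) ^ \<alpha> b)"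

definition P_idx :: "nat \<Rightarrow> ('d::euclidean_space \<Rightarrow> nat) set" where
  "P_idx r = {\<alpha>. (\<forall>b. b \<notin> Basis \<longrightarrow> \<alpha> b = 0) \<and> (\<Sum>b\<in>Basis. \<alpha> b) \<le> r}"

definition Q_idx :: "nat \<Rightarrow> ('d::euclidean_space \<Rightarrow> nat) set" where
  "Q_idx r = {\<alpha>. (\<forall>b. b \<notin> Basis \<longrightarrow> \<alpha> b = 0) \<and> (\<forall>b\<in>Basis. \<alpha> b \<le> r)}"

definition poly_on :: "('d::euclidean_space \<Rightarrow> nat) set \<Rightarrow> 'd set \<Rightarrow> ('d \<Rightarrow> real) \<Rightarrow> bool" where
  "poly_on A K f \<longleftrightarrow> (\<exists>c. \<forall>x\<in>K. f x = (\<Sum>\<alpha>\<in>A. c \<alpha> * monom \<alpha> x))"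

text \<open>Cells: simplices (triangles, tetrahedra) and images of the unit cube under an
  injective multilinear (Q_1) map (quadrilaterals, hexahedra).\<close>
definition simplex_cell :: "'d::euclidean_space set \<Rightarrow> bool" where
  "simplex_cell K \<longleftrightarrow> (\<exists>S. finite S \<and> card S = DIM('d) + 1 \<and> \<not> affine_dependent S \<and> K = convex hull S)"

definition cube_cell :: "'d::euclidean_space set \<Rightarrow> bool" where
  "cube_cell K \<longleftrightarrow> (\<exists>F::'d \<Rightarrow> 'd. (\<forall>b\<in>Basis. poly_on (Q_idx 1) UNIV (\<lambda>x. F x \<bullet> b)) \<and>
      inj_on F (cbox 0 One) \<and> K = F ` cbox 0 One)"

definition mesh_partition :: "'d::euclidean_space set \<Rightarrow> 'd set set \<Rightarrow> bool" where
  "mesh_partition \<Omega> \<T> \<longleftrightarrow> finite \<T> \<and> (\<forall>K\<in>\<T>. simplex_cell K \<or> cube_cell K) \<and>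
     \<Union>\<T> = closure \<Omega> \<and> (\<forall>K\<in>\<T>. \<forall>K'\<in>\<T>. K \<noteq> K' \<longrightarrow> interior K \<inter> interior K' = {})"

text \<open>Finite element space V_h: continuous functions vanishing outside \<Omega> (hence in H^1_0)
  which are polynomial (monomials in A) on each cell.\<close>
definition fe_space :: "'d::euclidean_space set \<Rightarrow> 'd set set \<Rightarrow> ('d \<Rightarrow> nat) set \<Rightarrow> ('d \<Rightarrow> real) set" where
  "fe_space \<Omega> \<T> A = {v. continuous_on UNIV v \<and> (\<forall>x. x \<notin> \<Omega> \<longrightarrow> v x = 0) \<and> (\<forall>K\<in>\<T>. poly_on A K v)}"

definition l2ip :: "'d::euclidean_space set \<Rightarrow> ('d \<Rightarrow> real) \<Rightarrow> ('d \<Rightarrow> real) \<Rightarrow> real" where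
  "l2ip \<Omega> f g = (LINT x:\<Omega>|lebesgue. f x * g x)"

text \<open>(a.e. classical) gradient; for piecewise polynomial continuous functions this is the weak gradient.\<close>
definition grad :: "('d::euclidean_space \<Rightarrow> real) \<Rightarrow> 'd \<Rightarrow> 'd" where
  "grad f x = (SOME D. GDERIV f x :> D)"

definition h1ip :: "'d::euclidean_space set \<Rightarrow> ('d \<Rightarrow> real) \<Rightarrow> ('d \<Rightarrow> real) \<Rightarrow> real" where
  "h1ip \<Omega> f g = (LINT x:\<Omega>|lebesgue. grad f x \<bullet> grad g x)"

definition disc_lap :: "'d::euclidean_space set \<Rightarrow> ('d \<Rightarrow> real) set \<Rightarrow> ('d \<Rightarrow> real) \<Rightarrow> ('d \<Rightarrow> real)" where
  "disc_lap \<Omega> V v = (THE w. w \<in> V \<and> (\<forall>\<psi>\<in>V. l2ip \<Omega> (\<lambda>x. - w x) \<psi> = h1ip \<Omega> v \<psi>))"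

definition l2proj :: "'d::euclidean_space set \<Rightarrow> ('d \<Rightarrow> real) set \<Rightarrow> ('d \<Rightarrow> real) \<Rightarrow> ('d \<Rightarrow> real)" where
  "l2proj \<Omega> V u = (THE w. w \<in> V \<and> (\<forall>\<psi>\<in>V. l2ip \<Omega> (\<lambda>x. u x - w x) \<psi> = 0))"

definition cpx :: "('d \<Rightarrow> real) \<Rightarrow> ('d \<Rightarrow> complex)" where
  "cpx v = (\<lambda>x. complex_of_real (v x))"

definition cplx_space :: "('d \<Rightarrow> real) set \<Rightarrow> ('d \<Rightarrow> complex) set" where
  "cplx_space V = {(\<lambda>x. complex_of_real (v x) + \<i> * complex_of_real (w x)) | v w. v \<in> V \<and> w \<in> V}"

definition cplx_lap :: "'d::euclidean_space set \<Rightarrow> ('d \<Rightarrow> real) set \<Rightarrow> ('d \<Rightarrow> complex) \<Rightarrow> ('d \<Rightarrow> complex)" where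
  "cplx_lap \<Omega> V f = (\<lambda>x. complex_of_real (disc_lap \<Omega> V (\<lambda>y. Re (f y)) x)
                        + \<i> * complex_of_real (disc_lap \<Omega> V (\<lambda>y. Im (f y)) x))"

definition resolvent :: "'d::euclidean_space set \<Rightarrow> ('d \<Rightarrow> real) set \<Rightarrow> complex \<Rightarrow> ('d \<Rightarrow> complex) \<Rightarrow> ('d \<Rightarrow> complex)" where
  "resolvent \<Omega> V z \<psi> = (THE w. w \<in> cplx_space V \<and> (\<lambda>x. z * w x + cplx_lap \<Omega> V w x) = \<psi>)"

definition sector :: "real \<Rightarrow> complex set" where
  "sector \<gamma> = {z. \<bar>Arg z\<bar> \<le> \<gamma>}"

definition is_norm_on :: "('d \<Rightarrow> complex) set \<Rightarrow> (('d \<Rightarrow> complex) \<Rightarrow> real) \<Rightarrow> bool" where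
  "is_norm_on W N \<longleftrightarrow> (\<forall>v\<in>W. 0 \<le> N v) \<and> (\<forall>v\<in>W. N v = 0 \<longleftrightarrow> v = (\<lambda>x. 0)) \<and>
     (\<forall>a. \<forall>v\<in>W. N (\<lambda>x. a * v x) = cmod a * N v) \<and>
     (\<forall>v\<in>W. \<forall>w\<in>W. N (\<lambda>x. v x + w x) \<le> N v + N w)"

definition time_partition :: "real \<Rightarrow> nat \<Rightarrow> (nat \<Rightarrow> real) \<Rightarrow> bool" where
  "time_partition T M t \<longleftrightarrow> M \<ge> 1 \<and> t 0 = 0 \<and> t M = T \<and> (\<forall>m<M. t m < t (Suc m))"

definition step :: "(nat \<Rightarrow> real) \<Rightarrow> nat \<Rightarrow> real" where
  "step t m = t m - t (m - 1)"

definition kmax :: "nat \<Rightarrow> (nat \<Rightarrow> real) \<Rightarrow> real" where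
  "kmax M t = Max (step t ` {1..M})"

definition kmin :: "nat \<Rightarrow> (nat \<Rightarrow> real) \<Rightarrow> real" where
  "kmin M t = Min (step t ` {1..M})"

definition admissible :: "real \<Rightarrow> real \<Rightarrow> real \<Rightarrow> real \<Rightarrow> nat \<Rightarrow> (nat \<Rightarrow> real) \<Rightarrow> bool" where
  "admissible T c \<beta> \<kappa> M t \<longleftrightarrow> time_partition T M t \<and>
     kmin M t \<ge> c * kmax M t powr \<beta> \<and>
     (\<forall>m. 1 \<le> m \<and> m < M \<longrightarrow> 1 / \<kappa> \<le> step t m / step t (Suc m) \<and> step t m / step t (Suc m) \<le> \<kappa>) \<and>
     kmax M t \<le> T / 4"

definition dG_space :: "('d \<Rightarrow> real) set \<Rightarrow> nat \<Rightarrow> nat \<Rightarrow> (nat \<Rightarrow> real) \<Rightarrow> (real \<Rightarrow> 'd \<Rightarrow> real) set" where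
  "dG_space V q M t = {u. \<forall>m\<in>{1..M}. \<exists>a::nat \<Rightarrow> ('d \<Rightarrow> real). (\<forall>j\<le>q. a j \<in> V) \<and>
      (\<forall>s\<in>{t (m - 1)<..t m}. u s = (\<lambda>x. \<Sum>j\<le>q. s ^ j * a j x))}"

definition dg_plus :: "(nat \<Rightarrow> real) \<Rightarrow> (real \<Rightarrow> 'd \<Rightarrow> real) \<Rightarrow> nat \<Rightarrow> 'd \<Rightarrow> real" where
  "dg_plus t u m = (\<lambda>x. Lim (at_right (t m)) (\<lambda>s. u s x))"

definition dg_minus :: "(nat \<Rightarrow> real) \<Rightarrow> (real \<Rightarrow> 'd \<Rightarrow> real) \<Rightarrow> nat \<Rightarrow> 'd \<Rightarrow> real" where
  "dg_minus t u m = (\<lambda>x. Lim (at_left (t m)) (\<lambda>s. u s x))"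

definition jump :: "(nat \<Rightarrow> real) \<Rightarrow> (real \<Rightarrow> 'd \<Rightarrow> real) \<Rightarrow> nat \<Rightarrow> 'd \<Rightarrow> real" where
  "jump t u m = (\<lambda>x. dg_plus t u m x - dg_minus t u m x)"

definition dtime :: "(nat \<Rightarrow> real) \<Rightarrow> (real \<Rightarrow> 'd \<Rightarrow> real) \<Rightarrow> nat \<Rightarrow> real \<Rightarrow> 'd \<Rightarrow> real" where
  "dtime t u m s = (\<lambda>x. vector_derivative (\<lambda>\<sigma>. u \<sigma> x) (at s within {t (m - 1)<..t m}))"

definition bilin :: "'d::euclidean_space set \<Rightarrow> nat \<Rightarrow> (nat \<Rightarrow> real) \<Rightarrow> (real \<Rightarrow> 'd \<Rightarrow> real) \<Rightarrow> (real \<Rightarrow> 'd \<Rightarrow> real) \<Rightarrow> real" where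
  "bilin \<Omega> M t u \<phi> =
     (\<Sum>m=1..M. integral {t (m - 1)..t m} (\<lambda>s. l2ip \<Omega> (dtime t u m s) (\<phi> s)))
     + integral {t 0..t M} (\<lambda>s. h1ip \<Omega> (u s) (\<phi> s))
     + (\<Sum>m=2..M. l2ip \<Omega> (jump t u (m - 1)) (dg_plus t \<phi> (m - 1)))
     + l2ip \<Omega> (dg_plus t u 0) (dg_plus t \<phi> 0)"

definition jump_ic :: "'d::euclidean_space set \<Rightarrow> ('d \<Rightarrow> real) set \<Rightarrow> ('d \<Rightarrow> real) \<Rightarrow> (nat \<Rightarrow> real) \<Rightarrow> (real \<Rightarrow> 'd \<Rightarrow> real) \<Rightarrow> nat \<Rightarrow> 'd \<Rightarrow> real" where
  "jump_ic \<Omega> V u0 t u m = (if m = 0 then (\<lambda>x. dg_plus t u 0 x - l2proj \<Omega> V u0 x) else jump t u m)"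

end

theory Submission
  imports Defs "HOL-Complex_Analysis.Cauchy_Integral_Formula" "HOL-Library.Function_Algebras"
    "HOL-Homology.Invariance_of_Domain"
begin

text \<open>In an \<open>L\<^sup>2\<close>-orthonormal eigenbasis of \<open>-\<Delta>\<^sub>h\<close> the scheme decouples into scalar problems, and the
  quantities to be bounded become \<open>A f(A) P\<^sub>h u\<^sub>0\<close>, where \<open>A = -\<Delta>\<^sub>h\<close> and \<open>f\<close> is a product of rational
  functions \<open>r(k\<^sub>l z)\<close> over the previous steps and one rational function of \<open>k\<^sub>m z\<close> for the current step.
  The energy identity of the scheme for complex \<open>z\<close> shows that the denominators do not vanish for
  \<open>Re z \<ge> 0\<close> and that \<open>\<bar>r(z)\<bar> \<le> 1 / (1 + c \<bar>z\<bar>)\<close> on a sector. Comparability of neighbouring steps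
  lets one split \<open>(0, t\<^sub>m)\<close> at a grid point into two parts of length comparable to \<open>t\<^sub>m\<close>, so that
  \<open>\<bar>f(z)\<bar> \<le> C / (1 + (c t\<^sub>m \<bar>z\<bar>)\<^sup>2)\<close> for \<open>m \<ge> 2\<close>. Cauchy's formula along the boundary of a slightly larger
  sector and the resolvent estimate then give the factor \<open>M\<^sub>h / t\<^sub>m\<close>. For \<open>m = 1\<close> the symbol decays only
  like \<open>1 / z\<close>; subtracting a multiple of \<open>1 / (1 + k\<^sub>1 z)\<close>, which is a single resolvent, restores
  quadratic decay.\<close>

text \<open>Every quantity to be bounded carries a factor \<open>A\<close>: the time derivative
  through the equation solved by the scalar solution, the jump because it equals
  \<open>- k_m A\<close> times a rational function of \<open>k_m A\<close>. On the contour this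
  factor \<open>z\<close> cancels the \<open>1 / |z|\<close> of the resolvent estimate, so
  \<open>f\<close> alone is integrated along two infinite rays. Decay like \<open>1 / z\<close>
  would let that integral diverge logarithmically; quadratic decay at the scale
  \<open>1 / t_m\<close> gives a constant over \<open>t_m\<close>. This is what makes two damped
  groups of steps necessary and the first step exceptional. The number of eigenvalues and their size
  enter the bound only through the far side of the contour, which disappears in the limit; hence no
  constant depends on \<open>h\<close>. The rays must avoid the closed sector of the resolvent
  estimate and lie in the half plane where the symbols are controlled; their angle is the mean of
  \<open>\<gamma>\<close> and \<open>pi / 2\<close>. The scalar solution is written with a
  polynomial that reproduces evaluation at 0. This yields a monic denominator of degree
  \<open>q + 1\<close> and numerators whose coefficients are bounded uniformly in time.\<close>

hide_const (open) module.smult up_ring.monom up_ring.coeff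

section \<open>The scalar discontinuous Galerkin step\<close>

text \<open>Rodrigues' formula for the polynomial that represents evaluation at \<open>0\<close>.\<close>
definition dg_bump :: "nat \<Rightarrow> real poly" where
  "dg_bump q = smult (1 / fact q) (Polynomial.monom 1 q * [:1, - 1:] ^ Suc q)"

definition dg_delta :: "nat \<Rightarrow> real poly" where
  "dg_delta q = - (pderiv ^^ Suc q) (dg_bump q)"

lemma degree_dg_bump: "degree (dg_bump q) = 2 * q + 1"
  by (simp add: dg_bump_def degree_mult_eq degree_monom_eq degree_power_eq del: power_Suc)

lemma degree_dg_delta: "degree (dg_delta q) = q"
  by (simp add: dg_delta_def degree_higher_pderiv degree_dg_bump del: funpow.simps)

text \<open>Differentiation lowers the multiplicity of a factor by at most one.\<close>

lemma power_dvd_higher_pderiv: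
  fixes a p :: "real poly"
  assumes "a ^ (j + n) dvd p"
  shows "a ^ n dvd (pderiv ^^ j) p"
  using assms
proof (induction j arbitrary: p)
  case (Suc j)
  obtain s where s: "p = a ^ Suc (j + n) * s" using Suc.prems by auto
  have "pderiv p = a ^ (j + n) * (smult (of_nat (Suc (j + n))) (pderiv a) * s + a * pderiv s)"
    unfolding s pderiv_mult pderiv_power_Suc by (simp add: algebra_simps)
  then have "a ^ (j + n) dvd pderiv p" by simp
  then show ?case using Suc.IH by (simp add: funpow_swap1)
qed auto

lemma higher_pderiv_dg_bump_1:
  assumes "j \<le> q"
  shows "poly ((pderiv ^^ j) (dg_bump q)) 1 = 0"
proof -
  have "[:1, - 1:] ^ Suc q dvd dg_bump q"
    unfolding dg_bump_def by (intro dvd_smult dvd_triv_right)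
  then have "[:1, - 1:] ^ (j + 1) dvd dg_bump q"
    using assms le_imp_power_dvd[of "j + 1" "Suc q" "[:1, - 1:] :: real poly"] by (auto intro: dvd_trans simp del: power_Suc)
  then have "[:1, - 1:] ^ 1 dvd (pderiv ^^ j) (dg_bump q)"
    by (rule power_dvd_higher_pderiv)
  then show ?thesis by auto
qed

text \<open>The bump has a zero of order \<open>q\<close> at 0, and the factor
  \<open>1 / fact q\<close> normalizes the first surviving derivative to 1. That derivative becomes
  the boundary term which evaluates at 0.\<close>

lemma higher_pderiv_dg_bump_0:
  "j < q \<Longrightarrow> poly ((pderiv ^^ j) (dg_bump q)) 0 = 0"
  "poly ((pderiv ^^ q) (dg_bump q)) 0 = 1"
proof -
  have c: "coeff (dg_bump q) j = (if j < q then 0 else 1 / fact q * coeff ([:1, - 1:] ^ Suc q) (j - q))" for j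
    by (simp add: dg_bump_def coeff_monom_mult del: power_Suc)
  show "j < q \<Longrightarrow> poly ((pderiv ^^ j) (dg_bump q)) 0 = 0"
    by (simp add: poly_0_coeff_0 coeff_higher_pderiv c)
  show "poly ((pderiv ^^ q) (dg_bump q)) 0 = 1"
    by (simp add: poly_0_coeff_0 coeff_higher_pderiv c coeff_0_power pochhammer_fact[symmetric])
qed

section \<open>Integrals of polynomials over the unit interval\<close>

definition poly_int :: "real poly \<Rightarrow> real" where
  "poly_int p = integral {0..1} (poly p)"

lemma poly_integrable: "poly p integrable_on {a..b :: real}"
  by (intro integrable_continuous_interval continuous_on_poly continuous_on_id)

lemma poly_int_add: "poly_int (p + r) = poly_int p + poly_int r"
proof -
  have "poly (p + r) = (\<lambda>x. poly p x + poly r x)" by auto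
  then show ?thesis unfolding poly_int_def by (simp add: integral_add poly_integrable)
qed

lemma poly_int_smult: "poly_int (smult c p) = c * poly_int p"
proof -
  have "poly (smult c p) = (\<lambda>x. c * poly p x)" by auto
  then show ?thesis unfolding poly_int_def by simp
qed

lemma poly_int_0 [simp]: "poly_int 0 = 0"
  using poly_int_smult[of 0 0] by simp

lemma poly_int_minus: "poly_int (- p) = - poly_int p"
  using poly_int_smult[of "-1" p] by simp

lemma poly_int_diff: "poly_int (p - r) = poly_int p - poly_int r"
  using poly_int_add[of p "- r"] by (simp add: poly_int_minus)

lemma poly_int_square_nonneg: "0 \<le> poly_int (p * p)"
  unfolding poly_int_def by (intro integral_nonneg poly_integrable) auto

lemma poly_int_square_eq_0:
  assumes "poly_int (p * p) = 0"
  shows "p = 0"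
proof -
  have "poly (p * p) x = 0" if "x \<in> {0..1}" for x
    using assms that unfolding poly_int_def
    by (subst (asm) integral_eq_0_iff) (auto intro!: continuous_intros)
  then have "{0..1} \<subseteq> {x. poly p x = 0}" by auto
  moreover have "infinite {0..1::real}" by (simp add: infinite_Icc)
  ultimately have "infinite {x. poly p x = 0}" using finite_subset by blast
  then show ?thesis using poly_roots_finite by blast
qed

lemma integral_poly_pderiv:
  fixes p :: "real poly"
  assumes "a \<le> b"
  shows "integral {a..b} (poly (pderiv p)) = poly p b - poly p a"
proof (intro integral_unique fundamental_theorem_of_calculus assms)
  show "(poly p has_vector_derivative poly (pderiv p) x) (at x within {a..b})" for x
    unfolding has_real_derivative_iff_has_vector_derivative[symmetric]
    by (intro DERIV_subset[OF poly_DERIV]) auto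
qed

lemma poly_int_by_parts:
  "poly_int (pderiv p * r) = poly (p * r) 1 - poly (p * r) 0 - poly_int (p * pderiv r)"
proof -
  have "poly_int (pderiv (p * r)) = poly (p * r) 1 - poly (p * r) 0"
    unfolding poly_int_def by (rule integral_poly_pderiv) simp
  then show ?thesis
    by (simp add: pderiv_mult poly_int_add mult.commute)
qed

text \<open>Integration by parts moves all \<open>j\<close> derivatives onto \<open>p\<close>, whose
  degree is below \<open>j\<close>. The boundary terms vanish because the derivatives of the bump of
  order below \<open>q\<close> vanish at both ends.\<close>

lemma poly_int_higher_pderiv_dg_bump:
  assumes "j \<le> q" "degree p < j \<or> p = 0"
  shows "poly_int ((pderiv ^^ j) (dg_bump q) * p) = 0"
  using assms
proof (induction j arbitrary: p)
  case (Suc j)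
  have "degree (pderiv p) < j \<or> pderiv p = 0"
    using Suc.prems(2) by (cases "degree p = 0") (auto simp: degree_pderiv pderiv_eq_0_iff)
  then show ?case
    using Suc higher_pderiv_dg_bump_1[of j q] higher_pderiv_dg_bump_0(1)[of j q]
    by (simp add: poly_int_by_parts)
qed auto

text \<open>One integration by parts leaves the boundary term at 0, where the \<open>q\<close>-th
  derivative of the bump is 1, and an integral against \<open>pderiv p\<close>, which is zero by
  orthogonality to lower degrees.\<close>

lemma dg_delta_reproducing:
  assumes "degree p \<le> q"
  shows "poly_int (dg_delta q * p) = poly p 0"
proof -
  have "degree (pderiv p) < q \<or> pderiv p = 0"
    using assms by (cases "degree p = 0") (auto simp: degree_pderiv pderiv_eq_0_iff)
  then have "poly_int ((pderiv ^^ q) (dg_bump q) * pderiv p) = 0"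
    by (rule poly_int_higher_pderiv_dg_bump[rotated]) auto
  then have "poly_int (pderiv ((pderiv ^^ q) (dg_bump q)) * p) = - poly p 0"
    unfolding poly_int_by_parts
    using higher_pderiv_dg_bump_1[of q q] higher_pderiv_dg_bump_0(2)[of q] by simp
  then show ?thesis
    by (simp add: dg_delta_def poly_int_minus)
qed

lemma dg_delta_nonzero: "dg_delta q \<noteq> 0"
  using dg_delta_reproducing[of 1 q] by auto

section \<open>The explicit solution of the scalar step\<close>

definition dg_comb :: "nat \<Rightarrow> (nat \<Rightarrow> real) \<Rightarrow> real poly" where
  "dg_comb q h = (\<Sum>j\<le>q. smult ((-1) ^ (q - j) * h j) ((pderiv ^^ (q - j)) (dg_delta q)))"

definition dg_ncoeff :: "nat \<Rightarrow> real \<Rightarrow> nat \<Rightarrow> real" where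
  "dg_ncoeff q \<theta> j = (-1) ^ (q - j) * poly ((pderiv ^^ (q - j)) (dg_delta q)) \<theta>"

text \<open>With initial value \<open>y\<close>, the discontinuous Galerkin solution of \<open>p' + z p = 0\<close> on the unit
  interval is \<open>y n(\<theta>, z) / Q(z)\<close>, where \<open>n(\<theta>, \<cdot>)\<close> has the coefficients \<^term>\<open>dg_ncoeff q \<theta>\<close> and
  \<open>Q\<close> is \<open>dg_den q\<close>; up to the factor \<open>z\<close>, its derivative has the coefficients
  \<open>dg_dcoeff q \<theta>\<close>.\<close>
definition dg_dcoeff :: "nat \<Rightarrow> real \<Rightarrow> nat \<Rightarrow> real" where
  "dg_dcoeff q \<theta> j = (if j = q then poly (dg_delta q) \<theta> else 0) - dg_ncoeff q \<theta> j"

definition polyval :: "nat \<Rightarrow> (nat \<Rightarrow> real) \<Rightarrow> 'a::real_normed_field \<Rightarrow> 'a" where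
  "polyval q a z = (\<Sum>j\<le>q. of_real (a j) * z ^ j)"

definition dg_den :: "nat \<Rightarrow> 'a::real_normed_field \<Rightarrow> 'a" where
  "dg_den q z = z ^ Suc q + polyval q (dg_ncoeff q 0) z"

lemma polyval_of_real: "polyval q a (of_real x) = of_real (polyval q a x)"
  by (simp add: polyval_def)

lemma dg_den_of_real: "dg_den q (of_real x) = of_real (dg_den q x)"
  by (simp add: dg_den_def polyval_of_real)

lemma poly_dg_comb: "poly (dg_comb q h) \<theta> = (\<Sum>j\<le>q. h j * dg_ncoeff q \<theta> j)"
  by (simp add: dg_comb_def dg_ncoeff_def poly_sum algebra_simps)

lemma degree_dg_comb: "degree (dg_comb q h) \<le> q"
  unfolding dg_comb_def
  by (intro degree_sum_le) (auto simp: degree_higher_pderiv degree_dg_delta)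

lemma pderiv_sum: "pderiv (sum f A) = (\<Sum>x\<in>A. pderiv (f x :: real poly))"
  by (induction A rule: infinite_finite_induct) (auto simp: pderiv_add)

text \<open>The alternating signs turn differentiation into a shift of the coefficients, up to the
  term of index \<open>q\<close>, which is added and subtracted. With \<open>h j = z ^ j\<close> and
  \<open>p = dg_comb q h\<close> this reads \<open>p' + z p = z ^ Suc q \<delta>\<close>, where
  \<open>\<delta> = dg_delta q\<close> represents evaluation at 0; so \<open>p\<close> solves the
  scheme up to normalization.\<close>

lemma pderiv_dg_comb:
  "pderiv (dg_comb q h) = smult (h (Suc q)) (dg_delta q) - dg_comb q (\<lambda>j. h (Suc j))"
proof -
  define D where "D i = (pderiv ^^ i) (dg_delta q)" for i
  have D0: "D (Suc q) = 0"
    proof -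
    have "degree ((pderiv ^^ q) (dg_delta q)) = 0"
      by (simp add: degree_higher_pderiv degree_dg_delta)
    then show ?thesis by (simp add: D_def pderiv_eq_0_iff)
  qed
  have P: "pderiv (D i) = D (Suc i)" for i by (simp add: D_def)
  have "pderiv (dg_comb q h) = (\<Sum>j\<le>q. smult ((-1) ^ (q - j) * h j) (D (Suc (q - j))))"
    unfolding dg_comb_def D_def[symmetric] by (simp add: pderiv_sum pderiv_smult P)
  also have "\<dots> = (\<Sum>j<q. smult ((-1) ^ (q - Suc j) * h (Suc j)) (D (Suc (q - Suc j))))"
    unfolding lessThan_Suc_atMost[symmetric] by (subst sum.lessThan_Suc_shift) (simp add: D0)
  also have "\<dots> = (\<Sum>j<q. - smult ((-1) ^ (q - j) * h (Suc j)) (D (q - j)))"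
  proof (intro sum.cong refl)
    fix j assume "j \<in> {..<q}"
    then have "q - j = Suc (q - Suc j)" by auto
    then show "smult ((-1) ^ (q - Suc j) * h (Suc j)) (D (Suc (q - Suc j))) = - smult ((-1) ^ (q - j) * h (Suc j)) (D (q - j))"
      by simp
  qed
  also have "\<dots> = smult (h (Suc q)) (D 0) - dg_comb q (\<lambda>j. h (Suc j))"
    unfolding dg_comb_def D_def[symmetric] lessThan_Suc_atMost[symmetric]
    by (simp add: sum_negf)
  finally show ?thesis by (simp add: D_def)
qed

text \<open>Since polynomials in time are kept real, a complex solution is carried as the pair of
  its real and imaginary parts.\<close>

lemma polyval_dg_ncoeff:
  fixes z :: complex
  shows "polyval q (dg_ncoeff q \<theta>) z =
    Complex (poly (dg_comb q (\<lambda>j. Re (z ^ j))) \<theta>) (poly (dg_comb q (\<lambda>j. Im (z ^ j))) \<theta>)"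
  by (simp add: polyval_def poly_dg_comb complex_eq_iff mult.commute)

lemma polyval_dg_ncoeff_real:
  fixes x :: real
  shows "polyval q (dg_ncoeff q \<theta>) x = poly (dg_comb q (\<lambda>j. x ^ j)) \<theta>"
  by (simp add: polyval_def poly_dg_comb mult.commute)

lemma dg_comb_diff: "dg_comb q (\<lambda>j. g j - h j) = dg_comb q g - dg_comb q h"
  by (simp add: dg_comb_def algebra_simps smult_diff_left sum_subtractf)

lemma dg_comb_add: "dg_comb q (\<lambda>j. g j + h j) = dg_comb q g + dg_comb q h"
  by (simp add: dg_comb_def algebra_simps smult_add_left sum.distrib)

lemma smult_sum_right: "smult c (sum f A) = (\<Sum>x\<in>A. smult c (f x :: real poly))"
  by (induction A rule: infinite_finite_induct) (auto simp: smult_add_right)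

lemma dg_comb_mult: "dg_comb q (\<lambda>j. c * h j) = smult c (dg_comb q h)"
  by (simp add: dg_comb_def smult_sum_right mult.left_commute)

lemma poly_int_pderiv_self: "2 * poly_int (pderiv p * p) = (poly p 1)\<^sup>2 - (poly p 0)\<^sup>2"
  using poly_int_by_parts[of p p] by (simp add: mult.commute power2_eq_square)

section \<open>The energy identity and its consequences: no poles in the right half plane,
  uniqueness\<close>

definition dg_energy :: "nat \<Rightarrow> complex \<Rightarrow> real" where
  "dg_energy q z = poly_int (dg_comb q (\<lambda>j. Re (z ^ j)) * dg_comb q (\<lambda>j. Re (z ^ j)))
                 + poly_int (dg_comb q (\<lambda>j. Im (z ^ j)) * dg_comb q (\<lambda>j. Im (z ^ j)))"

lemma dg_energy_nonneg: "0 \<le> dg_energy q z"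
  by (simp add: dg_energy_def poly_int_square_nonneg)

text \<open>Test \<open>p' + z p = w \<delta>\<close>, \<open>w = z ^ Suc q\<close>, with the
  conjugate of \<open>p\<close> and take real parts. As \<open>dg_den q z = w + p(0)\<close>, adding
  the squared modulus of \<open>w\<close> on both sides completes the square; this extra term is the
  energy of the jump.\<close>

lemma dg_energy_identity:
  "(cmod (polyval q (dg_ncoeff q 1) z))\<^sup>2 + (cmod z ^ Suc q)\<^sup>2 + 2 * Re z * dg_energy q z
    = (cmod (dg_den q z))\<^sup>2"
proof -
  define A where "A = dg_comb q (\<lambda>j. Re (z ^ j))"
  define B where "B = dg_comb q (\<lambda>j. Im (z ^ j))"
  define w where "w = z ^ Suc q"
  have dA: "pderiv A = smult (Re w) (dg_delta q) - smult (Re z) A + smult (Im z) B"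
    unfolding A_def B_def pderiv_dg_comb w_def by (simp add: dg_comb_diff dg_comb_mult)
  have dB: "pderiv B = smult (Im w) (dg_delta q) - smult (Re z) B - smult (Im z) A"
    unfolding A_def B_def pderiv_dg_comb w_def by (simp add: dg_comb_add dg_comb_mult)
  have dl: "poly_int (dg_delta q * A) = poly A 0" "poly_int (dg_delta q * B) = poly B 0"
    by (simp_all add: A_def B_def dg_delta_reproducing degree_dg_comb)
  note dl = dl dl[unfolded mult.commute[of "dg_delta q"]]
  have "poly_int (pderiv A * A) = Re w * poly A 0 - Re z * poly_int (A * A) + Im z * poly_int (A * B)"
    unfolding dA by (simp add: algebra_simps poly_int_add poly_int_diff poly_int_smult dl)
  moreover have "poly_int (pderiv B * B) = Im w * poly B 0 - Re z * poly_int (B * B) - Im z * poly_int (A * B)"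
    unfolding dB by (simp add: algebra_simps poly_int_add poly_int_diff poly_int_smult dl)
  moreover have "2 * Re z * dg_energy q z = 2 * (Re z * poly_int (A * A)) + 2 * (Re z * poly_int (B * B))"
    by (simp add: A_def B_def dg_energy_def algebra_simps)
  \<comment> \<open>The mixed terms \<open>Im z * poly_int (A * B)\<close> cancel in the sum of the
    two equations.\<close>
  ultimately have "(poly A 1)\<^sup>2 + (poly B 1)\<^sup>2 + 2 * Re z * dg_energy q z
      = (poly A 0)\<^sup>2 + (poly B 0)\<^sup>2 + 2 * (Re w * poly A 0 + Im w * poly B 0)"
    using poly_int_pderiv_self[of A] poly_int_pderiv_self[of B]
    by (simp add: distrib_left)
  moreover have "(cmod z ^ Suc q)\<^sup>2 = (Re w)\<^sup>2 + (Im w)\<^sup>2"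
    using cmod_power2[of w] by (simp add: w_def norm_power norm_mult)
  moreover have "(cmod (dg_den q z))\<^sup>2 = (Re w + poly A 0)\<^sup>2 + (Im w + poly B 0)\<^sup>2"
    unfolding dg_den_def polyval_dg_ncoeff cmod_power2 by (simp add: A_def B_def w_def)
  moreover have "(cmod (polyval q (dg_ncoeff q 1) z))\<^sup>2 = (poly A 1)\<^sup>2 + (poly B 1)\<^sup>2"
    unfolding polyval_dg_ncoeff cmod_power2 by (simp add: A_def B_def)
  ultimately show ?thesis by (simp add: power2_sum algebra_simps)
qed

lemma dg_den_ge:
  assumes "0 \<le> Re z"
  shows "cmod z ^ Suc q \<le> cmod (dg_den q z)"
proof (rule power2_le_imp_le)
  have "0 \<le> 2 * Re z * dg_energy q z" using assms dg_energy_nonneg by simp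
  moreover have "0 \<le> (cmod (polyval q (dg_ncoeff q 1) z))\<^sup>2" by simp
  ultimately show "(cmod z ^ Suc q)\<^sup>2 \<le> (cmod (dg_den q z))\<^sup>2"
    using dg_energy_identity[of q z] by linarith
qed simp

text \<open>By the lower bound a zero could only sit at the origin. There the value is, up to sign
  and the factor \<open>fact q\<close>, the leading coefficient of
  \<open>dg_delta q\<close>.\<close>

lemma dg_den_nonzero:
  fixes z :: complex
  assumes "0 \<le> Re z"
  shows "dg_den q z \<noteq> 0"
proof
  assume 0: "dg_den q z = 0"
  have "cmod z ^ Suc q \<le> 0"
    using dg_den_ge[OF assms, of q] 0 by simp
  then have z: "z = 0"
    using zero_less_power[of "cmod z" "Suc q"] by (meson linorder_not_le norm_le_zero_iff)
  have "coeff (dg_delta q) q \<noteq> 0"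
    using dg_delta_nonzero[of q] degree_dg_delta[of q] leading_coeff_0_iff by metis
  moreover have "polyval q (dg_ncoeff q 0) (0::complex) = of_real (dg_ncoeff q 0 0)"
    unfolding polyval_def by (subst sum.remove[of _ 0]) auto
  ultimately show False
    using 0 unfolding z dg_den_def
    by (simp add: dg_ncoeff_def poly_0_coeff_0 coeff_higher_pderiv pochhammer_fact[symmetric])
qed

lemma dg_den_real_nonzero:
  fixes x :: real
  assumes "0 \<le> x"
  shows "dg_den q x \<noteq> 0"
  using dg_den_nonzero[of "of_real x" q] assms by (simp add: dg_den_of_real)

lemma dg_comb_power_solves:
  fixes x :: real
  assumes "degree p \<le> q"
  shows "poly_int ((pderiv (dg_comb q (\<lambda>j. x ^ j)) + smult x (dg_comb q (\<lambda>j. x ^ j))) * p)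
     + poly (dg_comb q (\<lambda>j. x ^ j)) 0 * poly p 0 = dg_den q x * poly p 0"
  unfolding pderiv_dg_comb using assms
  using dg_delta_reproducing[OF assms]
  by (simp add: dg_comb_mult poly_int_smult dg_den_def polyval_dg_ncoeff_real distrib_right)

text \<open>The difference \<open>d\<close> to the explicit solution solves the homogeneous problem.
  Testing with \<open>d\<close> itself settles \<open>x > 0\<close>; for \<open>x = 0\<close> the
  energy sees the end values only, and \<open>pderiv d\<close> is used as a second test
  polynomial.\<close>

lemma dg_solution_unique:
  fixes x y :: real
  assumes x: "0 \<le> x" and p: "degree p \<le> q"
    and eq: "\<And>r. degree r \<le> q \<Longrightarrow>
      poly_int ((pderiv p + smult x p) * r) + poly p 0 * poly r 0 = y * poly r 0"
  shows "poly p \<theta> = y * polyval q (dg_ncoeff q \<theta>) x / dg_den q x"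
proof -
  define G where "G = dg_comb q (\<lambda>j. x ^ j)"
  define d where "d = p - smult (y / dg_den q x) G"
  have deg: "degree d \<le> q"
    unfolding d_def G_def by (intro degree_diff_le p) (auto simp: degree_dg_comb intro: order_trans[OF degree_smult_le])
  have hom: "poly_int ((pderiv d + smult x d) * r) + poly d 0 * poly r 0 = 0" if "degree r \<le> q" for r
  proof -
    have "(pderiv d + smult x d) * r = (pderiv p + smult x p) * r
        - smult (y / dg_den q x) ((pderiv G + smult x G) * r)"
      by (simp add: d_def pderiv_diff pderiv_smult algebra_simps smult_diff_right smult_add_right)
    moreover have "poly_int ((pderiv G + smult x G) * r) = dg_den q x * poly r 0 - poly G 0 * poly r 0"
      using dg_comb_power_solves[OF that, of x] by (simp add: G_def)
    moreover have "poly_int ((pderiv p + smult x p) * r) = y * poly r 0 - poly p 0 * poly r 0"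
      using eq[OF that] by simp
    ultimately show ?thesis
      using dg_den_real_nonzero[OF x, of q]
      by (simp only: poly_int_diff poly_int_smult) (simp add: d_def field_simps)
  qed
  have "poly_int (pderiv d * d) + x * poly_int (d * d) + (poly d 0)\<^sup>2 = 0"
    using hom[OF deg] by (simp add: algebra_simps poly_int_add poly_int_smult power2_eq_square)
  then have e: "(poly d 1)\<^sup>2 + (poly d 0)\<^sup>2 + 2 * (x * poly_int (d * d)) = 0"
    using poly_int_pderiv_self[of d] by simp
  have nn: "0 \<le> x * poly_int (d * d)" using x poly_int_square_nonneg by simp
  have "(poly d 0)\<^sup>2 = 0" and xd: "x * poly_int (d * d) = 0"
    using e nn zero_le_power2[of "poly d 0"] zero_le_power2[of "poly d 1"] by linarith+
  then have d0: "poly d 0 = 0" by simp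
  have "d = 0"
  proof (cases "x = 0")
    case True
    have "degree (pderiv d) \<le> q" using deg by (simp add: degree_pderiv)
    then have "pderiv d = 0"
      using hom[of "pderiv d"] d0 True by (auto intro: poly_int_square_eq_0)
    then show ?thesis
      using d0 by (auto simp: pderiv_eq_0_iff elim: degree_eq_zeroE)
  next
    case False
    then show ?thesis using xd poly_int_square_eq_0 by simp
  qed
  then have "p = smult (y / dg_den q x) G" by (simp add: d_def)
  then show ?thesis by (simp add: G_def polyval_dg_ncoeff_real)
qed

section \<open>Change of variables, and a trace inequality at the right end\<close>

lemma integral_poly_affine:
  assumes "0 < k"
  shows "integral {a..a + k} (poly p) = k * poly_int (pcompose p [:a, k:])"
proof -
  have "((\<lambda>x. poly p (k *\<^sub>R x + a)) has_integral (integral {a..a + k} (poly p) /\<^sub>R k ^ DIM(real)))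
      (cbox ((a - a) /\<^sub>R k) ((a + k - a) /\<^sub>R k))"
    using assms by (intro has_integral_affinity') (simp_all add: integrable_integral poly_integrable)
  moreover have "(\<lambda>x. poly p (k *\<^sub>R x + a)) = poly (pcompose p [:a, k:])"
    by (auto simp: poly_pcompose algebra_simps)
  ultimately have "(poly (pcompose p [:a, k:]) has_integral (integral {a..a + k} (poly p) / k)) {0..1}"
    using assms by (simp add: divide_inverse mult.commute)
  then show ?thesis
    using assms by (simp add: poly_int_def integral_unique)
qed

lemma poly_int_reflect: "poly_int (pcompose p [:1, - 1:]) = poly_int p"
proof -
  have "poly_int p = poly_int (pcompose (pcompose p [:1, 1:]) [:-1, 1:])"
    by (simp add: pcompose_assoc[symmetric] pcompose_pCons)
  also have "\<dots> = integral {-1..0} (poly (pcompose p [:1, 1:]))"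
    using integral_poly_affine[of 1 "-1" "pcompose p [:1, 1:]"] by simp
  also have "\<dots> = integral {0..1} (\<lambda>x. poly (pcompose p [:1, 1:]) (- x))"
    using Henstock_Kurzweil_Integration.integral_reflect_real[of 1 0 "\<lambda>x. poly (pcompose p [:1, 1:]) (- x)"] by simp
  also have "(\<lambda>x. poly (pcompose p [:1, 1:]) (- x)) = poly (pcompose p [:1, - 1:])"
    by (auto simp: poly_pcompose)
  finally show ?thesis by (simp add: poly_int_def)
qed

text \<open>Cauchy-Schwarz against the reproducing polynomial, after reflecting the interval so that
  evaluation at 1 becomes evaluation at 0. The squared norm of \<open>dg_delta q\<close> is its own
  value at 0.\<close>

lemma poly_1_square_le:
  assumes "degree p \<le> q"
  shows "(poly p 1)\<^sup>2 \<le> poly (dg_delta q) 0 * poly_int (p * p)"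
    and "0 < poly (dg_delta q) 0"
proof -
  define D where "D = poly (dg_delta q) 0"
  define s where "s = pcompose p [:1, - 1:]"
  have DD: "poly_int (dg_delta q * dg_delta q) = D"
    unfolding D_def by (rule dg_delta_reproducing) (simp add: degree_dg_delta)
  show D: "0 < poly (dg_delta q) 0"
    using DD poly_int_square_nonneg[of "dg_delta q"] poly_int_square_eq_0[of "dg_delta q"] dg_delta_nonzero[of q]
    unfolding D_def by linarith
  have s: "poly_int (dg_delta q * s) = poly p 1"
    unfolding s_def using assms by (subst dg_delta_reproducing) (auto simp: poly_pcompose degree_pcompose)
  have ss: "poly_int (s * s) = poly_int (p * p)"
    unfolding s_def pcompose_mult[symmetric] by (rule poly_int_reflect)
  \<comment> \<open>The coefficient of the orthogonal projection of \<open>s\<close> onto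
    \<open>dg_delta q\<close>, which makes the square below minimal.\<close>
  define c where "c = poly p 1 / D"
  have "0 \<le> poly_int ((s - smult c (dg_delta q)) * (s - smult c (dg_delta q)))"
    by (rule poly_int_square_nonneg)
  also have "\<dots> = poly_int (p * p) - 2 * c * poly p 1 + c\<^sup>2 * D"
    by (simp add: left_diff_distrib right_diff_distrib poly_int_diff poly_int_add poly_int_smult ss DD s s[unfolded mult.commute[of "dg_delta q"]] power2_eq_square)
  also have "\<dots> = poly_int (p * p) - (poly p 1)\<^sup>2 / D"
    using D by (simp add: c_def D_def field_simps power2_eq_square)
  finally show "(poly p 1)\<^sup>2 \<le> poly (dg_delta q) 0 * poly_int (p * p)"
    using D by (simp add: D_def field_simps)
qed

lemma polyval_bound:
  fixes z :: complex
  assumes "\<And>j. j \<le> q \<Longrightarrow> \<bar>a j\<bar> \<le> K"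
  shows "cmod z \<le> 1 \<Longrightarrow> cmod (polyval q a z) \<le> real (Suc q) * K"
    and "1 \<le> cmod z \<Longrightarrow> cmod (polyval q a z) \<le> real (Suc q) * K * cmod z ^ q"
proof -
  have K: "0 \<le> K" using assms[of 0] by auto
  show "cmod (polyval q a z) \<le> real (Suc q) * K" if "cmod z \<le> 1"
  proof -
    have "cmod (polyval q a z) \<le> (\<Sum>j\<le>q. K)"
      unfolding polyval_def
    proof (intro sum_norm_le)
      fix j assume "j \<in> {..q}"
      then have "\<bar>a j\<bar> * cmod z ^ j \<le> K * 1"
        using assms that K by (intro mult_mono power_le_one) auto
      then show "cmod (of_real (a j) * z ^ j) \<le> K" by (simp add: norm_mult norm_power)
    qed
    then show ?thesis by simp
  qed
  show "cmod (polyval q a z) \<le> real (Suc q) * K * cmod z ^ q" if "1 \<le> cmod z"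
  proof -
    have "cmod (polyval q a z) \<le> (\<Sum>j\<le>q. K * cmod z ^ q)"
      unfolding polyval_def
    proof (intro sum_norm_le)
      fix j assume "j \<in> {..q}"
      then have "\<bar>a j\<bar> * cmod z ^ j \<le> K * cmod z ^ q"
        using assms that K by (intro mult_mono power_increasing) auto
      then show "cmod (of_real (a j) * z ^ j) \<le> K * cmod z ^ q" by (simp add: norm_mult norm_power)
    qed
    then show ?thesis by simp
  qed
qed

text \<open>The term \<^term>\<open>2 * Re z * dg_energy q z\<close> of the energy identity controls the damping for
  small \<^term>\<open>z\<close>, the term \<^term>\<open>(cmod z ^ Suc q)\<^sup>2\<close> the one for large \<^term>\<open>z\<close>.\<close>
lemma dg_damping:
  assumes \<sigma>: "0 < \<sigma>"
  shows "\<exists>c>0. \<forall>z. \<sigma> * cmod z \<le> Re z \<longrightarrow>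
    cmod (polyval q (dg_ncoeff q 1) z) * (1 + c * cmod z) \<le> cmod (dg_den q z)"
proof -
  define D where "D = poly (dg_delta q) 0"
  define K where "K = 1 + real (Suc q) * (\<Sum>j\<le>q. \<bar>dg_ncoeff q 1 j\<bar>)"
  \<comment> \<open>The bound by \<open>\<sigma> / (2 * D)\<close> absorbs the cross term
    \<open>2 * c * x * n\<^sup>2\<close> through the trace inequality. The bound by
    \<open>1 / K\<close> lets the jump term dominate \<open>(c * x * n)\<^sup>2\<close> for
    \<open>x > 1\<close>; the summand 1 in \<open>K\<close> avoids a division by zero.\<close>
  define c where "c = min 1 (min (\<sigma> / (2 * D)) (1 / K))"
  have D: "0 < D" unfolding D_def by (rule poly_1_square_le(2)[of 0]) simp
  have K: "1 \<le> K" by (simp add: K_def sum_nonneg)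
  have c: "0 < c" "c \<le> 1" "c * (2 * D) \<le> \<sigma>" "c * K \<le> 1"
  proof -
    have "c \<le> \<sigma> / (2 * D)" "c \<le> 1 / K" by (simp_all add: c_def)
    then show "c * (2 * D) \<le> \<sigma>" "c * K \<le> 1"
      using D K by (simp_all add: pos_le_divide_eq)
    show "0 < c" "c \<le> 1" using D K \<sigma> by (simp_all add: c_def)
  qed
  have "cmod (polyval q (dg_ncoeff q 1) z) * (1 + c * cmod z) \<le> cmod (dg_den q z)"
    if z: "\<sigma> * cmod z \<le> Re z" for z
  proof (rule power2_le_imp_le)
    define x where "x = cmod z"
    define n where "n = cmod (polyval q (dg_ncoeff q 1) z)"
    define J where "J = dg_energy q z"
    have x: "0 \<le> x" and n: "0 \<le> n" by (simp_all add: x_def n_def)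
    have J: "0 \<le> J" by (simp add: J_def dg_energy_nonneg)
    have nJ: "n\<^sup>2 \<le> D * J"
      using poly_1_square_le(1)[OF degree_dg_comb, of q "\<lambda>j. Re (z ^ j)"]
        poly_1_square_le(1)[OF degree_dg_comb, of q "\<lambda>j. Im (z ^ j)"]
      by (simp add: n_def J_def D_def polyval_dg_ncoeff cmod_power2 dg_energy_def distrib_left)
    have small: "2 * c * x * n\<^sup>2 \<le> \<sigma> * x * J"
    proof -
      have "2 * c * x * n\<^sup>2 \<le> 2 * c * x * (D * J)"
        using nJ c x by (intro mult_left_mono) auto
      also have "\<dots> = (c * (2 * D)) * (x * J)" by simp
      also have "\<dots> \<le> \<sigma> * (x * J)" using c x J by (intro mult_right_mono) auto
      finally show ?thesis by simp
    qed
    \<comment> \<open>The energy identity offers \<open>\<sigma> * x * J\<close> twice. One copy is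
      spent on \<open>small\<close>; the other serves here when \<open>x \<le> 1\<close>, and the
      jump term serves for larger \<open>x\<close>.\<close>
    have large: "(c * x * n)\<^sup>2 \<le> (x ^ Suc q)\<^sup>2 + \<sigma> * x * J"
    proof (cases "x \<le> 1")
      case True
      have "c * x * (c * x) \<le> 1 * (c * x)"
        using c x True by (intro mult_right_mono) (auto intro: mult_le_one)
      then have "(c * x * n)\<^sup>2 \<le> c * x * n\<^sup>2"
        using mult_right_mono[of "c * x * (c * x)" "1 * (c * x)" "n\<^sup>2"]
        by (simp add: power_mult_distrib power2_eq_square mult_ac)
      also have "\<dots> \<le> \<sigma> * x * J"
      proof -
        have "0 \<le> c * x * n\<^sup>2" using c x by simp
        then show ?thesis using small by linarith
      qed
      finally show ?thesis using zero_le_power2[of "x ^ Suc q"] by linarith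
    next
      case False
      have "\<bar>dg_ncoeff q 1 j\<bar> \<le> (\<Sum>j\<le>q. \<bar>dg_ncoeff q 1 j\<bar>)" if "j \<le> q" for j
        using that by (intro member_le_sum) auto
      then have "n \<le> real (Suc q) * (\<Sum>j\<le>q. \<bar>dg_ncoeff q 1 j\<bar>) * x ^ q"
        unfolding n_def x_def by (rule polyval_bound(2)) (use False in \<open>auto simp: x_def\<close>)
      also have "\<dots> \<le> K * x ^ q" unfolding K_def using x by (intro mult_right_mono) auto
      finally have "c * x * n \<le> c * x * (K * x ^ q)" using c x by (intro mult_left_mono) auto
      also have "\<dots> = (c * K) * x ^ Suc q" by simp
      also have "\<dots> \<le> 1 * x ^ Suc q" using c x by (intro mult_right_mono) auto
      finally have "(c * x * n)\<^sup>2 \<le> (x ^ Suc q)\<^sup>2"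
        using c x n by (intro power_mono) auto
      moreover have "0 \<le> \<sigma> * x * J" using \<sigma> x J by simp
      ultimately show ?thesis by linarith
    qed
    have "(n * (1 + c * x))\<^sup>2 = n\<^sup>2 + 2 * c * x * n\<^sup>2 + (c * x * n)\<^sup>2"
      by (simp add: power2_eq_square algebra_simps)
    also have "\<dots> \<le> n\<^sup>2 + (x ^ Suc q)\<^sup>2 + 2 * (\<sigma> * x) * J"
      using small large by simp
    also have "\<dots> \<le> n\<^sup>2 + (x ^ Suc q)\<^sup>2 + 2 * Re z * J"
      using z J by (intro add_left_mono mult_right_mono) (auto simp: x_def)
    also have "\<dots> = (cmod (dg_den q z))\<^sup>2"
      unfolding n_def x_def J_def by (rule dg_energy_identity)
    finally show "(cmod (polyval q (dg_ncoeff q 1) z) * (1 + c * cmod z))\<^sup>2 \<le> (cmod (dg_den q z))\<^sup>2"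
      by (simp add: n_def x_def)
  qed simp
  with c(1) show ?thesis by blast
qed

section \<open>Bounds for the rational functions of a single step\<close>

lemma continuous_on_polyval [continuous_intros]:
  fixes f :: "'b::topological_space \<Rightarrow> complex"
  shows "continuous_on S f \<Longrightarrow> continuous_on S (\<lambda>x. polyval q a (f x))"
  unfolding polyval_def by (intro continuous_intros)

lemma holomorphic_on_polyval [holomorphic_intros]:
  "f holomorphic_on S \<Longrightarrow> (\<lambda>x. polyval q a (f x)) holomorphic_on S"
  unfolding polyval_def by (intro holomorphic_intros)

lemma holomorphic_on_dg_den [holomorphic_intros]:
  "f holomorphic_on S \<Longrightarrow> (\<lambda>x. dg_den q (f x)) holomorphic_on S"
  unfolding dg_den_def by (intro holomorphic_intros)

lemma dg_den_lower:
  obtains c where "0 < c" "\<And>z. 0 \<le> Re z \<Longrightarrow> cmod z \<le> 1 \<Longrightarrow> c \<le> cmod (dg_den q z)"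
proof -
  let ?S = "cball 0 1 \<inter> {z. 0 \<le> Re z}"
  have "compact ?S"
    by (intro compact_Int_closed compact_cball closed_halfspace_Re_ge)
  moreover have "0 \<in> ?S" by simp
  moreover have "continuous_on ?S (\<lambda>z. cmod (dg_den q z))"
    unfolding dg_den_def by (intro continuous_intros)
  ultimately obtain w where w: "w \<in> ?S" "\<And>z. z \<in> ?S \<Longrightarrow> cmod (dg_den q w) \<le> cmod (dg_den q z)"
    using continuous_attains_inf[of ?S "\<lambda>z. cmod (dg_den q z)"] by blast
  show ?thesis
    by (rule that[of "cmod (dg_den q w)"]) (use w dg_den_nonzero[of w q] in auto)
qed

text \<open>The constant has to be uniform in the numerator, whose coefficients will depend on the
  position in time. Near the origin compactness keeps the denominator away from 0; far out its
  degree exceeds that of the numerator by one.\<close>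

lemma dg_quotient_bound:
  assumes K: "0 \<le> K"
  shows "\<exists>C>0. \<forall>a z. (\<forall>j\<le>q. \<bar>a j\<bar> \<le> K) \<longrightarrow> 0 \<le> Re z \<longrightarrow>
    cmod (polyval q a z) * (1 + cmod z) \<le> C * cmod (dg_den q z)"
proof -
  obtain c where c: "0 < c" "\<And>z. 0 \<le> Re z \<Longrightarrow> cmod z \<le> 1 \<Longrightarrow> c \<le> cmod (dg_den q z)"
    using dg_den_lower by blast
  define L where "L = real (Suc q) * K"
  have L: "0 \<le> L" using K by (simp add: L_def)
  define C where "C = max (2 * L) (2 * L / c) + 1"
  have C: "2 * L \<le> C" "2 * L / c \<le> C" "0 < C" using L by (auto simp: C_def)
  have "cmod (polyval q a z) * (1 + cmod z) \<le> C * cmod (dg_den q z)"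
    if a: "\<forall>j\<le>q. \<bar>a j\<bar> \<le> K" and z: "0 \<le> Re z" for a z
  proof (cases "cmod z \<le> 1")
    case True
    have "cmod (polyval q a z) * (1 + cmod z) \<le> L * 2"
      using polyval_bound(1)[of q a K z] a True L by (intro mult_mono) (auto simp: L_def)
    also have "\<dots> = 2 * L / c * c" using c by simp
    also have "\<dots> \<le> C * cmod (dg_den q z)"
      using C c z True L by (intro mult_mono) auto
    finally show ?thesis .
  next
    case False
    then have "cmod (polyval q a z) * (1 + cmod z) \<le> (L * cmod z ^ q) * (2 * cmod z)"
      using polyval_bound(2)[of q a K z] a L by (intro mult_mono) (auto simp: L_def)
    also have "\<dots> = 2 * L * cmod z ^ Suc q" by simp
    also have "\<dots> \<le> C * cmod (dg_den q z)"
      using C dg_den_ge[OF z, of q] L by (intro mult_mono) auto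
    finally show ?thesis .
  qed
  then show ?thesis using C(3) by blast
qed

lemma cmod_one_plus_ge:
  assumes "0 \<le> Re z"
  shows "1 \<le> cmod (1 + z)" "cmod z \<le> cmod (1 + z)"
proof -
  show "1 \<le> cmod (1 + z)"
    using complex_Re_le_cmod[of "1 + z"] assms by simp
  show "cmod z \<le> cmod (1 + z)"
    unfolding cmod_def using assms by (intro real_sqrt_le_mono) (auto simp: power2_eq_square algebra_simps)
qed

text \<open>The denominator is monic of degree \<open>Suc q\<close>, so the quotient behaves like
  \<open>a q / z\<close> at infinity. The subtracted fraction has the same leading term and no pole
  in the half plane, and the difference gains one order of decay.\<close>

lemma dg_quotient_corrected_bound:
  assumes K: "0 \<le> K"
  shows "\<exists>C>0. \<forall>a z. (\<forall>j\<le>q. \<bar>a j\<bar> \<le> K) \<longrightarrow> 0 \<le> Re z \<longrightarrow>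
    cmod (polyval q a z / dg_den q z - of_real (a q) / (1 + z)) * (1 + (cmod z)\<^sup>2) \<le> C"
proof -
  obtain C0 where C0: "0 < C0" and q: "\<And>a z. (\<forall>j\<le>q. \<bar>a j\<bar> \<le> K) \<Longrightarrow> 0 \<le> Re z \<Longrightarrow>
    cmod (polyval q a z) * (1 + cmod z) \<le> C0 * cmod (dg_den q z)"
    using dg_quotient_bound[OF K] by blast
  define K0 where "K0 = (\<Sum>j\<le>q. \<bar>dg_ncoeff q 0 j\<bar>)"
  have K0: "\<bar>dg_ncoeff q 0 j\<bar> \<le> K0" if "j \<le> q" for j
    unfolding K0_def using that by (intro member_le_sum) auto
  define L where "L = 2 * (real (Suc q) * K) + K * (real (Suc q) * K0)"
  have K0nn: "0 \<le> K0" by (simp add: K0_def sum_nonneg)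
  have L: "0 \<le> L" using K K0nn by (simp add: L_def)
  define C where "C = 2 * (C0 + K) + 2 * L"
  have "cmod (polyval q a z / dg_den q z - of_real (a q) / (1 + z)) * (1 + (cmod z)\<^sup>2) \<le> C"
    if a: "\<forall>j\<le>q. \<bar>a j\<bar> \<le> K" and z: "0 \<le> Re z" for a z
  proof (cases "cmod z \<le> 1")
    case True
    have Q: "0 < cmod (dg_den q z)" using dg_den_nonzero[OF z] by simp
    have "cmod (polyval q a z) * 1 \<le> cmod (polyval q a z) * (1 + cmod z)"
      by (intro mult_left_mono) auto
    also have "\<dots> \<le> C0 * cmod (dg_den q z)" by (rule q[OF a z])
    finally have 1: "cmod (polyval q a z / dg_den q z) \<le> C0"
      using Q by (simp add: norm_divide divide_le_eq)
    have "\<bar>a q\<bar> \<le> K * cmod (1 + z)"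
      using a mult_left_mono[OF cmod_one_plus_ge(1)[OF z] K] order_trans[of "\<bar>a q\<bar>" K] by auto
    then have 2: "cmod (of_real (a q) / (1 + z)) \<le> K"
      using cmod_one_plus_ge(1)[OF z] by (auto simp: norm_divide divide_le_eq)
    have "cmod (polyval q a z / dg_den q z - of_real (a q) / (1 + z)) \<le> C0 + K"
      using 1 2 norm_triangle_ineq4[of "polyval q a z / dg_den q z" "of_real (a q) / (1 + z)"] by linarith
    then have "cmod (polyval q a z / dg_den q z - of_real (a q) / (1 + z)) * (1 + (cmod z)\<^sup>2) \<le> (C0 + K) * 2"
      using True C0 K by (intro mult_mono) (auto simp: power_le_one)
    then show ?thesis using L by (simp add: C_def)
  next
    case False
    define x where "x = cmod z"
    have x: "1 \<le> x" using False by (simp add: x_def)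
    define P where "P = polyval q a z"
    define Q where "Q = dg_den q z"
    have z1: "1 + z \<noteq> 0" using cmod_one_plus_ge(1)[OF z] by auto
    have Q0: "Q \<noteq> 0" unfolding Q_def by (rule dg_den_nonzero[OF z])
    have P: "cmod P \<le> real (Suc q) * K * x ^ q"
      using polyval_bound(2)[of q a K z] a x by (auto simp: P_def x_def)
    have N: "cmod (polyval q (dg_ncoeff q 0) z) \<le> real (Suc q) * K0 * x ^ q"
      using polyval_bound(2)[of q "dg_ncoeff q 0" K0 z] K0 x by (auto simp: x_def)
    have R: "cmod (z * P - of_real (a q) * z ^ Suc q) \<le> real (Suc q) * K * x ^ q"
    proof -
      have "z * P - of_real (a q) * z ^ Suc q = (\<Sum>j<q. of_real (a j) * z ^ Suc j)"
        unfolding P_def polyval_def lessThan_Suc_atMost[symmetric]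
        by (simp add: distrib_left sum_distrib_left algebra_simps)
      also have "cmod \<dots> \<le> (\<Sum>j<q. K * x ^ q)"
      proof (intro sum_norm_le)
        fix j assume "j \<in> {..<q}"
        then have "\<bar>a j\<bar> * x ^ Suc j \<le> K * x ^ q"
          using a x K by (intro mult_mono power_increasing) auto
        then show "cmod (of_real (a j) * z ^ Suc j) \<le> K * x ^ q" by (simp add: norm_mult norm_power x_def)
      qed
      also have "\<dots> \<le> real (Suc q) * K * x ^ q"
        using K x by (simp add: algebra_simps)
      finally show ?thesis .
    qed
    have S: "cmod (of_real (a q) * polyval q (dg_ncoeff q 0) z) \<le> K * (real (Suc q) * K0 * x ^ q)"
      unfolding norm_mult using a N K by (intro mult_mono) auto
    \<comment> \<open>The terms of degree \<open>Suc q\<close> are grouped so that they cancel;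
      every summand that remains has degree at most \<open>q\<close>.\<close>
    have num: "(1 + z) * P - of_real (a q) * Q = P + (z * P - of_real (a q) * z ^ Suc q)
        - of_real (a q) * polyval q (dg_ncoeff q 0) z"
      by (simp add: Q_def dg_den_def algebra_simps)
    have "cmod ((1 + z) * P - of_real (a q) * Q) \<le> L * x ^ q"
    proof -
      have "cmod ((1 + z) * P - of_real (a q) * Q) \<le> cmod P + cmod (z * P - of_real (a q) * z ^ Suc q)
        + cmod (of_real (a q) * polyval q (dg_ncoeff q 0) z)"
        unfolding num
        by (rule order_trans[OF norm_triangle_ineq4 add_right_mono[OF norm_triangle_ineq]])
      also have "\<dots> \<le> L * x ^ q" using P R S by (simp add: L_def algebra_simps)
      finally show ?thesis .
    qed
    moreover have "x * x ^ Suc q \<le> cmod ((1 + z) * Q)"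
      unfolding norm_mult using cmod_one_plus_ge(2)[OF z] dg_den_ge[OF z, of q] x
      by (intro mult_mono) (auto simp: x_def Q_def)
    moreover have "P / Q - of_real (a q) / (1 + z) = ((1 + z) * P - of_real (a q) * Q) / ((1 + z) * Q)"
      using z1 Q0 by (simp add: field_simps)
    moreover have "0 < x * x ^ Suc q" using x by simp
    ultimately have "cmod (P / Q - of_real (a q) / (1 + z)) \<le> L * x ^ q / (x * x ^ Suc q)"
      using x L unfolding norm_divide by (simp only: norm_divide) (intro frac_le; simp)
    also have "\<dots> = L / x\<^sup>2" using x by (simp add: field_simps power2_eq_square)
    finally have "cmod (P / Q - of_real (a q) / (1 + z)) * (1 + x\<^sup>2) \<le> L / x\<^sup>2 * (2 * x\<^sup>2)"
      using x L by (intro mult_mono) auto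
    also have "\<dots> = 2 * L" using x by simp
    finally show ?thesis using C0 K by (simp add: C_def P_def Q_def x_def)
  qed
  moreover have "0 < C" using C0 K L by (simp add: C_def)
  ultimately show ?thesis by blast
qed

section \<open>Functional calculus from a resolvent estimate\<close>

text \<open>The norm of the theorem is arbitrary, so the functional calculus may rely on nothing but
  these axioms and on finite dimension.\<close>

locale fin_seminorm =
  fixes n :: nat and \<Phi> :: "(nat \<Rightarrow> complex) \<Rightarrow> real"
  assumes triangle: "\<Phi> (\<lambda>i. a i + b i) \<le> \<Phi> a + \<Phi> b"
    and homogeneous: "\<Phi> (\<lambda>i. c * a i) = cmod c * \<Phi> a"
    and cong: "(\<And>i. i < n \<Longrightarrow> a i = b i) \<Longrightarrow> \<Phi> a = \<Phi> b"
begin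

lemma zero [simp]: "\<Phi> (\<lambda>i. 0) = 0"
  using homogeneous[of 0 "\<lambda>i. 0"] by simp

lemma nonneg: "0 \<le> \<Phi> a"
  using triangle[of a "\<lambda>i. - 1 * a i"] homogeneous[of "-1" a] by simp

lemma sum_le: "finite D \<Longrightarrow> \<Phi> (\<lambda>i. \<Sum>p\<in>D. f p i) \<le> (\<Sum>p\<in>D. \<Phi> (f p))"
proof (induction D rule: finite_induct)
  case (insert x F)
  then show ?case
    using triangle[of "f x" "\<lambda>i. \<Sum>p\<in>F. f p i"] by simp
qed simp

lemma coordinate_bound:
  obtains K where "0 \<le> K" "\<And>a. \<Phi> a \<le> K * (\<Sum>i<n. cmod (a i))"
proof -
  define e where "e j i = (if i = j then 1 else 0 :: complex)" for j i :: nat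
  define K where "K = (\<Sum>j<n. \<Phi> (e j))"
  have "\<Phi> a \<le> K * (\<Sum>i<n. cmod (a i))" for a
  proof -
    have "\<Phi> a = \<Phi> (\<lambda>i. \<Sum>j<n. a j * e j i)"
      by (rule cong) (simp add: e_def if_distrib cong: if_cong)
    also have "\<dots> \<le> (\<Sum>j<n. \<Phi> (\<lambda>i. a j * e j i))" by (rule sum_le) simp
    also have "\<dots> = (\<Sum>j<n. cmod (a j) * \<Phi> (e j))" by (simp add: homogeneous)
    also have "\<dots> \<le> (\<Sum>j<n. cmod (a j) * K)"
      by (intro sum_mono mult_left_mono) (auto simp: K_def nonneg intro!: member_le_sum)
    finally show ?thesis by (simp add: sum_distrib_left mult.commute)
  qed
  moreover have "0 \<le> K" by (simp add: K_def nonneg sum_nonneg)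
  ultimately show ?thesis using that by blast
qed

text \<open>The triangle inequality for Riemann sums passes to the limit. One tagged division that
  is fine for all \<open>n\<close> coordinates and for \<open>G\<close> at once makes the sums
  comparable; the majorant \<open>G\<close> stands in for the integrand
  \<open>\<Phi> (\<lambda>i. h i s)\<close>.\<close>

lemma integral_le:
  assumes h: "\<And>i. i < n \<Longrightarrow> (h i has_integral I i) {a..b::real}"
    and G: "(G has_integral J) {a..b}"
    and le: "\<And>s. s \<in> {a..b} \<Longrightarrow> \<Phi> (\<lambda>i. h i s) \<le> G s"
  shows "\<Phi> I \<le> J"
proof -
  obtain K where K: "0 \<le> K" "\<And>a. \<Phi> a \<le> K * (\<Sum>i<n. cmod (a i))"
    using coordinate_bound by blast
  have "\<Phi> I \<le> J + (K * n + 1) * e" if e: "0 < e" for e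
  proof -
    have "\<forall>i\<in>{..<n}. \<exists>g. gauge g \<and> (\<forall>D. D tagged_division_of {a..b} \<and> g fine D \<longrightarrow>
        norm ((\<Sum>(x,k)\<in>D. measure lborel k *\<^sub>R h i x) - I i) < e)"
      using h e unfolding has_integral_real by auto
    then obtain g where g: "\<And>i. i < n \<Longrightarrow> gauge (g i)" "\<And>i D. i < n \<Longrightarrow> D tagged_division_of {a..b} \<Longrightarrow> g i fine D \<Longrightarrow>
        norm ((\<Sum>(x,k)\<in>D. measure lborel k *\<^sub>R h i x) - I i) < e"
      by (metis lessThan_iff)
    obtain g' where g': "gauge g'" "\<And>D. D tagged_division_of {a..b} \<Longrightarrow> g' fine D \<Longrightarrow>
        norm ((\<Sum>(x,k)\<in>D. measure lborel k *\<^sub>R G x) - J) < e"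
      using G e unfolding has_integral_real by meson
    define d where "d x = g' x \<inter> (\<Inter>i\<in>{..<n}. g i x)" for x
    have "gauge d"
      using g(1) g'(1) unfolding d_def gauge_def by auto
    then obtain D where D: "D tagged_division_of {a..b}" "d fine D"
      using fine_division_exists_real by blast
    have fD: "g' fine D" "\<And>i. i < n \<Longrightarrow> g i fine D"
      using D(2) unfolding fine_def d_def by blast+
    define S where "S i = (\<Sum>(x,k)\<in>D. measure lborel k *\<^sub>R h i x)" for i
    have fin: "finite D" using D(1) by blast
    have "\<Phi> I \<le> \<Phi> S + \<Phi> (\<lambda>i. I i - S i)"
      using triangle[of S "\<lambda>i. I i - S i"] by simp
    moreover have "\<Phi> (\<lambda>i. I i - S i) \<le> K * (n * e)"
    proof -
      have "(\<Sum>i<n. cmod (I i - S i)) \<le> (\<Sum>i<n. e)"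
        using g(2)[OF _ D(1) fD(2)] by (intro sum_mono) (simp add: S_def norm_minus_commute less_imp_le)
      then show ?thesis
        using K by (intro order_trans[OF K(2)] mult_left_mono) auto
    qed
    moreover have "\<Phi> S \<le> J + e"
    proof -
      have "\<Phi> S = \<Phi> (\<lambda>i. \<Sum>p\<in>D. (case p of (x, k) \<Rightarrow> of_real (measure lborel k) * h i x))"
        unfolding S_def scaleR_conv_of_real ..
      also have "\<dots> \<le> (\<Sum>p\<in>D. \<Phi> (\<lambda>i. case p of (x, k) \<Rightarrow> of_real (measure lborel k) * h i x))"
        by (rule sum_le[OF fin])
      also have "\<dots> \<le> (\<Sum>(x,k)\<in>D. measure lborel k *\<^sub>R G x)"
      proof (intro sum_mono)
        fix p assume p: "p \<in> D"
        obtain x k where xk: "p = (x, k)" by (cases p)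
        have "x \<in> {a..b}" using D(1) p xk by blast
        then show "\<Phi> (\<lambda>i. case p of (x, k) \<Rightarrow> of_real (measure lborel k) * h i x) \<le> (case p of (x, k) \<Rightarrow> measure lborel k *\<^sub>R G x)"
          unfolding xk by (auto simp: homogeneous intro!: mult_left_mono le)
      qed
      also have "\<dots> \<le> J + e" using g'(2)[OF D(1) fD(1)] by simp
      finally show ?thesis .
    qed
    ultimately show ?thesis by (simp add: algebra_simps)
  qed
  note * = this
  show ?thesis
  proof (rule field_le_epsilon)
    fix e :: real assume "0 < e"
    moreover have "0 < K * n + 1" using K(1) by (simp add: add_nonneg_pos)
    ultimately show "\<Phi> I \<le> J + e" using *[of "e / (K * n + 1)"] by simp
  qed
qed

text \<open>The rays start at the origin, where no resolvent estimate is available, so the bound may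
  be asked for in the open interval only.\<close>

lemma integral_le_open:
  assumes h: "\<And>i. i < n \<Longrightarrow> (h i has_integral I i) {a..b::real}"
    and G: "(G has_integral J) {a..b}"
    and le: "\<And>s. a < s \<Longrightarrow> s < b \<Longrightarrow> \<Phi> (\<lambda>i. h i s) \<le> G s"
  shows "\<Phi> I \<le> J"
proof (rule integral_le)
  show "((\<lambda>s. if s \<in> {a, b} then 0 else h i s) has_integral I i) {a..b}" if "i < n" for i
    by (rule has_integral_spike_finite[OF _ _ h[OF that], of "{a, b}"]) auto
  show "((\<lambda>s. if s \<in> {a, b} then 0 else G s) has_integral J) {a..b}"
    by (rule has_integral_spike_finite[OF _ _ G, of "{a, b}"]) auto
qed (use le in auto)

end

section \<open>Auxiliary facts for the triangular contour\<close>

lemma triangle_interior: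
  assumes X: "0 < x" "x < X" and \<tau>: "0 < \<tau>"
  shows "complex_of_real x \<in> interior (convex hull {0, Complex X (- \<tau> * X), Complex X (\<tau> * X)})"
proof (rule interiorI)
  show "open {z. Re z < X \<and> \<bar>Im z\<bar> < \<tau> * Re z}"
    by (intro open_Collect_conj open_Collect_less continuous_intros)
  show "complex_of_real x \<in> {z. Re z < X \<and> \<bar>Im z\<bar> < \<tau> * Re z}"
    using assms by simp
  show "{z. Re z < X \<and> \<bar>Im z\<bar> < \<tau> * Re z} \<subseteq> convex hull {0, Complex X (- \<tau> * X), Complex X (\<tau> * X)}"
  proof
    fix z assume "z \<in> {z. Re z < X \<and> \<bar>Im z\<bar> < \<tau> * Re z}"
    then have z: "Re z < X" "\<bar>Im z\<bar> < \<tau> * Re z" by auto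
    have X0: "0 < X" using X by simp
    \<comment> \<open>\<open>v\<close> and \<open>w\<close> are the barycentric coordinates of
      \<open>z\<close> belonging to the two vertices away from the origin.\<close>
    define v where "v = (Re z / X - Im z / (\<tau> * X)) / 2"
    define w where "w = (Re z / X + Im z / (\<tau> * X)) / 2"
    have "\<bar>Im z / (\<tau> * X)\<bar> \<le> Re z / X"
      using z X0 \<tau> by (simp add: abs_mult field_simps)
    note abs_leD = abs_le_D1[OF this] abs_le_D2[OF this]
    then have vw: "0 \<le> v" "0 \<le> w" by (simp_all add: v_def w_def)
    have "v + w = Re z / X" by (simp add: v_def w_def field_simps)
    then have "v + w \<le> 1" using z X0 by simp
    moreover have "z = (1 - v - w) *\<^sub>R 0 + v *\<^sub>R Complex X (- \<tau> * X) + w *\<^sub>R Complex X (\<tau> * X)"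
      using X0 \<tau> by (simp add: complex_eq_iff v_def w_def field_simps)
    ultimately show "z \<in> convex hull {0, Complex X (- \<tau> * X), Complex X (\<tau> * X)}"
      unfolding convex_hull_3 using vw by (intro CollectI exI[of _ "1 - v - w"] exI[of _ v] exI[of _ w]) auto
  qed
qed

lemma has_integral_lorentz:
  fixes t L :: real
  assumes "0 < t" "0 < L"
  shows "((\<lambda>s. L / (1 + (t * (s * L))\<^sup>2)) has_integral arctan (t * L) / t) {0..1}"
proof -
  have "((\<lambda>s. arctan (t * (s * L)) / t) has_real_derivative (L / (1 + (t * (s * L))\<^sup>2))) (at s within {0..1})" for s
  proof -
    have "1 + (t * (s * L))\<^sup>2 \<noteq> 0" by (rule add_pos_nonneg[THEN less_imp_neq, symmetric]) auto
    then show ?thesis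
      using assms by (auto intro!: derivative_eq_intros simp: divide_simps)
  qed
  then have "((\<lambda>s. L / (1 + (t * (s * L))\<^sup>2)) has_integral arctan (t * (1 * L)) / t - arctan (t * (0 * L)) / t) {0..1}"
    by (intro fundamental_theorem_of_calculus) (auto simp: has_real_derivative_iff_has_vector_derivative)
  then show ?thesis by simp
qed


context fin_seminorm
begin

text \<open>Cauchy's formula on the triangle with vertices \<^term>\<open>0\<close>, \<^term>\<open>Complex X (- \<tau> * X)\<close>,
  \<^term>\<open>Complex X (\<tau> * X)\<close>: the resolvent is controlled on the two sides through the origin,
  and the contribution of the third side vanishes as \<^term>\<open>X\<close> tends to infinity.\<close>
lemma functional_calculus_bound:
  fixes \<mu> :: "nat \<Rightarrow> real"
  assumes \<mu>: "\<And>i. i < n \<Longrightarrow> 0 \<le> \<mu> i"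
    and hol: "f holomorphic_on {z. 0 \<le> Re z}"
    and t: "0 < t" and \<tau>: "0 < \<tau>"
    and fle: "\<And>z. \<bar>Im z\<bar> \<le> \<tau> * Re z \<Longrightarrow> cmod (f z) \<le> C / (1 + (t * cmod z)\<^sup>2)"
    and res: "\<And>z. 0 < Re z \<Longrightarrow> \<bar>Im z\<bar> = \<tau> * Re z \<Longrightarrow> \<Phi> (\<lambda>i. v i / (z - of_real (\<mu> i))) \<le> R / cmod z"
  shows "\<Phi> (\<lambda>i. of_real (\<mu> i) * f (of_real (\<mu> i)) * v i) \<le> C * R / (2 * t)"
proof -
  let ?S = "{z. 0 \<le> Re z}"
  \<comment> \<open>The integrand of Cauchy's formula for \<open>z * f z\<close>. A zero eigenvalue
    would put the pole on the contour, at the vertex of the triangle; there the factor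
    \<open>z\<close> is cancelled beforehand and the holomorphic \<open>f\<close> is left.\<close>
  define g where "g i z = (if \<mu> i = 0 then f z else z * f z / (z - of_real (\<mu> i)))" for i z
  define F where "F i = of_real (\<mu> i) * f (of_real (\<mu> i)) * v i" for i
  have C: "0 \<le> C" using fle[of 0] order_trans[OF norm_ge_zero, of "f 0" C] by simp
  have R: "0 \<le> R"
    using order_trans[OF nonneg res[of "Complex 1 \<tau>"]] \<tau> by (simp add: zero_le_divide_iff complex_eq_iff)
  obtain K where K: "0 \<le> K" "\<And>a. \<Phi> a \<le> K * (\<Sum>i<n. cmod (a i))"
    using coordinate_bound by blast
  \<comment> \<open>The third side contributes \<open>C / (t * X)\<^sup>2\<close> from
    \<open>f\<close>, at most \<open>2 * (1 + \<tau>)\<close> from \<open>z / (z - \<mu> i)\<close>,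
    and its length \<open>2 * \<tau> * X\<close>; one inverse power of \<open>X\<close>
    remains.\<close>
  define E where "E = K * (\<Sum>i<n. C / t\<^sup>2 * (2 * (1 + \<tau>)) * (2 * \<tau>) * cmod (v i))"
  have convS: "convex ?S" using convex_halfspace_Re_ge by simp
  have side: "\<Phi> J \<le> C * R * (pi / 2) / t"
    if w: "0 < Re w" "\<bar>Im w\<bar> = \<tau> * Re w"
      and J: "\<And>i. i < n \<Longrightarrow> ((\<lambda>z. g i z * v i) has_contour_integral J i) (linepath 0 w)" for w J
  proof -
    define L where "L = cmod w"
    have L: "0 < L" using w by (auto simp: L_def)
    have "\<Phi> J \<le> C * R * (arctan (t * L) / t)"
    proof (rule integral_le_open[of "\<lambda>i s. g i (of_real s * w) * v i * w"])
      show "((\<lambda>s. g i (of_real s * w) * v i * w) has_integral J i) {0..1}" if "i < n" for i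
        using J[OF that] unfolding has_contour_integral_linepath
        by (simp add: linepath_def scaleR_conv_of_real)
      show "((\<lambda>s. C * R * (L / (1 + (t * (s * L))\<^sup>2))) has_integral C * R * (arctan (t * L) / t)) {0..1}"
        by (intro has_integral_mult_right has_integral_lorentz t L)
      fix s :: real assume s: "0 < s" "s < 1"
      define z where "z = of_real s * w"
      have z: "0 < Re z" "\<bar>Im z\<bar> = \<tau> * Re z" using s w by (simp_all add: z_def abs_mult)
      have z0: "z \<noteq> 0" using z by auto
      have cz: "cmod z = s * L" using s by (simp add: z_def L_def norm_mult)
      have "\<Phi> (\<lambda>i. g i z * v i * w) = \<Phi> (\<lambda>i. (w * f z * z) * (v i / (z - of_real (\<mu> i))))"
        using z0 by (intro cong) (auto simp: g_def)
      also have "\<dots> = L * cmod (f z) * cmod z * \<Phi> (\<lambda>i. v i / (z - of_real (\<mu> i)))"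
        by (subst homogeneous) (simp add: norm_mult L_def)
      \<comment> \<open>The factor \<open>cmod z\<close> meets \<open>R / cmod z\<close>, so the
        integrand stays bounded at the origin and decays as fast as \<open>f\<close>.\<close>
      also have "\<dots> \<le> L * (C / (1 + (t * cmod z)\<^sup>2)) * cmod z * (R / cmod z)"
        using L C z fle[of z] res[of z] nonneg by (intro mult_mono mult_nonneg_nonneg divide_nonneg_nonneg) auto
      also have "\<dots> = C * R * (L / (1 + (t * (s * L))\<^sup>2))"
        using z0 L s by (simp add: cz)
      finally show "\<Phi> (\<lambda>i. g i (of_real s * w) * v i * w) \<le> C * R * (L / (1 + (t * (s * L))\<^sup>2))"
        by (simp add: z_def)
    qed
    also have "\<dots> \<le> C * R * ((pi / 2) / t)"
      using C R t arctan_ubound[of "t * L"] by (intro mult_left_mono divide_right_mono) auto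
    finally show ?thesis by simp
  qed
  \<comment> \<open>The condition \<open>2 * \<mu> i < X\<close> keeps every positive eigenvalue
    inside the triangle and every eigenvalue at distance at least \<open>X / 2\<close> from the
    third side.\<close>
  have main: "2 * pi * \<Phi> F \<le> pi * C * R / t + E * inverse X"
    if X: "0 < X" and X\<mu>: "\<And>i. i < n \<Longrightarrow> 2 * \<mu> i < X" for X
  proof -
    define b where "b = Complex X (- \<tau> * X)"
    define c where "c = Complex X (\<tau> * X)"
    let ?\<gamma> = "linepath 0 b +++ linepath b c +++ linepath c 0"
    have bc: "Re b = X" "Im b = - \<tau> * X" "Re c = X" "Im c = \<tau> * X" by (simp_all add: b_def c_def)
    have segS: "closed_segment 0 b \<subseteq> ?S" "closed_segment b c \<subseteq> ?S" "closed_segment c 0 \<subseteq> ?S"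
      using X by (simp_all add: closed_segment_subset[OF _ _ convS] bc)
    have seg_bc: "Re z = X" "\<bar>Im z\<bar> \<le> \<tau> * X" if zbc: "z \<in> closed_segment b c" for z
    proof -
      obtain u where u: "0 \<le> u" "u \<le> 1" "z = (1 - u) *\<^sub>R b + u *\<^sub>R c"
        using zbc unfolding closed_segment_def by blast
      have "Re z = (1 - u) * X + u * X" unfolding u(3) by (simp add: bc)
      then show "Re z = X" by (simp add: algebra_simps)
      have "Im z = (2 * u - 1) * (\<tau> * X)" unfolding u(3) by (simp add: bc algebra_simps)
      then have "\<bar>Im z\<bar> = \<bar>2 * u - 1\<bar> * (\<tau> * X)" using \<tau> X by (simp add: abs_mult)
      also have "\<dots> \<le> 1 * (\<tau> * X)" using \<tau> X u by (intro mult_right_mono) auto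
      finally show "\<bar>Im z\<bar> \<le> \<tau> * X" by simp
    qed
    have nots: "of_real (\<mu> i) \<notin> closed_segment 0 b" "of_real (\<mu> i) \<notin> closed_segment b c" "of_real (\<mu> i) \<notin> closed_segment c 0"
      if i: "i < n" "\<mu> i \<noteq> 0" for i
    proof -
      show "of_real (\<mu> i) \<notin> closed_segment b c"
        using seg_bc(1)[of "of_real (\<mu> i)"] X\<mu>[OF i(1)] \<mu>[OF i(1)] by auto
      have *: "of_real (\<mu> i) \<notin> closed_segment 0 w" if w: "Im w \<noteq> 0" for w
      proof
        assume "of_real (\<mu> i) \<in> closed_segment 0 w"
        then obtain u where "of_real (\<mu> i) = u *\<^sub>R w" by (auto simp: closed_segment_def)
        then show False using w i(2) by (auto simp: complex_eq_iff)
      qed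
      show "of_real (\<mu> i) \<notin> closed_segment 0 b" "of_real (\<mu> i) \<notin> closed_segment c 0"
        using *[of b] *[of c] X \<tau> by (auto simp: bc closed_segment_commute)
    qed
    have cont: "continuous_on (closed_segment p r) (\<lambda>z. g i z * v i)"
      if "i < n" "closed_segment p r \<subseteq> ?S" "\<mu> i \<noteq> 0 \<Longrightarrow> of_real (\<mu> i) \<notin> closed_segment p r" for i p r
    proof -
      have "continuous_on (closed_segment p r) f"
        using holomorphic_on_imp_continuous_on[OF hol] that(2) continuous_on_subset by blast
      then show ?thesis
        using that(3) unfolding g_def by (cases "\<mu> i = 0") (auto intro!: continuous_intros)
    qed
    note conts = cont[OF _ segS(1)] cont[OF _ segS(2)] cont[OF _ segS(3)]
    have ci: "(\<lambda>z. g i z * v i) contour_integrable_on linepath 0 b"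
       "(\<lambda>z. g i z * v i) contour_integrable_on linepath b c"
       "(\<lambda>z. g i z * v i) contour_integrable_on linepath c 0" if "i < n" for i
      using conts[OF that] nots[OF that] by (auto intro!: contour_integrable_continuous_linepath)
    define J1 J2 J3 where "J1 i = contour_integral (linepath 0 b) (\<lambda>z. g i z * v i)"
      and "J2 i = contour_integral (linepath b c) (\<lambda>z. g i z * v i)"
      and "J3 i = contour_integral (linepath 0 c) (\<lambda>z. g i z * v i)" for i
    \<comment> \<open>\<open>J3\<close> is taken from the origin outwards, against the orientation
      of the contour, so that \<open>side\<close> applies to both rays; hence the sign.\<close>
    have tot: "2 * pi * \<i> * F i = J1 i + J2 i + - 1 * J3 i" if i: "i < n" for i
    proof -
      have pS: "path_image ?\<gamma> \<subseteq> ?S"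
        using segS by (simp add: path_image_join)
      have "((\<lambda>z. g i z * v i) has_contour_integral (2 * pi * \<i> * F i)) ?\<gamma>"
      proof (cases "\<mu> i = 0")
        case True
        have "(\<lambda>z. f z * v i) holomorphic_on ?S" using hol by (intro holomorphic_intros)
        then have "((\<lambda>z. f z * v i) has_contour_integral 0) ?\<gamma>"
          by (rule Cauchy_theorem_convex_simple[OF _ convS _ pS]) auto
        then show ?thesis using True by (simp add: g_def F_def)
      next
        case False
        then have pos: "0 < \<mu> i" using \<mu>[OF i] by simp
        have hol': "(\<lambda>z. z * f z * v i) holomorphic_on ?S" using hol by (intro holomorphic_intros)
        have int: "complex_of_real (\<mu> i) \<in> interior (convex hull {0, b, c})"
          unfolding b_def c_def using pos X\<mu>[OF i] \<tau> by (intro triangle_interior) auto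
        have intS: "complex_of_real (\<mu> i) \<in> interior ?S"
        proof (rule interiorI)
          show "open {z. 0 < Re z}" by (rule open_halfspace_Re_gt)
        qed (use pos in auto)
        have "winding_number ?\<gamma> (of_real (\<mu> i)) = 1"
          unfolding winding_number_triangle[OF int] using pos X \<tau> by (simp add: bc algebra_simps)
        moreover have "((\<lambda>z. z * f z * v i / (z - of_real (\<mu> i))) has_contour_integral
            (2 * pi * \<i> * winding_number ?\<gamma> (of_real (\<mu> i)) * (of_real (\<mu> i) * f (of_real (\<mu> i)) * v i))) ?\<gamma>"
          using pS nots[OF i False]
          by (intro Cauchy_integral_formula_convex_simple[OF convS hol' intS]) (auto simp: path_image_join)
        ultimately show ?thesis
          using False by (simp add: g_def F_def mult.assoc)
      qed
      moreover have "((\<lambda>z. g i z * v i) has_contour_integral (J1 i + (J2 i + contour_integral (linepath c 0) (\<lambda>z. g i z * v i)))) ?\<gamma>"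
        unfolding J1_def J2_def using ci[OF i]
        by (intro has_contour_integral_join has_contour_integral_integral valid_path_join) auto
      moreover have "contour_integral (linepath c 0) (\<lambda>z. g i z * v i) = - J3 i"
        unfolding J3_def
        using contour_integral_reverse_linepath[of 0 c "\<lambda>z. g i z * v i"] conts(3)[OF i] nots[OF i]
        by (simp add: closed_segment_commute)
      ultimately show ?thesis
        using has_contour_integral_unique by fastforce
    qed
    have "2 * pi * \<Phi> F = \<Phi> (\<lambda>i. 2 * pi * \<i> * F i)"
      by (simp only: homogeneous) (simp add: norm_mult)
    also have "\<dots> = \<Phi> (\<lambda>i. J1 i + J2 i + - 1 * J3 i)" by (rule cong) (rule tot)
    also have "\<dots> \<le> \<Phi> J1 + \<Phi> J2 + \<Phi> J3"
      using triangle[of "\<lambda>i. J1 i + J2 i" "\<lambda>i. - 1 * J3 i"] triangle[of J1 J2] homogeneous[of "-1" J3] by simp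
    also have "\<Phi> J1 \<le> C * R * (pi / 2) / t"
      using ci(1) X \<tau> by (intro side[of b]) (auto simp: bc J1_def has_contour_integral_integral)
    also have "\<Phi> J3 \<le> C * R * (pi / 2) / t"
    proof (rule side[of c])
      show "((\<lambda>z. g i z * v i) has_contour_integral J3 i) (linepath 0 c)" if "i < n" for i
        unfolding J3_def
        by (intro has_contour_integral_integral contour_integrable_continuous_linepath)
           (use conts(3)[OF that] nots[OF that] in \<open>auto simp: closed_segment_commute\<close>)
    qed (use X \<tau> in \<open>auto simp: bc\<close>)
    also have "\<Phi> J2 \<le> E * inverse X"
    proof -
      have "cmod (J2 i) \<le> C / t\<^sup>2 * (2 * (1 + \<tau>)) * (2 * \<tau>) * cmod (v i) * inverse X" if i: "i < n" for i
      proof -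
        have "cmod (J2 i) \<le> C / (t * X)\<^sup>2 * (2 * (1 + \<tau>)) * cmod (v i) * cmod (c - b)"
          unfolding J2_def
        proof (rule contour_integral_bound_linepath[OF ci(2)[OF i]])
          show "0 \<le> C / (t * X)\<^sup>2 * (2 * (1 + \<tau>)) * cmod (v i)" using C \<tau> by simp
          fix z assume "z \<in> closed_segment b c"
          note z = seg_bc[OF this]
          have zX: "X \<le> cmod z" using z complex_Re_le_cmod[of z] by simp
          have "cmod (f z) \<le> C / (1 + (t * cmod z)\<^sup>2)" using z X by (intro fle) auto
          also have "\<dots> \<le> C / (t * X)\<^sup>2"
          proof (rule divide_left_mono)
            have "(t * X)\<^sup>2 \<le> (t * cmod z)\<^sup>2" using t X zX by (intro power_mono mult_left_mono) auto
            then show "(t * X)\<^sup>2 \<le> 1 + (t * cmod z)\<^sup>2" by simp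
            have "0 < (t * X)\<^sup>2" using t X by simp
            then show "0 < (1 + (t * cmod z)\<^sup>2) * (t * X)\<^sup>2" by (intro mult_pos_pos add_pos_nonneg) auto
          qed (rule C)
          finally have fz: "cmod (f z) \<le> C / (t * X)\<^sup>2" .
          have "cmod (g i z) \<le> cmod (f z) * (2 * (1 + \<tau>))"
          proof (cases "\<mu> i = 0")
            case True
            then show ?thesis using \<tau> mult_left_mono[of 1 "2 * (1 + \<tau>)" "cmod (f z)"] by (simp add: g_def)
          next
            case False
            have "cmod z \<le> (1 + \<tau>) * X"
              using z cmod_le[of z] X by (simp add: algebra_simps)
            moreover have "X / 2 \<le> cmod (z - of_real (\<mu> i))"
              using z complex_Re_le_cmod[of "z - of_real (\<mu> i)"] X\<mu>[OF i] by simp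
            ultimately have "cmod z / cmod (z - of_real (\<mu> i)) \<le> (1 + \<tau>) * X / (X / 2)"
              using X \<tau> by (intro frac_le) auto
            also have "\<dots> = 2 * (1 + \<tau>)" using X by simp
            finally have "cmod (f z) * (cmod z / cmod (z - of_real (\<mu> i))) \<le> cmod (f z) * (2 * (1 + \<tau>))"
              by (rule mult_left_mono) simp
            then show ?thesis using False by (simp add: g_def norm_mult norm_divide mult.commute)
          qed
          also have "\<dots> \<le> C / (t * X)\<^sup>2 * (2 * (1 + \<tau>))"
            using fz \<tau> by (intro mult_right_mono) auto
          finally show "cmod (g i z * v i) \<le> C / (t * X)\<^sup>2 * (2 * (1 + \<tau>)) * cmod (v i)"
            unfolding norm_mult by (rule mult_right_mono) simp
        qed
        also have "cmod (c - b) = 2 * \<tau> * X"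
        proof -
          have "c - b = \<i> * of_real (2 * \<tau> * X)" by (simp add: complex_eq_iff bc)
          then have "cmod (c - b) = \<bar>2 * \<tau> * X\<bar>" by (simp only: norm_mult norm_of_real norm_ii)
          then show ?thesis using X \<tau> by simp
        qed
        also have "C / (t * X)\<^sup>2 * (2 * (1 + \<tau>)) * cmod (v i) * (2 * \<tau> * X)
            = C / t\<^sup>2 * (2 * (1 + \<tau>)) * (2 * \<tau>) * cmod (v i) * inverse X"
          using X t by (simp add: field_simps power2_eq_square)
        finally show ?thesis .
      qed
      then have "(\<Sum>i<n. cmod (J2 i)) \<le> (\<Sum>i<n. C / t\<^sup>2 * (2 * (1 + \<tau>)) * (2 * \<tau>) * cmod (v i) * inverse X)"
        by (intro sum_mono) auto
      then show ?thesis
        unfolding E_def mult.assoc sum_distrib_right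
        using K by (intro order_trans[OF K(2)] mult_left_mono) (auto simp: mult.assoc)
    qed
    finally show ?thesis by (simp add: field_simps)
  qed
  have "2 * pi * \<Phi> F \<le> pi * C * R / t"
  proof (rule tendsto_lowerbound)
    have "((\<lambda>X. E * inverse X) \<longlongrightarrow> E * 0) at_top"
      by (intro tendsto_mult tendsto_const tendsto_inverse_0_at_top filterlim_ident)
    then show "((\<lambda>X. pi * C * R / t + E * inverse X) \<longlongrightarrow> pi * C * R / t) at_top"
      using tendsto_add[OF tendsto_const[of "pi * C * R / t"], of "\<lambda>X. E * inverse X" "E * 0"] by simp
    have "\<forall>\<^sub>F X in at_top. (1 + (\<Sum>i<n. 2 * \<mu> i)) \<le> X" by (rule eventually_ge_at_top)
    then show "\<forall>\<^sub>F X in at_top. 2 * pi * \<Phi> F \<le> pi * C * R / t + E * inverse X"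
    proof (rule eventually_mono)
      fix X assume X: "1 + (\<Sum>i<n. 2 * \<mu> i) \<le> X"
      have "2 * \<mu> i \<le> (\<Sum>i<n. 2 * \<mu> i)" if "i < n" for i
        using that \<mu> by (intro member_le_sum) auto
      moreover have "0 \<le> (\<Sum>i<n. 2 * \<mu> i)" using \<mu> by (intro sum_nonneg) auto
      ultimately show "2 * pi * \<Phi> F \<le> pi * C * R / t + E * inverse X"
        using X by (intro main) force+
    qed
  qed simp
  then show ?thesis
    using t by (simp add: F_def[abs_def] field_simps)
qed

end

section \<open>Smoothing by products of rational functions\<close>

text \<open>Take the last grid point not beyond \<open>t m / 2\<close>: the next one is beyond, and
  it is larger by at most the factor \<open>1 + \<kappa>\<close>. If already \<open>t 1\<close>
  passes the midpoint, take \<open>n = 1\<close>: the second step has length at least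
  \<open>t 1 / \<kappa>\<close>.\<close>

lemma time_partition_split:
  fixes t :: "nat \<Rightarrow> real"
  assumes \<kappa>: "0 < \<kappa>" and t0: "t 0 = 0" and m: "2 \<le> m"
    and inc: "\<And>l. l < m \<Longrightarrow> t l < t (Suc l)"
    and up: "\<And>l. 1 \<le> l \<Longrightarrow> l < m \<Longrightarrow> t (Suc l) - t l \<le> \<kappa> * (t l - t (l - 1))"
    and down: "\<And>l. 1 \<le> l \<Longrightarrow> l < m \<Longrightarrow> t l - t (l - 1) \<le> \<kappa> * (t (Suc l) - t l)"
  shows "\<exists>n\<ge>1. n < m \<and> t m / (2 * (1 + \<kappa>)) \<le> t n \<and> t m / (2 * (1 + \<kappa>)) \<le> t m - t n"
proof -
  have mono: "t i \<le> t j" if "i \<le> j" "j \<le> m" for i j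
    using that
  proof (induction j rule: dec_induct)
    case (step k)
    then show ?case using inc[of k] by force
  qed simp
  have tm: "0 < t m" using mono[of 1 m] inc[of 0] t0 m by simp
  have e: "t m / (2 * (1 + \<kappa>)) \<le> t m / 2"
    using \<kappa> tm by (intro divide_left_mono) auto
  show ?thesis
  proof (cases "t 1 \<le> t m / 2")
    case True
    define n where "n = Max {l. l < m \<and> t l \<le> t m / 2}"
    have fin: "finite {l. l < m \<and> t l \<le> t m / 2}" by simp
    have "1 \<in> {l. l < m \<and> t l \<le> t m / 2}" using True m by simp
    then have n1: "1 \<le> n" and n: "n < m" "t n \<le> t m / 2"
      using Max_ge[OF fin] Max_in[OF fin] unfolding n_def by blast+
    have "t m / 2 < t (Suc n)"
    proof (cases "Suc n = m")
      case False
      then have "Suc n < m" using n by simp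
      moreover have "Suc n \<notin> {l. l < m \<and> t l \<le> t m / 2}"
        using Max_ge[OF fin, of "Suc n"] n_def by linarith
      ultimately show ?thesis by simp
    qed (use tm in auto)
    also have "t (Suc n) \<le> t n + \<kappa> * (t n - t (n - 1))" using up[OF n1 n(1)] by simp
    also have "\<dots> \<le> t n + \<kappa> * t n"
      using \<kappa> mono[of 0 "n - 1"] n t0 by simp
    finally have "t m / (2 * (1 + \<kappa>)) \<le> t n"
      using \<kappa> by (simp add: field_simps)
    then show ?thesis using n n1 e by (intro exI[of _ n]) auto
  next
    case False
    have "t 1 \<le> \<kappa> * (t 2 - t 1)"
      using down[of 1] m t0 by (simp add: numeral_2_eq_2)
    also have "\<dots> \<le> (1 + \<kappa>) * (t m - t 1)"
      using \<kappa> mono[of 2 m] mono[of 1 2] m by (intro mult_mono) auto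
    finally have "t m / 2 \<le> (1 + \<kappa>) * (t m - t 1)" using False by simp
    then have "t m / (2 * (1 + \<kappa>)) \<le> t m - t 1"
      using \<kappa> by (simp add: field_simps)
    then show ?thesis using False e m by (intro exI[of _ 1]) auto
  qed
qed

text \<open>This converts the damping of a group of steps into one factor governed by the total
  length of the group, however short the single steps are.\<close>

lemma prod_one_plus_ge:
  fixes x :: "'a \<Rightarrow> real"
  assumes "finite S" "\<And>l. l \<in> S \<Longrightarrow> 0 \<le> x l"
  shows "1 + (\<Sum>l\<in>S. x l) \<le> (\<Prod>l\<in>S. 1 + x l)"
  using assms
proof (induction S rule: finite_induct)
  case (insert a S)
  have "1 + (x a + (\<Sum>l\<in>S. x l)) \<le> (1 + x a) * (1 + (\<Sum>l\<in>S. x l))"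
    using insert.prems by (auto simp: algebra_simps intro!: mult_nonneg_nonneg sum_nonneg)
  also have "\<dots> \<le> (1 + x a) * (\<Prod>l\<in>S. 1 + x l)"
    using insert by (intro mult_left_mono) auto
  finally show ?case using insert by simp
qed simp

lemma sum_steps:
  fixes t :: "nat \<Rightarrow> real"
  shows "i \<le> j \<Longrightarrow> (\<Sum>l\<in>{i<..j}. t l - t (l - 1)) = t j - t i"
proof (induction j rule: dec_induct)
  case (step k)
  have "{i<..Suc k} = insert (Suc k) {i<..k}" using step by auto
  then show ?case using step by simp
qed simp

lemma time_pos:
  fixes t :: "nat \<Rightarrow> real"
  assumes "0 < m" "\<forall>l<m. t l < t (Suc l)"
  shows "t 0 < t m"
  using assms
proof (induction m)
  case (Suc m)
  then show ?case by (cases m) (auto intro: less_trans)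
qed simp

text \<open>The amplification factors of the earlier steps, followed by the rational function of the
  current step with numerator coefficients \<open>a\<close>. The choice of \<open>a\<close> decides
  between value, time derivative and jump. The field is left open because the eigenvalues are real
  while the contour is complex.\<close>

definition dg_symbol :: "nat \<Rightarrow> (nat \<Rightarrow> real) \<Rightarrow> nat \<Rightarrow> (nat \<Rightarrow> real) \<Rightarrow> 'a::real_normed_field \<Rightarrow> 'a" where
  "dg_symbol q t m a z =
    (\<Prod>l\<in>{0<..<m}. polyval q (dg_ncoeff q 1) (of_real (t l - t (l - 1)) * z) / dg_den q (of_real (t l - t (l - 1)) * z))
    * (polyval q a (of_real (t m - t (m - 1)) * z) / dg_den q (of_real (t m - t (m - 1)) * z))"

lemma dg_symbol_of_real: "dg_symbol q t m a (of_real x) = of_real (dg_symbol q t m a x)"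
  by (simp only: dg_symbol_def of_real_mult of_real_prod of_real_divide polyval_of_real[symmetric]
      dg_den_of_real[symmetric] of_real_eq_id id_apply)

lemma dg_symbol_holomorphic:
  assumes "\<And>l. l < m \<Longrightarrow> t l < t (Suc l)" "1 \<le> m"
  shows "dg_symbol q t m a holomorphic_on {z. 0 \<le> Re z}"
proof -
  have "dg_den q (of_real (t l - t (l - 1)) * z) \<noteq> 0" if "0 < l" "l \<le> m" "0 \<le> Re z" for l and z :: complex
    using assms(1)[of "l - 1"] that by (intro dg_den_nonzero) (auto simp: less_imp_le)
  then show ?thesis
    unfolding dg_symbol_def[abs_def] using assms(2) by (intro holomorphic_intros) auto
qed

definition graded_steps :: "real \<Rightarrow> (nat \<Rightarrow> real) \<Rightarrow> nat \<Rightarrow> bool" where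
  "graded_steps \<kappa> t m \<longleftrightarrow> t 0 = 0 \<and> (\<forall>l<m. t l < t (Suc l)) \<and>
    (\<forall>l. 1 \<le> l \<longrightarrow> l < m \<longrightarrow> t (Suc l) - t l \<le> \<kappa> * (t l - t (l - 1)) \<and> t l - t (l - 1) \<le> \<kappa> * (t (Suc l) - t l))"

text \<open>Coordinates with respect to an eigenbasis: \<open>\<Phi>\<close> is the norm, \<open>\<mu>\<close> the eigenvalues, \<open>v\<close> the
  initial value. The resolvent estimate is needed on the boundary of a sector and on the negative
  real axis.\<close>
locale spectral_estimate = fin_seminorm +
  fixes \<mu> :: "nat \<Rightarrow> real" and v :: "nat \<Rightarrow> complex" and R \<tau> :: real
  assumes eigenvalue_nonneg: "i < n \<Longrightarrow> 0 \<le> \<mu> i"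
    and initial_le: "\<Phi> v \<le> 2 * R"
    and resolvent_le: "(0 < Re z \<and> \<bar>Im z\<bar> = \<tau> * Re z) \<or> (Re z < 0 \<and> Im z = 0) \<Longrightarrow>
         \<Phi> (\<lambda>i. v i / (z - of_real (\<mu> i))) \<le> R / cmod z"
begin

lemma bound_nonneg: "0 \<le> R"
  using nonneg[of v] initial_le by simp

end

text \<open>With \<open>w = - 1 / k\<close> the subtracted part is
  \<open>\<mu> / (1 + k * \<mu>) = (1 - w / (w - \<mu>)) / k\<close>, the identity minus one
  resolvent on the negative real axis. It costs \<open>(2 * R + R) / k\<close> times
  \<open>K\<close>, by \<open>initial_le\<close> and by the resolvent estimate at
  \<open>w\<close>.\<close>

lemma dg_smoothing_first_step:
  assumes K: "0 \<le> K" and \<tau>: "0 < \<tau>"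
  shows "\<exists>C\<ge>0. \<forall>n \<Phi> \<mu> v R k a. spectral_estimate n \<Phi> \<mu> v R \<tau> \<longrightarrow> 0 < k \<longrightarrow> (\<forall>j\<le>q. \<bar>a j\<bar> \<le> K) \<longrightarrow>
     \<Phi> (\<lambda>i. of_real (\<mu> i) * (polyval q a (of_real k * of_real (\<mu> i)) / dg_den q (of_real k * of_real (\<mu> i))) * v i) \<le> C * R / k"
proof -
  obtain C0 where C0: "0 < C0" and B: "\<And>a z. (\<forall>j\<le>q. \<bar>a j\<bar> \<le> K) \<Longrightarrow> 0 \<le> Re z \<Longrightarrow>
    cmod (polyval q a z / dg_den q z - of_real (a q) / (1 + z)) * (1 + (cmod z)\<^sup>2) \<le> C0"
    using dg_quotient_corrected_bound[OF K, of q] by blast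
  have "\<Phi> (\<lambda>i. of_real (\<mu> i) * (polyval q a (of_real k * of_real (\<mu> i)) / dg_den q (of_real k * of_real (\<mu> i))) * v i)
     \<le> (C0 / 2 + 3 * K) * R / k"
    if est: "spectral_estimate n \<Phi> \<mu> v R \<tau>" and k: "0 < k" and a: "\<forall>j\<le>q. \<bar>a j\<bar> \<le> K"
    for n \<Phi> \<mu> v R k and a :: "nat \<Rightarrow> real"
  proof -
    interpret spectral_estimate n \<Phi> \<mu> v R \<tau> by (rule est)
    let ?S = "\<lambda>i. of_real (\<mu> i) * (polyval q a (of_real k * of_real (\<mu> i)) / dg_den q (of_real k * of_real (\<mu> i))) * v i"
    define f where "f z = polyval q a (of_real k * z) / dg_den q (of_real k * z) - of_real (a q) / (1 + of_real k * z)" for z :: complex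
    define w where "w = complex_of_real (- (1 / k))"
    have nz: "1 + of_real k * z \<noteq> 0" if "0 \<le> Re z" for z
      using cmod_one_plus_ge(1)[of "of_real k * z"] that k by auto
    have hol: "f holomorphic_on {z. 0 \<le> Re z}"
      unfolding f_def[abs_def] using k nz by (intro holomorphic_intros dg_den_nonzero) auto
    have "\<Phi> (\<lambda>i. of_real (\<mu> i) * f (of_real (\<mu> i)) * v i) \<le> C0 * R / (2 * k)"
    proof (rule functional_calculus_bound[OF _ hol k \<tau>])
      fix z :: complex assume z: "\<bar>Im z\<bar> \<le> \<tau> * Re z"
      then have "0 \<le> \<tau> * Re z" by (rule order_trans[rotated]) simp
      then have "0 \<le> Re z" using \<tau> by (simp add: zero_le_mult_iff)
      then have "cmod (f z) * (1 + (k * cmod z)\<^sup>2) \<le> C0"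
        using B[OF a, of "of_real k * z"] k by (simp add: f_def norm_mult)
      moreover have "0 < 1 + (k * cmod z)\<^sup>2" by (intro add_pos_nonneg) auto
      ultimately show "cmod (f z) \<le> C0 / (1 + (k * cmod z)\<^sup>2)" by (simp add: pos_le_divide_eq)
    qed (use eigenvalue_nonneg resolvent_le in auto)
    moreover have "\<Phi> (\<lambda>i. of_real (a q / k) * (v i + w * (v i / (w - of_real (\<mu> i))) * -1)) \<le> K / k * (3 * R)"
    proof -
      have "\<Phi> (\<lambda>i. (- w) * (v i / (w - of_real (\<mu> i)))) \<le> cmod w * (R / cmod w)"
        unfolding homogeneous norm_minus_cancel using resolvent_le[of w] k
        by (intro mult_left_mono) (simp_all add: w_def)
      then have "\<Phi> (\<lambda>i. v i + (- w) * (v i / (w - of_real (\<mu> i)))) \<le> 3 * R"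
        using triangle[of v "\<lambda>i. (- w) * (v i / (w - of_real (\<mu> i)))"] initial_le k by (simp add: w_def)
      moreover have "\<bar>a q\<bar> / k \<le> K / k" using a k by (intro divide_right_mono) auto
      ultimately have "\<bar>a q\<bar> / k * \<Phi> (\<lambda>i. v i + (- w) * (v i / (w - of_real (\<mu> i)))) \<le> K / k * (3 * R)"
        using k K nonneg by (intro mult_mono) auto
      then show ?thesis
        using k by (subst homogeneous) (simp add: norm_divide)
    qed
    moreover have "\<Phi> ?S
      = \<Phi> (\<lambda>i. of_real (\<mu> i) * f (of_real (\<mu> i)) * v i + of_real (a q / k) * (v i + w * (v i / (w - of_real (\<mu> i))) * -1))"
    proof (rule cong)
      fix i assume i: "i < n"
      have p: "0 < 1 + k * \<mu> i" using eigenvalue_nonneg[OF i] k by (simp add: add_pos_nonneg)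
      have "w / (w - of_real (\<mu> i)) = of_real (- (1 / k) / (- (1 / k) - \<mu> i))"
        by (simp add: w_def)
      also have "- (1 / k) / (- (1 / k) - \<mu> i) = 1 / (1 + k * \<mu> i)"
        using p k by (simp add: divide_simps) (simp add: algebra_simps)
      finally have w: "w / (w - of_real (\<mu> i)) = of_real (1 / (1 + k * \<mu> i))" .
      have "of_real (a q / k) * (v i + w * (v i / (w - of_real (\<mu> i))) * -1)
          = of_real (a q / k) * (v i - v i * (w / (w - of_real (\<mu> i))))"
        by simp
      also have "\<dots> = of_real (a q / k * (1 - 1 / (1 + k * \<mu> i))) * v i"
        unfolding w by (simp add: algebra_simps)
      also have "a q / k * (1 - 1 / (1 + k * \<mu> i)) = \<mu> i * (a q / (1 + k * \<mu> i))"
        using p k by (simp add: divide_simps)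
      finally show "?S i
         = of_real (\<mu> i) * f (of_real (\<mu> i)) * v i + of_real (a q / k) * (v i + w * (v i / (w - of_real (\<mu> i))) * -1)"
        by (simp add: f_def algebra_simps)
    qed
    ultimately have "\<Phi> ?S
      \<le> C0 * R / (2 * k) + K / k * (3 * R)"
      by (simp only:) (rule order_trans[OF triangle add_mono])
    also have "\<dots> = (C0 / 2 + 3 * K) * R / k" using k by (simp add: field_simps)
    finally show ?thesis .
  qed
  moreover have "0 \<le> C0 / 2 + 3 * K" using C0 K by simp
  ultimately show ?thesis by blast
qed

lemma dg_smoothing_later_steps:
  assumes K: "0 \<le> K" and \<tau>: "0 < \<tau>" and \<kappa>: "0 < \<kappa>"
  shows "\<exists>C\<ge>0. \<forall>n \<Phi> \<mu> v R t m a. spectral_estimate n \<Phi> \<mu> v R \<tau> \<longrightarrow> graded_steps \<kappa> t m \<longrightarrow> 2 \<le> m \<longrightarrow>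
     (\<forall>j\<le>q. \<bar>a j\<bar> \<le> K) \<longrightarrow>
     \<Phi> (\<lambda>i. of_real (\<mu> i) * dg_symbol q t m a (of_real (\<mu> i)) * v i) \<le> C * R / t m"
proof -
  \<comment> \<open>\<open>\<bar>Im z\<bar> \<le> \<tau> * Re z\<close> implies
    \<open>cmod z \<le> (1 + \<tau>) * Re z\<close>, the form of sector condition in
    \<open>dg_damping\<close>.\<close>
  define \<sigma> where "\<sigma> = 1 / (1 + \<tau>)"
  have "0 < \<sigma>" using \<tau> by (simp add: \<sigma>_def)
  then obtain c0 where c0: "0 < c0" and damp: "\<And>z. \<sigma> * cmod z \<le> Re z \<Longrightarrow>
    cmod (polyval q (dg_ncoeff q 1) z) * (1 + c0 * cmod z) \<le> cmod (dg_den q z)"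
    using dg_damping by blast
  obtain C0 where C0: "0 < C0" and B: "\<And>a z. (\<forall>j\<le>q. \<bar>a j\<bar> \<le> K) \<Longrightarrow> 0 \<le> Re z \<Longrightarrow>
    cmod (polyval q a z) * (1 + cmod z) \<le> C0 * cmod (dg_den q z)"
    using dg_quotient_bound[OF K, of q] by blast
  \<comment> \<open>One rate for all factors: \<open>c0\<close> belongs to the damping of the
    earlier steps, 1 to the bound for the current step.\<close>
  define c where "c = min 1 c0"
  have c: "0 < c" "c \<le> 1" "c \<le> c0" using c0 by (auto simp: c_def)
  \<comment> \<open>The rate \<open>c\<close> times the fraction of \<open>t m\<close> that
    \<open>time_partition_split\<close> guarantees for each group.\<close>
  define \<epsilon> where "\<epsilon> = c / (2 * (1 + \<kappa>))"
  have \<epsilon>: "0 < \<epsilon>" using c \<kappa> by (simp add: \<epsilon>_def)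
  have "\<Phi> (\<lambda>i. of_real (\<mu> i) * dg_symbol q t m a (of_real (\<mu> i)) * v i) \<le> C0 / (2 * \<epsilon>) * R / t m"
    if est: "spectral_estimate n \<Phi> \<mu> v R \<tau>" and t: "graded_steps \<kappa> t m" and m: "2 \<le> m"
      and a: "\<forall>j\<le>q. \<bar>a j\<bar> \<le> K"
    for n \<Phi> \<mu> v R m and t a :: "nat \<Rightarrow> real"
  proof -
    interpret spectral_estimate n \<Phi> \<mu> v R \<tau> by (rule est)
    have t0: "t 0 = 0" and inc: "\<forall>l<m. t l < t (Suc l)" using t by (auto simp: graded_steps_def)
    obtain p where p: "1 \<le> p" "p < m" and tp: "t m / (2 * (1 + \<kappa>)) \<le> t p" "t m / (2 * (1 + \<kappa>)) \<le> t m - t p"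
      using time_partition_split[where t = t and m = m, OF \<kappa> t0 m] t by (auto simp: graded_steps_def)
    have step: "0 < t l - t (l - 1)" if "0 < l" "l \<le> m" for l
      using inc[rule_format, of "l - 1"] that by simp
    have tm: "0 < t m"
      using time_pos[of m t] inc t0 m by simp
    have bound: "cmod (dg_symbol q t m a z) \<le> C0 / (1 + (\<epsilon> * t m * cmod z)\<^sup>2)" if z: "\<bar>Im z\<bar> \<le> \<tau> * Re z" for z
    proof -
      define x where "x = cmod z"
      define k where "k l = t l - t (l - 1)" for l
      have x: "0 \<le> x" by (simp add: x_def)
      have "0 \<le> \<tau> * Re z" using z by (rule order_trans[rotated]) simp
      then have Re: "0 \<le> Re z" using \<tau> by (simp add: zero_le_mult_iff)
      have "cmod z \<le> (1 + \<tau>) * Re z" using z Re cmod_le[of z] by (simp add: algebra_simps)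
      then have sec: "\<sigma> * cmod z \<le> Re z" using \<tau> by (simp add: \<sigma>_def field_simps)
      have den: "0 < cmod (dg_den q (of_real (k l) * z))" if "0 < l" "l \<le> m" for l
        using step[OF that] Re dg_den_nonzero[of "of_real (k l) * z" q] by (simp add: k_def less_imp_le)
      have 1: "cmod (polyval q (dg_ncoeff q 1) (of_real (k l) * z) / dg_den q (of_real (k l) * z)) \<le> 1 / (1 + c * k l * x)"
        if l: "0 < l" "l \<le> m" for l
      proof -
        have kl: "0 < k l" using step[OF l] by (simp add: k_def)
        have "cmod (polyval q (dg_ncoeff q 1) (of_real (k l) * z)) * (1 + c * k l * x)
          \<le> cmod (polyval q (dg_ncoeff q 1) (of_real (k l) * z)) * (1 + c0 * cmod (of_real (k l) * z))"
          using kl c x by (intro mult_left_mono) (auto simp: norm_mult x_def mult_right_mono)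
        also have "\<dots> \<le> cmod (dg_den q (of_real (k l) * z))"
          using sec kl by (intro damp) (auto simp: norm_mult mult.left_commute)
        finally show ?thesis
          using den[OF l] kl c x by (simp add: norm_divide divide_le_eq pos_le_divide_eq add_pos_nonneg)
      qed
      have 2: "cmod (polyval q a (of_real (k m) * z) / dg_den q (of_real (k m) * z)) \<le> C0 / (1 + c * k m * x)"
      proof -
        have km: "0 < k m" using step[of m] m by (simp add: k_def)
        have "c * k m * x \<le> 1 * k m * x" using c km x by (intro mult_right_mono) auto
        then have "cmod (polyval q a (of_real (k m) * z)) * (1 + c * k m * x)
          \<le> cmod (polyval q a (of_real (k m) * z)) * (1 + cmod (of_real (k m) * z))"
          using km by (intro mult_left_mono) (auto simp: norm_mult x_def)
        also have "\<dots> \<le> C0 * cmod (dg_den q (of_real (k m) * z))"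
          using km Re by (intro B[OF a]) auto
        finally show ?thesis
          using den[of m] m km c x by (simp add: norm_divide divide_le_eq pos_le_divide_eq add_pos_nonneg)
      qed
      have ckx: "0 \<le> c * k l * x" if "0 < l" "l \<le> m" for l
        using step[OF that] c x by (simp add: k_def)
      have "cmod (dg_symbol q t m a z) \<le> (\<Prod>l\<in>{0<..<m}. 1 / (1 + c * k l * x)) * (C0 / (1 + c * k m * x))"
        unfolding dg_symbol_def norm_mult prod_norm[symmetric] k_def[symmetric]
      proof (intro mult_mono prod_mono conjI)
        show "0 \<le> (\<Prod>l\<in>{0<..<m}. 1 / (1 + c * k l * x))"
          by (intro prod_nonneg) (use ckx in force)
      qed (use 1 2 in auto)
      also have "\<dots> = C0 / (\<Prod>l\<in>{0<..m}. 1 + c * k l * x)"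
      proof -
        have "{0<..m} = insert m {0<..<m}" using m by auto
        then show ?thesis by (simp add: prod_dividef)
      qed
      \<comment> \<open>Since \<open>p < m\<close>, the current step belongs to the second group and
        its factor counts there like a damping factor.\<close>
      also have "(\<Prod>l\<in>{0<..m}. 1 + c * k l * x) = (\<Prod>l\<in>{0<..p}. 1 + c * k l * x) * (\<Prod>l\<in>{p<..m}. 1 + c * k l * x)"
      proof -
        have "{0<..m} = {0<..p} \<union> {p<..m}" "{0<..p} \<inter> {p<..m} = {}" using p by auto
        then show ?thesis by (simp add: prod.union_disjoint)
      qed
      also have "C0 / \<dots> \<le> C0 / (1 + (\<epsilon> * t m * x)\<^sup>2)"
      proof (rule divide_left_mono)
        have s: "1 + c * x * (t j - t i) \<le> (\<Prod>l\<in>{i<..j}. 1 + c * k l * x)" if "i \<le> j" "j \<le> m" for i j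
        proof -
          have "1 + (\<Sum>l\<in>{i<..j}. c * k l * x) \<le> (\<Prod>l\<in>{i<..j}. 1 + c * k l * x)"
            using that by (intro prod_one_plus_ge) (auto intro!: ckx)
          moreover have "(\<Sum>l\<in>{i<..j}. c * k l * x) = c * x * (t j - t i)"
            unfolding sum_steps[OF that(1), symmetric] k_def by (simp add: sum_distrib_left mult_ac)
          ultimately show ?thesis by simp
        qed
        have e: "\<epsilon> * t m * x = c * x * (t m / (2 * (1 + \<kappa>)))" by (simp add: \<epsilon>_def)
        have e0: "0 \<le> \<epsilon> * t m * x" using \<epsilon> tm x by simp
        have a1: "\<epsilon> * t m * x \<le> c * x * (t p - t 0)" unfolding e t0 using tp c x by (intro mult_left_mono) auto
        have a2: "\<epsilon> * t m * x \<le> c * x * (t m - t p)" unfolding e using tp c x by (intro mult_left_mono) auto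
        have "1 + (\<epsilon> * t m * x)\<^sup>2 \<le> (1 + \<epsilon> * t m * x) * (1 + \<epsilon> * t m * x)"
          using e0 by (simp add: power2_eq_square algebra_simps)
        also have "\<dots> \<le> (\<Prod>l\<in>{0<..p}. 1 + c * k l * x) * (\<Prod>l\<in>{p<..m}. 1 + c * k l * x)"
          using a1 a2 s[of 0 p] s[of p m] p e0 by (intro mult_mono) auto
        finally show le: "1 + (\<epsilon> * t m * x)\<^sup>2 \<le> (\<Prod>l\<in>{0<..p}. 1 + c * k l * x) * (\<Prod>l\<in>{p<..m}. 1 + c * k l * x)" .
        have pos: "0 < 1 + (\<epsilon> * t m * x)\<^sup>2" by (intro add_pos_nonneg) auto
        show "0 < (\<Prod>l\<in>{0<..p}. 1 + c * k l * x) * (\<Prod>l\<in>{p<..m}. 1 + c * k l * x) * (1 + (\<epsilon> * t m * x)\<^sup>2)"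
          by (rule mult_pos_pos[OF order_less_le_trans[OF pos le] pos])
      qed (use C0 in simp)
      finally show ?thesis by (simp add: x_def)
    qed
    have "\<Phi> (\<lambda>i. of_real (\<mu> i) * dg_symbol q t m a (of_real (\<mu> i)) * v i) \<le> C0 * R / (2 * (\<epsilon> * t m))"
      using eigenvalue_nonneg \<epsilon> tm resolvent_le inc m
      by (intro functional_calculus_bound[OF _ dg_symbol_holomorphic _ \<tau> bound]) auto
    then show ?thesis by (simp add: mult.assoc)
  qed
  moreover have "0 \<le> C0 / (2 * \<epsilon>)" using C0 \<epsilon> by simp
  ultimately show ?thesis by blast
qed

lemma dg_smoothing:
  assumes K: "0 \<le> K" and \<tau>: "0 < \<tau>" and \<kappa>: "0 < \<kappa>"
  shows "\<exists>C\<ge>0. \<forall>n \<Phi> \<mu> v R t m a. spectral_estimate n \<Phi> \<mu> v R \<tau> \<longrightarrow> graded_steps \<kappa> t m \<longrightarrow> 1 \<le> m \<longrightarrow>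
     (\<forall>j\<le>q. \<bar>a j\<bar> \<le> K) \<longrightarrow>
     \<Phi> (\<lambda>i. of_real (\<mu> i) * dg_symbol q t m a (of_real (\<mu> i)) * v i) \<le> C * R / t m"
proof -
  obtain C1 where C1: "0 \<le> C1" and 1: "\<And>n \<Phi> \<mu> v R k a. spectral_estimate n \<Phi> \<mu> v R \<tau> \<Longrightarrow> 0 < k \<Longrightarrow> (\<forall>j\<le>q. \<bar>a j\<bar> \<le> K) \<Longrightarrow>
     \<Phi> (\<lambda>i. of_real (\<mu> i) * (polyval q a (of_real k * of_real (\<mu> i)) / dg_den q (of_real k * of_real (\<mu> i))) * v i) \<le> C1 * R / k"
    using dg_smoothing_first_step[OF K \<tau>, of q] by blast
  obtain C2 where C2: "0 \<le> C2" and 2: "\<And>n \<Phi> \<mu> v R t m a. spectral_estimate n \<Phi> \<mu> v R \<tau> \<Longrightarrow> graded_steps \<kappa> t m \<Longrightarrow> 2 \<le> m \<Longrightarrow>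
     (\<forall>j\<le>q. \<bar>a j\<bar> \<le> K) \<Longrightarrow> \<Phi> (\<lambda>i. of_real (\<mu> i) * dg_symbol q t m a (of_real (\<mu> i)) * v i) \<le> C2 * R / t m"
    using dg_smoothing_later_steps[OF K \<tau> \<kappa>, of q] by blast
  show ?thesis
  proof (intro exI[of _ "max C1 C2"] conjI allI impI)
    show "0 \<le> max C1 C2" using C1 by simp
    fix n \<Phi> \<mu> v R m and t a :: "nat \<Rightarrow> real"
    assume est: "spectral_estimate n \<Phi> \<mu> v R \<tau>" and t: "graded_steps \<kappa> t m" and m: "1 \<le> m"
      and a: "\<forall>j\<le>q. \<bar>a j\<bar> \<le> K"
    let ?S = "\<lambda>i. of_real (\<mu> i) * dg_symbol q t m a (of_real (\<mu> i)) * v i"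
    have R: "0 \<le> R" by (rule spectral_estimate.bound_nonneg[OF est])
    have t0: "t 0 = 0" and tm: "0 < t m"
      using time_pos[of m t] t m by (auto simp: graded_steps_def)
    have "\<Phi> ?S \<le> C1 * R / t m \<or> \<Phi> ?S \<le> C2 * R / t m"
    proof (cases "m = 1")
      case True
      then show ?thesis
        using 1[OF est tm a] t0 by (simp add: dg_symbol_def)
    next
      case False
      then show ?thesis using 2[OF est t _ a] m by simp
    qed
    moreover have "C1 * R / t m \<le> max C1 C2 * R / t m" "C2 * R / t m \<le> max C1 C2 * R / t m"
      using R tm by (intro divide_right_mono mult_right_mono; simp)+
    ultimately show "\<Phi> ?S \<le> max C1 C2 * R / t m"
      by linarith
  qed
qed

section \<open>Simultaneous diagonalization of two symmetric forms\<close>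

definition fun_scale :: "real \<Rightarrow> ('a \<Rightarrow> real) \<Rightarrow> 'a \<Rightarrow> real" where
  "fun_scale c f = (\<lambda>x. c * f x)"

interpretation fs: vector_space fun_scale
  by unfold_locales (auto simp: fun_scale_def fun_eq_iff algebra_simps)

lemma sum_fun_apply: "(\<Sum>i\<in>A. f i) x = (\<Sum>i\<in>A. f i x :: real)"
  by (induction A rule: infinite_finite_induct) auto

locale sym_form =
  fixes V :: "('a \<Rightarrow> real) set" and B :: "('a \<Rightarrow> real) \<Rightarrow> ('a \<Rightarrow> real) \<Rightarrow> real"
  assumes subspace: "fs.subspace V"
    and add_left: "u \<in> V \<Longrightarrow> v \<in> V \<Longrightarrow> w \<in> V \<Longrightarrow> B (u + v) w = B u w + B v w"
    and scale_left: "u \<in> V \<Longrightarrow> w \<in> V \<Longrightarrow> B (fun_scale c u) w = c * B u w"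
    and sym: "u \<in> V \<Longrightarrow> v \<in> V \<Longrightarrow> B u v = B v u"
begin

lemma add_right: "u \<in> V \<Longrightarrow> v \<in> V \<Longrightarrow> w \<in> V \<Longrightarrow> B w (u + v) = B w u + B w v"
  using add_left sym fs.subspace_add[OF subspace] by metis

lemma scale_right: "u \<in> V \<Longrightarrow> w \<in> V \<Longrightarrow> B w (fun_scale c u) = c * B w u"
  using scale_left sym fs.subspace_scale[OF subspace] by metis

lemma diff_left:
  assumes "u \<in> V" "v \<in> V" "w \<in> V"
  shows "B (u - v) w = B u w - B v w"
proof -
  have eq: "u - v = u + fun_scale (-1) v" by (auto simp: fun_scale_def fun_eq_iff)
  have "fun_scale (-1) v \<in> V" by (rule fs.subspace_scale[OF subspace assms(2)])
  from add_left[OF assms(1) this assms(3)] show ?thesis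
    unfolding eq scale_left[OF assms(2,3)] by linarith
qed

lemma zero_left: "w \<in> V \<Longrightarrow> B 0 w = 0"
  using scale_left[of w w 0] by simp

lemma comb_in: "(\<And>i. i \<in> I \<Longrightarrow> f i \<in> V) \<Longrightarrow> (\<Sum>i\<in>I. fun_scale (c i) (f i)) \<in> V"
  by (intro fs.subspace_sum fs.subspace_scale subspace)

lemma comb_left:
  assumes "finite I" "\<And>i. i \<in> I \<Longrightarrow> f i \<in> V" "w \<in> V"
  shows "B (\<Sum>i\<in>I. fun_scale (c i) (f i)) w = (\<Sum>i\<in>I. c i * B (f i) w)"
  using assms
proof (induction I rule: finite_induct)
  case (insert i I)
  then have "(\<Sum>i\<in>I. fun_scale (c i) (f i)) \<in> V" "fun_scale (c i) (f i) \<in> V"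
    using comb_in[of I f c] fs.subspace_scale[OF subspace] by auto
  then have "B (fun_scale (c i) (f i) + (\<Sum>i\<in>I. fun_scale (c i) (f i))) w
      = c i * B (f i) w + (\<Sum>i\<in>I. c i * B (f i) w)"
    using insert add_left[of "fun_scale (c i) (f i)" "\<Sum>i\<in>I. fun_scale (c i) (f i)" w]
      scale_left[of "f i" w "c i"] by simp
  then show ?case by (simp only: sum.insert[OF insert.hyps(1,2)])
qed (simp add: zero_left)

lemma comb_right:
  assumes "finite I" "\<And>i. i \<in> I \<Longrightarrow> f i \<in> V" "w \<in> V"
  shows "B w (\<Sum>i\<in>I. fun_scale (c i) (f i)) = (\<Sum>i\<in>I. c i * B w (f i))"
proof -
  have "B w (\<Sum>i\<in>I. fun_scale (c i) (f i)) = B (\<Sum>i\<in>I. fun_scale (c i) (f i)) w"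
    using assms by (intro sym comb_in) auto
  also have "\<dots> = (\<Sum>i\<in>I. c i * B (f i) w)" by (rule comb_left[OF assms])
  also have "\<dots> = (\<Sum>i\<in>I. c i * B w (f i))"
    using assms sym by (intro sum.cong) auto
  finally show ?thesis .
qed

lemma sub: "fs.subspace U \<Longrightarrow> U \<subseteq> V \<Longrightarrow> sym_form U B"
  by unfold_locales (auto intro: add_left scale_left sym)

end

locale inner_form = sym_form +
  assumes pos: "u \<in> V \<Longrightarrow> u \<noteq> 0 \<Longrightarrow> 0 < B u u"

text \<open>Coefficient vectors are functions on a whole type with the product topology. Fixing them
  to 0 outside \<open>S\<close> makes the sphere a closed subset of a product of compact
  sets.\<close>

lemma compact_coefficient_sphere:
  fixes S :: "'b set"
  assumes "finite S"
  shows "compact {c :: 'b \<Rightarrow> real. (\<forall>b. b \<notin> S \<longrightarrow> c b = 0) \<and> (\<Sum>b\<in>S. (c b)\<^sup>2) = 1}" (is "compact ?T")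
proof -
  let ?Q = "PiE UNIV (\<lambda>b. if b \<in> S then {-1..1::real} else {0})"
  have "compactin (product_topology (\<lambda>b. euclidean) UNIV) (?Q)"
    unfolding compactin_PiE by (intro disjI2) auto
  then have "compact (?Q)"
    by (simp add: euclidean_product_topology)
  moreover have "?T \<subseteq> ?Q"
  proof
    fix c assume c: "c \<in> ?T"
    have "\<bar>c b\<bar> \<le> 1" if "b \<in> S" for b
    proof -
      have "(c b)\<^sup>2 \<le> (\<Sum>b\<in>S. (c b)\<^sup>2)" using that assms by (intro member_le_sum) auto
      then show ?thesis using c by (simp add: abs_square_le_1)
    qed
    then show "c \<in> ?Q"
      using c by (auto simp: abs_le_iff PiE_UNIV_domain minus_le_iff)
  qed
  moreover have "closed ?T"
  proof -
    have "?T = (\<Inter>b\<in>-S. {c. c b = 0}) \<inter> {c. (\<Sum>b\<in>S. (c b)\<^sup>2) = 1}" by auto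
    moreover have "closed (\<Inter>b\<in>-S. {c :: 'b \<Rightarrow> real. c b = 0})"
      by (intro closed_INT ballI closed_Collect_eq continuous_on_product_coordinates continuous_on_const)
    moreover have "closed {c :: 'b \<Rightarrow> real. (\<Sum>b\<in>S. (c b)\<^sup>2) = 1}"
      by (intro closed_Collect_eq continuous_on_sum continuous_on_power continuous_on_product_coordinates continuous_on_const)
    ultimately show ?thesis by (simp only: closed_Int)
  qed
  ultimately have "compact (?Q \<inter> ?T)"
    and "?Q \<inter> ?T = ?T"
    by (simp only: compact_Int_closed, simp only: inf.absorb2)
  then show ?thesis by (simp only:)
qed

lemma linear_term_zero:
  fixes p r :: real
  assumes "\<And>s. 0 \<le> 2 * s * p + s\<^sup>2 * r" "0 \<le> r"
  shows "p = 0"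
proof (rule ccontr)
  assume "p \<noteq> 0"
  \<comment> \<open>The minimizer in \<open>s\<close> would be \<open>- p / r\<close>; the shifted
    denominator \<open>r + 1\<close> also covers \<open>r = 0\<close>.\<close>
  have "0 \<le> 2 * (- p / (r + 1)) * p + (- p / (r + 1))\<^sup>2 * r" by (rule assms(1))
  also have "\<dots> = - (p\<^sup>2 * (r + 2)) / (r + 1)\<^sup>2"
    using assms(2) by (simp add: divide_simps power2_eq_square) (simp add: algebra_simps)
  also have "\<dots> < 0"
    using \<open>p \<noteq> 0\<close> assms(2) by (intro divide_neg_pos) auto
  finally show False by simp
qed

text \<open>The quotient of \<open>a w w\<close> and \<open>ip w w\<close> does not change under
  scaling, so its minimum is attained on a compact sphere of coefficients. The vanishing first
  variation there is the weak eigenvalue equation.\<close>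

lemma rayleigh_minimizer:
  assumes ip: "inner_form U ip" and a: "sym_form U a"
    and fin: "finite S" "U \<subseteq> fs.span S" and ne: "U \<noteq> {0}"
  shows "\<exists>e\<in>U. ip e e = 1 \<and> (\<forall>w\<in>U. a e w = a e e * ip e w)"
proof -
  interpret ip: inner_form U ip by (rule ip)
  interpret a: sym_form U a by (rule a)
  obtain B where B: "B \<subseteq> U" "fs.independent B" "U \<subseteq> fs.span B"
    using fs.basis_exists by metis
  have finB: "finite B"
    using fs.independent_span_bound[OF fin(1) B(2)] B(1) fin(2) by blast
  define comb where "comb c = (\<Sum>b\<in>B. fun_scale (c b) b)" for c
  have comb_U: "comb c \<in> U" for c
    unfolding comb_def using B(1) by (intro ip.comb_in) auto
  define T where "T = {c. (\<forall>b. b \<notin> B \<longrightarrow> c b = 0) \<and> (\<Sum>b\<in>B. (c b)\<^sup>2) = (1::real)}"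
  have T: "compact T" unfolding T_def by (rule compact_coefficient_sphere[OF finB])
  have comb_nz: "comb c \<noteq> 0" if "c \<in> T" for c
  proof
    assume "comb c = 0"
    then have "\<forall>b\<in>B. c b = 0"
      using B(2) finB unfolding fs.independent_explicit_module comb_def by blast
    then have "(\<Sum>b\<in>B. (c b)\<^sup>2) = 0" by simp
    then show False using that by (simp add: T_def)
  qed
  have rep: "\<exists>s c. c \<in> T \<and> w = fun_scale s (comb c)" if w: "w \<in> U" "w \<noteq> 0" for w
  proof -
    obtain d where d: "w = (\<Sum>b\<in>B. fun_scale (d b) b)"
      using w B(3) fs.span_finite[OF finB] by blast
    define s where "s = sqrt (\<Sum>b\<in>B. (d b)\<^sup>2)"
    have "\<not> (\<forall>b\<in>B. d b = 0)" using d w(2) by (auto simp: fs.scale_zero_left)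
    then have d0: "0 < (\<Sum>b\<in>B. (d b)\<^sup>2)"
      using finB by (metis (mono_tags, lifting) sum_nonneg_0 sum_nonneg zero_le_power2 zero_eq_power2 order_le_less)
    from d0 have s: "0 < s" "s\<^sup>2 = (\<Sum>b\<in>B. (d b)\<^sup>2)" by (simp_all add: s_def)
    define c where "c b = (if b \<in> B then d b / s else 0)" for b
    have "(\<Sum>b\<in>B. (c b)\<^sup>2) = (\<Sum>b\<in>B. (d b)\<^sup>2) / s\<^sup>2"
      by (simp add: c_def power_divide sum_divide_distrib)
    then have "(\<Sum>b\<in>B. (c b)\<^sup>2) = 1" using s d0 by simp
    then have "c \<in> T" by (simp add: T_def) (simp add: c_def)
    moreover have "w = fun_scale s (comb c)"
      unfolding d comb_def fs.scale_sum_right fs.scale_scale using s by (intro sum.cong) (auto simp: c_def)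
    ultimately show ?thesis by blast
  qed
  define F where "F c = a (comb c) (comb c) / ip (comb c) (comb c)" for c
  have expand: "Q (comb c) (comb c) = (\<Sum>b\<in>B. c b * (\<Sum>b'\<in>B. c b' * Q b b'))"
    if Q: "sym_form U Q" for Q c
  proof -
    have "Q (comb c) (comb c) = (\<Sum>b\<in>B. c b * Q b (comb c))"
      by (subst (1) comb_def) (rule sym_form.comb_left[OF Q finB _ comb_U], use B(1) in auto)
    moreover have "Q b (comb c) = (\<Sum>b'\<in>B. c b' * Q b b')" if "b \<in> B" for b
      unfolding comb_def by (rule sym_form.comb_right[OF Q finB]) (use that B(1) in auto)
    ultimately show ?thesis by simp
  qed
  have coord: "continuous_on T (\<lambda>c. c b)" for b
    by (rule continuous_on_subset[OF continuous_on_product_coordinates]) simp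
  have cont: "continuous_on T (\<lambda>c. \<Sum>b\<in>B. c b * (\<Sum>b'\<in>B. c b' * Q b b'))" for Q :: "('a \<Rightarrow> real) \<Rightarrow> ('a \<Rightarrow> real) \<Rightarrow> real"
    by (rule continuous_on_sum, rule continuous_on_mult[OF coord], rule continuous_on_sum,
        rule continuous_on_mult[OF coord continuous_on_const])
  have "continuous_on T F"
    unfolding F_def[abs_def] expand[OF a] expand[OF ip.sym_form_axioms]
  proof (rule continuous_on_divide[OF cont cont], rule ballI)
    fix c assume "c \<in> T"
    then show "(\<Sum>b\<in>B. c b * (\<Sum>b'\<in>B. c b' * ip b b')) \<noteq> 0"
      using ip.pos[OF comb_U comb_nz] expand[OF ip.sym_form_axioms, of c] by force
  qed
  moreover have "T \<noteq> {}"
  proof -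
    obtain w where "w \<in> U" "w \<noteq> 0" using ne fs.subspace_0[OF ip.subspace] by blast
    then show ?thesis using rep by blast
  qed
  ultimately obtain c0 where c0: "c0 \<in> T" and min: "\<And>c. c \<in> T \<Longrightarrow> F c0 \<le> F c"
    using continuous_attains_inf[OF T] by blast
  define \<mu> where "\<mu> = F c0"
  define e0 where "e0 = comb c0"
  have e0: "e0 \<in> U" "e0 \<noteq> 0" unfolding e0_def using comb_U comb_nz c0 by auto
  have ip0: "0 < ip e0 e0" by (rule ip.pos[OF e0])
  have ge: "\<mu> * ip w w \<le> a w w" if w: "w \<in> U" for w
  proof (cases "w = 0")
    case True
    then show ?thesis using ip.zero_left[OF w] a.zero_left[OF w] by simp
  next
    case False
    then obtain s c where c: "c \<in> T" and ws: "w = fun_scale s (comb c)" using rep w by blast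
    have "\<mu> * ip (comb c) (comb c) \<le> a (comb c) (comb c)"
      using min[OF c] ip.pos[OF comb_U comb_nz[OF c]] by (simp add: \<mu>_def F_def[of c] pos_le_divide_eq)
    then have "s\<^sup>2 * (\<mu> * ip (comb c) (comb c)) \<le> s\<^sup>2 * a (comb c) (comb c)"
      by (intro mult_left_mono) auto
    then show ?thesis
      unfolding ws using comb_U[of c] fs.subspace_scale[OF ip.subspace comb_U[of c], of s]
      by (simp add: ip.scale_left ip.scale_right a.scale_left a.scale_right power2_eq_square mult_ac)
  qed
  have eq0: "a e0 e0 = \<mu> * ip e0 e0"
    using ip0 by (simp add: \<mu>_def F_def e0_def)
  have weak: "a e0 w = \<mu> * ip e0 w" if w: "w \<in> U" for w
  proof -
    have "a e0 w - \<mu> * ip e0 w = 0"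
    proof (rule linear_term_zero)
      show "0 \<le> a w w - \<mu> * ip w w" using ge[OF w] by simp
      fix s
      have sw: "fun_scale s w \<in> U" by (rule fs.subspace_scale[OF ip.subspace w])
      have in_U: "e0 + fun_scale s w \<in> U" by (rule fs.subspace_add[OF ip.subspace e0(1) sw])
      have q: "Q (e0 + fun_scale s w) (e0 + fun_scale s w) = Q e0 e0 + 2 * s * Q e0 w + s\<^sup>2 * Q w w"
        if "sym_form U Q" for Q
      proof -
        interpret Q: sym_form U Q by (rule that)
        show ?thesis
          using e0(1) w sw in_U Q.sym[OF e0(1) w]
          by (simp add: Q.add_left Q.add_right Q.scale_left Q.scale_right power2_eq_square algebra_simps)
      qed
      show "0 \<le> 2 * s * (a e0 w - \<mu> * ip e0 w) + s\<^sup>2 * (a w w - \<mu> * ip w w)"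
        using ge[OF in_U] eq0 unfolding q[OF a] q[OF ip.sym_form_axioms]
        by (simp add: algebra_simps)
    qed
    then show ?thesis by simp
  qed
  define r where "r = 1 / sqrt (ip e0 e0)"
  have r: "r * (r * ip e0 e0) = 1"
    using ip0 by (simp add: r_def field_simps flip: power2_eq_square)
  define e where "e = fun_scale r e0"
  have eU: "e \<in> U" unfolding e_def by (rule fs.subspace_scale[OF ip.subspace e0(1)])
  have 1: "ip e e = 1"
    using e0(1) eU r unfolding e_def by (simp add: ip.scale_left ip.scale_right)
  have 2: "a e w = \<mu> * ip e w" if "w \<in> U" for w
    using weak[OF that] that e0(1) unfolding e_def by (simp add: ip.scale_left a.scale_left)
  show ?thesis
    using 1 2 eU by (intro bexI[of _ e]) auto
qed

text \<open>A longest orthonormal system of eigenvectors is complete. Otherwise a minimizer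
  \<open>e'\<close> on its orthogonal complement would extend it: symmetry gives
  \<open>a e' (e i) = 0\<close>, so the eigenvalue equation for \<open>e'\<close> holds against all
  of \<open>V\<close> and not only against the complement.\<close>

lemma simultaneous_diagonalization:
  fixes V :: "('a \<Rightarrow> real) set"
  assumes ip: "inner_form V ip" and a: "sym_form V a"
    and nonneg: "\<And>u. u \<in> V \<Longrightarrow> 0 \<le> a u u"
    and fin: "finite S" "V \<subseteq> fs.span S"
  shows "\<exists>(n::nat) e \<mu>. (\<forall>i<n. e i \<in> V \<and> 0 \<le> \<mu> i) \<and>
    (\<forall>i<n. \<forall>j<n. ip (e i) (e j) = (if i = j then 1 else 0)) \<and>
    (\<forall>i<n. \<forall>w\<in>V. a (e i) w = \<mu> i * ip (e i) w) \<and>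
    (\<forall>v\<in>V. v = (\<Sum>i<n. fun_scale (ip v (e i)) (e i)))"
proof -
  interpret ip: inner_form V ip by (rule ip)
  interpret a: sym_form V a by (rule a)
  define P where "P n e \<longleftrightarrow> (\<forall>i<n. e i \<in> V) \<and>
    (\<forall>i<n. \<forall>j<n. ip (e i) (e j) = (if i = j then 1 else 0)) \<and>
    (\<forall>i<n. \<forall>w\<in>V. a (e i) w = a (e i) (e i) * ip (e i) w)" for n :: nat and e
  have bound: "n \<le> card S" if "P n e" for n e
  proof -
    have e: "e i \<in> V" "ip (e i) (e j) = (if i = j then 1 else 0)" if "i < n" "j < n" for i j
      using \<open>P n e\<close> that by (auto simp: P_def)
    have inj: "inj_on e {..<n}"
    proof (rule inj_onI)
      fix i j assume "i \<in> {..<n}" "j \<in> {..<n}" "e i = e j"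
      then show "i = j" using e(2)[of i j] e(2)[of j j] by (auto split: if_splits)
    qed
    have "fs.independent (e ` {..<n})"
    proof (rule fs.independent_if_scalars_zero)
      fix f x assume f: "(\<Sum>x\<in>e ` {..<n}. fun_scale (f x) x) = 0" and "x \<in> e ` {..<n}"
      then obtain j where j: "j < n" "x = e j" by auto
      have "(\<Sum>i<n. fun_scale (f (e i)) (e i)) = 0"
        using f by (simp add: sum.reindex[OF inj])
      then have "0 = ip (\<Sum>i<n. fun_scale (f (e i)) (e i)) (e j)"
        using ip.zero_left e j by simp
      also have "\<dots> = (\<Sum>i<n. f (e i) * ip (e i) (e j))"
        using e j by (intro ip.comb_left) auto
      also have "\<dots> = (\<Sum>i<n. if i = j then f (e i) else 0)"
        using e j by (intro sum.cong) auto
      finally show "f x = 0" using j by simp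
    qed simp
    moreover have "e ` {..<n} \<subseteq> fs.span S" using e fin(2) by blast
    ultimately have "card (e ` {..<n}) \<le> card S"
      using fs.independent_span_bound[OF fin(1)] by blast
    then show ?thesis using inj by (simp add: card_image)
  qed
  have "P 0 (\<lambda>i. 0)" by (simp add: P_def)
  then obtain n e where Pn: "P n e" and max: "\<And>n' e'. P n' e' \<Longrightarrow> n' \<le> n"
    using GreatestI_nat[of "\<lambda>n. \<exists>e. P n e" 0 "card S"] Greatest_le_nat[of "\<lambda>n. \<exists>e. P n e" _ "card S"] bound
    by metis
  have eV: "e i \<in> V" if "i < n" for i
    using Pn that unfolding P_def by blast
  have eo: "ip (e i) (e j) = (if i = j then 1 else 0)" if "i < n" "j < n" for i j
    using Pn that unfolding P_def by blast
  have weak: "a (e i) w = a (e i) (e i) * ip (e i) w" if "i < n" "w \<in> V" for i w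
    using Pn that unfolding P_def by blast
  define U where "U = {w\<in>V. \<forall>i<n. ip w (e i) = 0}"
  have subU: "fs.subspace U"
    using eV ip.zero_left fs.subspace_0[OF ip.subspace] fs.subspace_add[OF ip.subspace] fs.subspace_scale[OF ip.subspace]
    by (intro fs.subspaceI) (auto simp: U_def ip.add_left ip.scale_left)
  have UV: "U \<subseteq> V" by (auto simp: U_def)
  have proj: "v - (\<Sum>i<n. fun_scale (ip v (e i)) (e i)) \<in> U" if v: "v \<in> V" for v
  proof -
    define p where "p = (\<Sum>i<n. fun_scale (ip v (e i)) (e i))"
    have p: "p \<in> V" unfolding p_def using eV by (intro ip.comb_in) auto
    have ipp: "ip p (e j) = ip v (e j)" if j: "j < n" for j
    proof -
      have "ip p (e j) = (\<Sum>i<n. ip v (e i) * ip (e i) (e j))"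
        unfolding p_def using eV j by (intro ip.comb_left) auto
      also have "\<dots> = (\<Sum>i<n. if i = j then ip v (e i) else 0)"
        using eo j by (intro sum.cong) auto
      finally show ?thesis using j by simp
    qed
    show ?thesis
      using v p eV fs.subspace_diff[OF ip.subspace v p]
      by (simp add: U_def p_def[symmetric] ip.diff_left ipp del: minus_apply)
  qed
  have "U = {0}"
  proof (rule ccontr)
    assume ne: "U \<noteq> {0}"
    have inner: "inner_form U ip"
      using ip.sub[OF subU UV] ip.pos UV by (auto simp: inner_form_def inner_form_axioms_def)
    have "U \<subseteq> fs.span S" using UV fin(2) by (rule order_trans)
    from rayleigh_minimizer[OF inner a.sub[OF subU UV] fin(1) this ne] obtain e' where e':
      "e' \<in> U" "ip e' e' = 1" and "\<forall>w\<in>U. a e' w = a e' e' * ip e' w"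
      by (elim bexE conjE)
    then have e'3: "a e' w = a e' e' * ip e' w" if "w \<in> U" for w using that by (elim ballE) auto
    have e'0: "ip e' (e i) = 0" "ip (e i) e' = 0" if "i < n" for i
      using e'(1) that ip.sym eV by (auto simp: U_def)
    have e'V: "e' \<in> V" using e'(1) UV by blast
    have weak': "a e' w = a e' e' * ip e' w" if w: "w \<in> V" for w
    proof -
      define p where "p = (\<Sum>i<n. fun_scale (ip w (e i)) (e i))"
      have p: "p \<in> V" unfolding p_def using eV by (intro ip.comb_in) auto
      have wp: "w - p \<in> U" using proj[OF w] by (simp add: p_def)
      have "a e' p = 0"
      proof -
        have "a e' p = (\<Sum>i<n. ip w (e i) * a e' (e i))"
          unfolding p_def using eV e'V by (intro a.comb_right) auto
        also have "\<dots> = 0"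
        proof (intro sum.neutral ballI)
          fix i assume "i \<in> {..<n}"
          then have i: "i < n" by simp
          show "ip w (e i) * a e' (e i) = 0"
            unfolding a.sym[OF e'V eV[OF i]] weak[OF i e'V] e'0(2)[OF i] by simp
        qed
        finally show ?thesis .
      qed
      moreover have "ip e' p = 0"
        unfolding p_def using eV e'V e'0 by (subst ip.comb_right) auto
      ultimately show ?thesis
        using e'3[OF wp] a.add_right[of "w - p" p e'] ip.add_right[of "w - p" p e'] wp UV p e'V by auto
    qed
    have "P (Suc n) (\<lambda>i. if i < n then e i else e')"
      unfolding P_def
    proof (intro conjI allI impI ballI)
      fix i assume i: "i < Suc n"
      show "(if i < n then e i else e') \<in> V" using eV e'V by simp
      fix w assume w: "w \<in> V"
      show "a (if i < n then e i else e') w = a (if i < n then e i else e') (if i < n then e i else e')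
          * ip (if i < n then e i else e') w"
        by (cases "i < n") (simp_all only: if_True if_False weak[OF _ w] weak'[OF w])
    next
      fix i j assume "i < Suc n" "j < Suc n"
      then show "ip (if i < n then e i else e') (if j < n then e j else e') = (if i = j then 1 else 0)"
        using eo e'0 e'(2) by (auto simp: less_Suc_eq)
    qed
    then show False using max by fastforce
  qed
  then have "v = (\<Sum>i<n. fun_scale (ip v (e i)) (e i))" if "v \<in> V" for v
    using proj[OF that] by simp
  then show ?thesis
    using eV eo weak nonneg
    by (intro exI[of _ n] exI[of _ e] exI[of _ "\<lambda>i. a (e i) (e i)"] conjI allI impI ballI) blast+
qed

section \<open>Finite element spaces\<close>

definition C1_fun :: "('a::euclidean_space \<Rightarrow> real) \<Rightarrow> bool" where
  "C1_fun f \<longleftrightarrow> (\<exists>G. continuous_on UNIV G \<and> (\<forall>x. GDERIV f x :> G x))"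

lemma C1_fun_continuous: "C1_fun f \<Longrightarrow> continuous_on S f"
  unfolding C1_fun_def gderiv_def
  by (meson continuous_at_imp_continuous_on has_derivative_continuous)

lemma C1_fun_const: "C1_fun (\<lambda>x. c)"
  unfolding C1_fun_def by (intro exI[of _ "\<lambda>x. 0"]) (simp add: GDERIV_const)

lemma C1_fun_add:
  assumes "C1_fun f" "C1_fun g"
  shows "C1_fun (\<lambda>x. f x + g x)"
proof -
  obtain F G where "continuous_on UNIV F" "\<And>x. GDERIV f x :> F x" "continuous_on UNIV G" "\<And>x. GDERIV g x :> G x"
    using assms unfolding C1_fun_def by blast
  then show ?thesis
    unfolding C1_fun_def by (intro exI[of _ "\<lambda>x. F x + G x"]) (auto intro: continuous_intros GDERIV_add)
qed

lemma C1_fun_mult: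
  assumes "C1_fun f" "C1_fun g"
  shows "C1_fun (\<lambda>x. f x * g x)"
proof -
  obtain F G where FG: "continuous_on UNIV F" "\<And>x. GDERIV f x :> F x" "continuous_on UNIV G" "\<And>x. GDERIV g x :> G x"
    using assms unfolding C1_fun_def by blast
  have "continuous_on UNIV (\<lambda>x. f x *\<^sub>R G x + g x *\<^sub>R F x)"
    using FG C1_fun_continuous[OF assms(1)] C1_fun_continuous[OF assms(2)] by (intro continuous_intros)
  then show ?thesis
    unfolding C1_fun_def using FG by (intro exI[of _ "\<lambda>x. f x *\<^sub>R G x + g x *\<^sub>R F x"]) (auto intro: GDERIV_mult)
qed

lemma C1_fun_inner: "C1_fun (\<lambda>x. x \<bullet> b)"
  unfolding C1_fun_def
  by (intro exI[of _ "\<lambda>x. b"]) (auto simp: gderiv_def intro!: derivative_eq_intros)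

lemma C1_fun_power: "C1_fun f \<Longrightarrow> C1_fun (\<lambda>x. f x ^ n)"
  by (induction n) (auto intro: C1_fun_const C1_fun_mult)

lemma C1_fun_prod: "finite S \<Longrightarrow> (\<And>b. b \<in> S \<Longrightarrow> C1_fun (f b)) \<Longrightarrow> C1_fun (\<lambda>x. \<Prod>b\<in>S. f b x)"
  by (induction S rule: finite_induct) (auto intro: C1_fun_const C1_fun_mult)

lemma C1_fun_sum: "(\<And>b. b \<in> S \<Longrightarrow> C1_fun (f b)) \<Longrightarrow> C1_fun (\<lambda>x. \<Sum>b\<in>S. f b x)"
  by (induction S rule: infinite_finite_induct) (auto intro: C1_fun_const C1_fun_add)

lemma C1_fun_polynomial: "C1_fun (\<lambda>x. \<Sum>\<alpha>\<in>A. c \<alpha> * Defs.monom \<alpha> x)"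
  unfolding Defs.monom_def
  by (intro C1_fun_sum C1_fun_mult C1_fun_const C1_fun_prod C1_fun_power C1_fun_inner) auto

lemma finite_Q_idx: "finite (Q_idx r :: ('d::euclidean_space \<Rightarrow> nat) set)"
proof -
  have "finite {\<alpha> :: 'd \<Rightarrow> nat. \<forall>b. (b \<in> Basis \<longrightarrow> \<alpha> b \<in> {..r}) \<and> (b \<notin> Basis \<longrightarrow> \<alpha> b = 0)}"
    by (rule finite_set_of_finite_funs) auto
  then show ?thesis by (rule finite_subset[rotated]) (auto simp: Q_idx_def)
qed

lemma finite_P_idx: "finite (P_idx r :: ('d::euclidean_space \<Rightarrow> nat) set)"
proof -
  have "\<alpha> b \<le> r" if "\<alpha> \<in> P_idx r" "b \<in> Basis" for \<alpha> :: "'d \<Rightarrow> nat" and b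
    using that member_le_sum[of b Basis \<alpha>] by (auto simp: P_idx_def)
  then have "P_idx r \<subseteq> (Q_idx r :: ('d \<Rightarrow> nat) set)" by (auto simp: Q_idx_def P_idx_def)
  then show ?thesis using finite_Q_idx by (rule finite_subset)
qed

lemma simplex_cell_negligible: "simplex_cell K \<Longrightarrow> negligible (K - interior K)"
  unfolding simplex_cell_def
  by (metis Diff_mono closure_subset convex_convex_hull frontier_def negligible_convex_frontier negligible_subset order_refl)

text \<open>A differentiable map sends the null boundary of the cube to a null set. Invariance of
  domain makes the image of the open cube open, without any condition on the Jacobian.\<close>

lemma cube_cell_negligible:
  fixes K :: "'d::euclidean_space set"
  assumes "cube_cell K"
  shows "negligible (K - interior K)"
proof -
  obtain F :: "'d \<Rightarrow> 'd" where F: "\<forall>b\<in>Basis. poly_on (Q_idx 1) UNIV (\<lambda>x. F x \<bullet> b)"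
    and inj: "inj_on F (cbox 0 One)" and K: "K = F ` cbox 0 One"
    using assms unfolding cube_cell_def by blast
  have comp: "C1_fun (\<lambda>x. F x \<bullet> b)" if b: "b \<in> Basis" for b
  proof -
    obtain c where "\<forall>x\<in>UNIV. F x \<bullet> b = (\<Sum>\<alpha>\<in>Q_idx 1. c \<alpha> * Defs.monom \<alpha> x)"
      using F b unfolding poly_on_def by blast
    then have "(\<lambda>x. F x \<bullet> b) = (\<lambda>x. \<Sum>\<alpha>\<in>Q_idx 1. c \<alpha> * Defs.monom \<alpha> x)" by auto
    then show ?thesis by (simp add: C1_fun_polynomial)
  qed
  have diff: "F differentiable_on S" for S
    unfolding differentiable_on_def
  proof
    fix x assume "x \<in> S"
    have "(\<lambda>x. F x \<bullet> b) differentiable (at x within S)" if "b \<in> Basis" for b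
      using comp[OF that] unfolding C1_fun_def gderiv_def differentiable_def
      by (blast intro: has_derivative_at_withinI)
    then show "F differentiable (at x within S)"
      by (subst differentiable_componentwise_within) blast
  qed
  have cont: "continuous_on S F" for S by (rule differentiable_imp_continuous_on[OF diff])
  have "open (F ` box 0 One)"
    using inj box_subset_cbox by (intro invariance_of_domain_gen cont) (auto intro: inj_on_subset)
  then have "F ` box 0 One \<subseteq> interior K"
    unfolding K using box_subset_cbox by (intro interior_maximal image_mono) auto
  then have "K - interior K \<subseteq> F ` (cbox 0 One - box 0 One)" unfolding K by blast
  moreover have "negligible (cbox 0 (One::'d) - box 0 One)"
    using negligible_frontier_interval by blast
  then have "negligible (F ` (cbox 0 One - box 0 One))"
    by (intro negligible_differentiable_image_negligible diff) auto
  ultimately show ?thesis by (rule negligible_subset[rotated])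
qed

lemma GDERIV_unique:
  assumes "GDERIV f x :> D" "GDERIV f x :> D'"
  shows "D = D'"
proof -
  have "(\<lambda>h. h \<bullet> D) = (\<lambda>h. h \<bullet> D')"
    using assms unfolding gderiv_def by (rule has_derivative_unique)
  then show ?thesis by (metis inner_commute inner_eq_zero_iff inner_diff_right right_minus_eq)
qed

lemma grad_eq: "GDERIV f x :> D \<Longrightarrow> grad f x = D"
  unfolding grad_def using GDERIV_unique by blast

lemma fe_space_subspace: "fs.subspace (fe_space \<Omega> \<T> A)"
proof (rule fs.subspaceI)
  have poly0: "poly_on A K (\<lambda>x. 0)" for K
    unfolding poly_on_def by (intro exI[of _ "\<lambda>\<alpha>. 0"]) simp
  show "0 \<in> fe_space \<Omega> \<T> A"
    using poly0 by (auto simp: fe_space_def zero_fun_def)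
  show "u + v \<in> fe_space \<Omega> \<T> A" if u: "u \<in> fe_space \<Omega> \<T> A" and v: "v \<in> fe_space \<Omega> \<T> A" for u v
  proof -
    have "poly_on A K (\<lambda>x. u x + v x)" if K: "K \<in> \<T>" for K
    proof -
      obtain c d where "\<forall>x\<in>K. u x = (\<Sum>\<alpha>\<in>A. c \<alpha> * Defs.monom \<alpha> x)" "\<forall>x\<in>K. v x = (\<Sum>\<alpha>\<in>A. d \<alpha> * Defs.monom \<alpha> x)"
        using u v K unfolding fe_space_def poly_on_def by blast
      then show ?thesis
        unfolding poly_on_def by (intro exI[of _ "\<lambda>\<alpha>. c \<alpha> + d \<alpha>"]) (simp add: algebra_simps sum.distrib)
    qed
    then show ?thesis using u v by (auto simp: fe_space_def plus_fun_def intro: continuous_on_add)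
  qed
  show "fun_scale a u \<in> fe_space \<Omega> \<T> A" if u: "u \<in> fe_space \<Omega> \<T> A" for a u
  proof -
    have "poly_on A K (\<lambda>x. a * u x)" if K: "K \<in> \<T>" for K
    proof -
      obtain c where "\<forall>x\<in>K. u x = (\<Sum>\<alpha>\<in>A. c \<alpha> * Defs.monom \<alpha> x)"
        using u K unfolding fe_space_def poly_on_def by blast
      then show ?thesis
        unfolding poly_on_def by (intro exI[of _ "\<lambda>\<alpha>. a * c \<alpha>"]) (simp add: sum_distrib_left mult.assoc)
    qed
    then show ?thesis using u by (auto simp: fe_space_def fun_scale_def intro: continuous_on_mult_left)
  qed
qed

section \<open>The two bilinear forms on the finite element space, and its dimension\<close>

context
  fixes \<Omega> :: "'d::euclidean_space set" and \<T> and A :: "('d \<Rightarrow> nat) set"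
  assumes open_dom: "open \<Omega>" and bounded_dom: "bounded \<Omega>" and mesh: "mesh_partition \<Omega> \<T>"
begin

abbreviation (input) "V \<equiv> fe_space \<Omega> \<T> A"

definition cell_interiors :: "'d set" where
  "cell_interiors = \<Union> (interior ` \<T>)"

lemma negligible_skeleton: "negligible (\<Omega> - cell_interiors)"
proof -
  have "negligible (\<Union>K\<in>\<T>. K - interior K)"
    using mesh simplex_cell_negligible cube_cell_negligible
    by (intro negligible_Union) (auto simp: mesh_partition_def)
  moreover have "\<Omega> - cell_interiors \<subseteq> (\<Union>K\<in>\<T>. K - interior K)"
  proof
    fix x assume x: "x \<in> \<Omega> - cell_interiors"
    then have "x \<in> \<Union>\<T>"
      using mesh closure_subset[of \<Omega>] unfolding mesh_partition_def by auto
    then show "x \<in> (\<Union>K\<in>\<T>. K - interior K)"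
      using x by (auto simp: cell_interiors_def)
  qed
  ultimately show ?thesis by (rule negligible_subset)
qed

text \<open>The gradient of the cell's polynomial is continuous on the whole space, which gives
  control up to the boundary of the cell.\<close>

lemma fe_gradient:
  assumes u: "u \<in> V" and K: "K \<in> \<T>"
  obtains G where "continuous_on UNIV G" "\<And>x. x \<in> interior K \<Longrightarrow> GDERIV u x :> G x"
proof -
  obtain c where c: "\<forall>x\<in>K. u x = (\<Sum>\<alpha>\<in>A. c \<alpha> * Defs.monom \<alpha> x)"
    using u K unfolding fe_space_def poly_on_def by blast
  obtain G where G: "continuous_on UNIV G" "\<And>x. GDERIV (\<lambda>x. \<Sum>\<alpha>\<in>A. c \<alpha> * Defs.monom \<alpha> x) x :> G x"
    using C1_fun_polynomial[of c A] unfolding C1_fun_def by blast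
  show ?thesis
  proof (rule that[OF G(1)])
    fix x assume x: "x \<in> interior K"
    show "GDERIV u x :> G x"
      unfolding gderiv_def
      by (rule has_derivative_transform_within_open[OF G(2)[of x, unfolded gderiv_def] open_interior x])
         (use c interior_subset[of K] in \<open>simp add: subset_iff\<close>)
  qed
qed

lemma fe_GDERIV: "u \<in> V \<Longrightarrow> x \<in> cell_interiors \<Longrightarrow> GDERIV u x :> grad u x"
  by (auto simp: cell_interiors_def) (metis fe_gradient grad_eq)

lemma continuous_set_integrable:
  fixes f :: "'d \<Rightarrow> real"
  assumes "continuous_on UNIV f" "S \<in> sets lebesgue" "S \<subseteq> \<Omega>"
  shows "set_integrable lebesgue S f"
proof -
  obtain a where a: "\<Omega> \<subseteq> cbox (- a) a" using bounded_subset_cbox_symmetric[OF bounded_dom] by blast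
  have "set_integrable lebesgue (cbox (- a) a) f"
    by (intro absolutely_integrable_continuous continuous_on_subset[OF assms(1)]) simp
  then show ?thesis by (rule set_integrable_subset[OF _ assms(2) order_trans[OF assms(3) a]])
qed

lemma fe_h1_integrable:
  assumes u: "u \<in> V" and v: "v \<in> V"
  shows "set_integrable lebesgue \<Omega> (\<lambda>x. grad u x \<bullet> grad v x)"
proof -
  let ?f = "\<lambda>x. grad u x \<bullet> grad v x"
  have cell: "set_integrable lebesgue (\<Omega> \<inter> interior K) ?f" if K: "K \<in> \<T>" for K
  proof -
    obtain G where G: "continuous_on UNIV G" "\<And>x. x \<in> interior K \<Longrightarrow> GDERIV u x :> G x"
      using fe_gradient[OF u K] by blast
    obtain H where H: "continuous_on UNIV H" "\<And>x. x \<in> interior K \<Longrightarrow> GDERIV v x :> H x"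
      using fe_gradient[OF v K] by blast
    have "set_integrable lebesgue (\<Omega> \<inter> interior K) (\<lambda>x. G x \<bullet> H x)"
      using G H open_dom by (intro continuous_set_integrable continuous_intros) auto
    then show ?thesis
      by (rule absolutely_integrable_spike[OF _ negligible_empty])
         (auto simp: grad_eq[OF G(2)] grad_eq[OF H(2)])
  qed
  have "finite \<T>" using mesh by (simp add: mesh_partition_def)
  then have "set_integrable lebesgue (\<Union>K\<in>\<T>. \<Omega> \<inter> interior K) ?f"
    using open_dom by (intro set_integrable_UN cell) (auto simp: lebesgue_openin)
  moreover have "(\<Union>K\<in>\<T>. \<Omega> \<inter> interior K) - \<Omega> = {}" "\<Omega> - (\<Union>K\<in>\<T>. \<Omega> \<inter> interior K) = \<Omega> - cell_interiors"
    by (auto simp: cell_interiors_def)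
  ultimately show ?thesis
    using negligible_skeleton
    by (subst absolutely_integrable_spike_set_eq[of \<Omega> "\<Union>K\<in>\<T>. \<Omega> \<inter> interior K"])
       (auto intro: negligible_subset)
qed

lemma fe_h1ip:
  assumes "u \<in> V" "v \<in> V"
  shows "h1ip \<Omega> u v = integral \<Omega> (\<lambda>x. grad u x \<bullet> grad v x)" "(\<lambda>x. grad u x \<bullet> grad v x) integrable_on \<Omega>"
  using set_lebesgue_integral_eq_integral[OF fe_h1_integrable[OF assms]] by (simp_all add: h1ip_def)

text \<open>\<open>grad\<close> is an arbitrary choice where no gradient exists, so linearity is
  available in the cell interiors and reaches the integral because the remaining part of
  \<open>\<Omega>\<close> is a null set.\<close>

lemma fe_h1_form: "sym_form V (h1ip \<Omega>)"
proof
  show "fs.subspace V" by (rule fe_space_subspace)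
  note sub = fs.subspace_add[OF fe_space_subspace] fs.subspace_scale[OF fe_space_subspace]
  show "h1ip \<Omega> (u + v) w = h1ip \<Omega> u w + h1ip \<Omega> v w" if u: "u \<in> V" and v: "v \<in> V" and w: "w \<in> V" for u v w
  proof -
    have "grad (u + v) x \<bullet> grad w x = grad u x \<bullet> grad w x + grad v x \<bullet> grad w x" if "x \<in> cell_interiors" for x
    proof -
      have "grad (u + v) x = grad u x + grad v x"
        unfolding plus_fun_def by (rule grad_eq, rule GDERIV_add; rule fe_GDERIV; fact)
      then show ?thesis by (simp add: inner_add_left)
    qed
    then have "h1ip \<Omega> (u + v) w = integral \<Omega> (\<lambda>x. grad u x \<bullet> grad w x + grad v x \<bullet> grad w x)"
      unfolding fe_h1ip(1)[OF sub(1)[OF u v] w]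
      by (intro integral_spike[OF negligible_skeleton]) auto
    then show ?thesis
      using fe_h1ip[OF u w] fe_h1ip[OF v w] by (simp add: integral_add)
  qed
  show "h1ip \<Omega> (fun_scale c u) w = c * h1ip \<Omega> u w" if u: "u \<in> V" and w: "w \<in> V" for c u w
  proof -
    have "grad (fun_scale c u) x \<bullet> grad w x = c * (grad u x \<bullet> grad w x)" if "x \<in> cell_interiors" for x
    proof -
      have "grad (fun_scale c u) x = c *\<^sub>R grad u x"
        using GDERIV_mult[OF GDERIV_const[of c x] fe_GDERIV[OF u that]]
        by (intro grad_eq) (simp add: fun_scale_def)
      then show ?thesis by simp
    qed
    then have "h1ip \<Omega> (fun_scale c u) w = integral \<Omega> (\<lambda>x. c * (grad u x \<bullet> grad w x))"
      unfolding fe_h1ip(1)[OF sub(2)[OF u] w]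
      by (intro integral_spike[OF negligible_skeleton]) auto
    then show ?thesis
      using fe_h1ip[OF u w] by simp
  qed
  show "h1ip \<Omega> u v = h1ip \<Omega> v u" for u v
    by (simp add: h1ip_def inner_commute)
qed

lemma fe_h1_nonneg: "u \<in> V \<Longrightarrow> 0 \<le> h1ip \<Omega> u u"
  using fe_h1ip[of u u] by (simp add: integral_nonneg)

lemma fe_continuous: "u \<in> V \<Longrightarrow> continuous_on UNIV u"
  by (simp add: fe_space_def)

lemma dom_sets: "\<Omega> \<in> sets lebesgue"
  using open_dom by auto

lemma l2_fe_integrable:
  assumes u0: "u0 \<in> borel_measurable (lebesgue_on \<Omega>)" "integrable (lebesgue_on \<Omega>) (\<lambda>x. (u0 x)\<^sup>2)" and v: "v \<in> V"
  shows "set_integrable lebesgue \<Omega> (\<lambda>x. u0 x * v x)"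
proof -
  have v_meas: "v \<in> borel_measurable (lebesgue_on \<Omega>)"
    by (intro continuous_imp_measurable_on_sets_lebesgue dom_sets continuous_on_subset[OF fe_continuous[OF v]]) simp
  have "set_integrable lebesgue \<Omega> (\<lambda>x. (v x)\<^sup>2)"
    using fe_continuous[OF v] dom_sets by (intro continuous_set_integrable continuous_intros) auto
  then have v2: "integrable (lebesgue_on \<Omega>) (\<lambda>x. (v x)\<^sup>2)"
    using dom_sets by (simp add: integrable_restrict_space set_integrable_def)
  have "integrable (lebesgue_on \<Omega>) (\<lambda>x. u0 x * v x)"
  proof (rule Bochner_Integration.integrable_bound)
    show "integrable (lebesgue_on \<Omega>) (\<lambda>x. (u0 x)\<^sup>2 + (v x)\<^sup>2)"
      using u0 v2 by (intro Bochner_Integration.integrable_add)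
    show "(\<lambda>x. u0 x * v x) \<in> borel_measurable (lebesgue_on \<Omega>)"
      using u0 v_meas by (intro borel_measurable_times)
    have "\<bar>a * b\<bar> \<le> \<bar>a\<^sup>2 + b\<^sup>2\<bar>" for a b :: real
    proof -
      have "2 * \<bar>a * b\<bar> \<le> a\<^sup>2 + b\<^sup>2"
        using sum_squares_bound[of "\<bar>a\<bar>" "\<bar>b\<bar>"] by (simp add: abs_mult)
      then show ?thesis by simp
    qed
    then show "AE x in lebesgue_on \<Omega>. norm (u0 x * v x) \<le> norm ((u0 x)\<^sup>2 + (v x)\<^sup>2)" by simp
  qed
  then show ?thesis
    using dom_sets by (simp add: integrable_restrict_space set_integrable_def)
qed

lemma fe_l2_integrable:
  assumes u: "u \<in> V" and v: "v \<in> V"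
  shows "set_integrable lebesgue \<Omega> (\<lambda>x. u x * v x)"
  using fe_continuous[OF u] fe_continuous[OF v] dom_sets
  by (intro continuous_set_integrable continuous_intros) auto

text \<open>Elements are functions, not classes modulo null sets. Definiteness comes from continuity
  together with vanishing outside \<open>\<Omega>\<close>: a nonzero value has a box around it
  inside \<open>\<Omega>\<close>.\<close>

lemma fe_l2_form: "inner_form V (l2ip \<Omega>)"
proof
  show "fs.subspace V" by (rule fe_space_subspace)
  show "l2ip \<Omega> (u + v) w = l2ip \<Omega> u w + l2ip \<Omega> v w" if u: "u \<in> V" and v: "v \<in> V" and w: "w \<in> V" for u v w
    using fe_l2_integrable[OF u w] fe_l2_integrable[OF v w]
    by (simp add: l2ip_def distrib_right set_integral_add)
  show "l2ip \<Omega> (fun_scale c u) w = c * l2ip \<Omega> u w" if u: "u \<in> V" and w: "w \<in> V" for c u w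
    by (simp add: l2ip_def fun_scale_def mult.assoc)
  show "l2ip \<Omega> u v = l2ip \<Omega> v u" for u v
    by (simp add: l2ip_def mult.commute)
  show "0 < l2ip \<Omega> u u" if u: "u \<in> V" "u \<noteq> 0" for u
  proof -
    obtain x where x: "u x \<noteq> 0" using u(2) by (auto simp: fun_eq_iff)
    then have "x \<in> \<Omega>" using u(1) by (auto simp: fe_space_def)
    then obtain a b where ab: "cbox a b \<subseteq> \<Omega>" "x \<in> box a b"
      using open_contains_cbox[OF open_dom] by metis
    note int = set_lebesgue_integral_eq_integral[OF fe_l2_integrable[OF u(1) u(1)]]
    have cont: "continuous_on (cbox a b) (\<lambda>x. u x * u x)"
      by (intro continuous_intros continuous_on_subset[OF fe_continuous[OF u(1)]]) auto
    have "integral (cbox a b) (\<lambda>x. u x * u x) \<noteq> 0"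
    proof
      assume "integral (cbox a b) (\<lambda>x. u x * u x) = 0"
      then have "((\<lambda>x. u x * u x) has_integral 0) (cbox a b)"
        using integrable_continuous[OF cont] by (metis integrable_integral)
      then have "u x * u x = 0"
        using has_integral_0_cbox_imp_0[OF cont, of x] ab(2) box_subset_cbox by force
      then show False using x by simp
    qed
    moreover have "0 \<le> integral (cbox a b) (\<lambda>x. u x * u x)"
      by (intro integral_nonneg integrable_continuous cont) simp
    moreover have "integral (cbox a b) (\<lambda>x. u x * u x) \<le> integral \<Omega> (\<lambda>x. u x * u x)"
      by (intro integral_subset_le ab int(1) integrable_continuous cont) simp
    ultimately show ?thesis using int(2) by (simp add: l2ip_def)
  qed
qed

text \<open>Closed cells may overlap on their boundaries, so each point is assigned to the first
  listed cell that contains it. The monomials cut off to these disjoint sets span the space,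
  although they need not belong to it.\<close>

lemma fe_space_finite_dim:
  assumes "finite A"
  shows "\<exists>S. finite S \<and> V \<subseteq> fs.span S"
proof -
  have "finite \<T>" using mesh by (simp add: mesh_partition_def)
  then obtain Ks where Ks: "set Ks = \<T>" "distinct Ks" using finite_distinct_list by blast
  define D where "D i = Ks ! i - (\<Union>j<i. Ks ! j)" for i
  define b where "b i \<alpha> x = (if x \<in> D i then Defs.monom \<alpha> x else 0)" for i \<alpha> and x :: 'd
  define S where "S = (\<lambda>(i, \<alpha>). b i \<alpha>) ` ({..<length Ks} \<times> A)"
  have "V \<subseteq> fs.span S"
  proof
    fix v assume v: "v \<in> V"
    have "\<forall>i\<in>{..<length Ks}. \<exists>c. \<forall>x\<in>Ks ! i. v x = (\<Sum>\<alpha>\<in>A. c \<alpha> * Defs.monom \<alpha> x)"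
      using v Ks(1) nth_mem unfolding fe_space_def poly_on_def by blast
    then obtain c where c: "\<And>i x. i < length Ks \<Longrightarrow> x \<in> Ks ! i \<Longrightarrow> v x = (\<Sum>\<alpha>\<in>A. c i \<alpha> * Defs.monom \<alpha> x)"
      by (metis lessThan_iff)
    have "v = (\<Sum>i<length Ks. \<Sum>\<alpha>\<in>A. fun_scale (c i \<alpha>) (b i \<alpha>))"
    proof
      fix x
      have eq: "(\<Sum>i<length Ks. \<Sum>\<alpha>\<in>A. fun_scale (c i \<alpha>) (b i \<alpha>)) x = (\<Sum>i<length Ks. if x \<in> D i then v x else 0)"
        unfolding sum_fun_apply
      proof (intro sum.cong refl)
        fix i assume i: "i \<in> {..<length Ks}"
        show "(\<Sum>\<alpha>\<in>A. fun_scale (c i \<alpha>) (b i \<alpha>) x) = (if x \<in> D i then v x else 0)"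
        proof (cases "x \<in> D i")
          case True
          then have "x \<in> Ks ! i" by (simp add: D_def)
          then show ?thesis using c[of i x] i True by (simp add: fun_scale_def b_def)
        qed (simp add: fun_scale_def b_def)
      qed
      show "v x = (\<Sum>i<length Ks. \<Sum>\<alpha>\<in>A. fun_scale (c i \<alpha>) (b i \<alpha>)) x"
      proof (cases "\<exists>i<length Ks. x \<in> Ks ! i")
        case True
        define i0 where "i0 = (LEAST i. i < length Ks \<and> x \<in> Ks ! i)"
        have i0: "i0 < length Ks" "x \<in> Ks ! i0"
          using LeastI_ex[OF True] by (auto simp: i0_def)
        have least: "\<not> (j < length Ks \<and> x \<in> Ks ! j)" if "j < i0" for j
          using not_less_Least that unfolding i0_def by blast
        have "x \<in> D i \<longleftrightarrow> i = i0" if "i < length Ks" for i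
        proof
          assume "x \<in> D i"
          then show "i = i0"
            using i0 least[of i] that by (cases i i0 rule: linorder_cases) (auto simp: D_def)
        next
          assume "i = i0"
          then show "x \<in> D i" using i0 least by (auto simp: D_def)
        qed
        then have "(\<Sum>i<length Ks. if x \<in> D i then v x else 0) = (\<Sum>i<length Ks. if i = i0 then v x else 0)"
          by (intro sum.cong) auto
        then show ?thesis unfolding eq using i0 by simp
      next
        case False
        then have "x \<notin> \<Union>\<T>" using Ks(1) by (auto simp: in_set_conv_nth)
        then have "x \<notin> \<Omega>" using mesh closure_subset[of \<Omega>] by (auto simp: mesh_partition_def)
        then have "v x = 0" using v by (simp add: fe_space_def)
        moreover have "(\<Sum>i<length Ks. if x \<in> D i then v x else 0) = 0"
          using False by (intro sum.neutral) (auto simp: D_def)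
        ultimately show ?thesis unfolding eq by simp
      qed
    qed
    also have "\<dots> \<in> fs.span S"
      by (intro fs.span_sum fs.span_scale fs.span_base) (auto simp: S_def)
    finally show "v \<in> fs.span S" .
  qed
  moreover have "finite S" using assms by (simp add: S_def)
  ultimately show ?thesis by blast
qed

lemma fe_eigenbasis:
  assumes "finite A"
  obtains n :: nat and e \<mu> where
    "\<And>i. i < n \<Longrightarrow> e i \<in> V" "\<And>i. i < n \<Longrightarrow> 0 \<le> \<mu> i"
    "\<And>i j. i < n \<Longrightarrow> j < n \<Longrightarrow> l2ip \<Omega> (e i) (e j) = (if i = j then 1 else 0)"
    "\<And>i j. i < n \<Longrightarrow> j < n \<Longrightarrow> h1ip \<Omega> (e i) (e j) = (if i = j then \<mu> i else 0)"
    "\<And>v. v \<in> V \<Longrightarrow> v = (\<Sum>i<n. fun_scale (l2ip \<Omega> v (e i)) (e i))"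
proof -
  obtain S where S: "finite S" "V \<subseteq> fs.span S" using fe_space_finite_dim[OF assms] by blast
  obtain n :: nat and e \<mu> where e: "\<forall>i<n. e i \<in> V \<and> 0 \<le> \<mu> i"
    and o: "\<forall>i<n. \<forall>j<n. l2ip \<Omega> (e i) (e j) = (if i = j then 1 else 0)"
    and h: "\<forall>i<n. \<forall>w\<in>V. h1ip \<Omega> (e i) w = \<mu> i * l2ip \<Omega> (e i) w"
    and r: "\<forall>v\<in>V. v = (\<Sum>i<n. fun_scale (l2ip \<Omega> v (e i)) (e i))"
    using simultaneous_diagonalization[OF fe_l2_form fe_h1_form fe_h1_nonneg S] by blast
  show ?thesis
    by (rule that[of n e \<mu>]) (use e o h r in auto)
qed

end

section \<open>Decoupling in the eigenbasis\<close>

text \<open>The interface between space and time discretization: an orthonormal eigenbasis, with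
  both forms already expressed in coordinates.\<close>

locale fe_diag =
  fixes \<Omega> :: "'d::euclidean_space set" and V :: "('d \<Rightarrow> real) set" and n :: nat
    and e :: "nat \<Rightarrow> 'd \<Rightarrow> real" and \<mu> :: "nat \<Rightarrow> real"
  assumes nonneg_ev: "i < n \<Longrightarrow> 0 \<le> \<mu> i"
    and V_iff: "v \<in> V \<longleftrightarrow> (\<exists>c. v = (\<lambda>x. \<Sum>i<n. c i * e i x))"
    and l2: "l2ip \<Omega> (\<lambda>x. \<Sum>i<n. c i * e i x) (\<lambda>x. \<Sum>i<n. d i * e i x) = (\<Sum>i<n. c i * d i)"
    and h1: "h1ip \<Omega> (\<lambda>x. \<Sum>i<n. c i * e i x) (\<lambda>x. \<Sum>i<n. d i * e i x) = (\<Sum>i<n. \<mu> i * c i * d i)"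
begin

definition comb :: "(nat \<Rightarrow> real) \<Rightarrow> 'd \<Rightarrow> real" where
  "comb c = (\<lambda>x. \<Sum>i<n. c i * e i x)"

lemma V_comb: "v \<in> V \<longleftrightarrow> (\<exists>c. v = comb c)"
  by (simp add: V_iff comb_def)

lemma comb_in_V [simp]: "comb c \<in> V"
  by (auto simp: V_comb)

lemma l2_comb: "l2ip \<Omega> (comb c) (comb d) = (\<Sum>i<n. c i * d i)"
  by (simp add: comb_def l2)

lemma h1_comb: "h1ip \<Omega> (comb c) (comb d) = (\<Sum>i<n. \<mu> i * c i * d i)"
  by (simp add: comb_def h1)

lemma comb_cong: "(\<And>i. i < n \<Longrightarrow> c i = d i) \<Longrightarrow> comb c = comb d"
  by (simp add: comb_def)

lemma comb_zero: "comb (\<lambda>i. 0) = (\<lambda>x. 0)"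
  by (simp add: comb_def)

lemma comb_minus: "(\<lambda>x. - comb c x) = comb (\<lambda>i. - c i)"
  by (simp add: comb_def sum_negf)

lemma comb_diff: "(\<lambda>x. comb c x - comb d x) = comb (\<lambda>i. c i - d i)"
  by (simp add: comb_def sum_subtractf left_diff_distrib)

lemma sum_unit: "j < n \<Longrightarrow> (\<Sum>i<n. f i * (if i = j then a else 0)) = f j * (a::real)"
  by (simp add: if_distrib[of "\<lambda>x. f _ * x"] cong: if_cong)

lemma coeff_eqI:
  assumes "\<And>d. (\<Sum>i<n. a i * d i) = (\<Sum>i<n. b i * d i :: real)" "j < n"
  shows "a j = b j"
  using assms(1)[of "\<lambda>i. if i = j then 1 else 0"] assms(2) by (simp add: sum_unit)

lemma comb_inject:
  assumes "comb c = comb d" "j < n"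
  shows "c j = d j"
  using assms by (intro coeff_eqI[of c d]) (auto simp flip: l2_comb)

lemma disc_lap_comb: "disc_lap \<Omega> V (comb c) = comb (\<lambda>i. - (\<mu> i * c i))"
  unfolding disc_lap_def
proof (rule the_equality)
  show "comb (\<lambda>i. - (\<mu> i * c i)) \<in> V \<and>
    (\<forall>\<psi>\<in>V. l2ip \<Omega> (\<lambda>x. - comb (\<lambda>i. - (\<mu> i * c i)) x) \<psi> = h1ip \<Omega> (comb c) \<psi>)"
    by (auto simp: V_comb comb_minus l2_comb h1_comb)
  fix w assume w: "w \<in> V \<and> (\<forall>\<psi>\<in>V. l2ip \<Omega> (\<lambda>x. - w x) \<psi> = h1ip \<Omega> (comb c) \<psi>)"
  then obtain d where d: "w = comb d" by (auto simp: V_comb)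
  have "(\<Sum>i<n. - d i * f i) = (\<Sum>i<n. (\<mu> i * c i) * f i)" for f
    using w comb_in_V[of f] unfolding d comb_minus by (metis (no_types) l2_comb h1_comb)
  then have "- d j = \<mu> j * c j" if "j < n" for j
    using that by (rule coeff_eqI)
  then show "w = comb (\<lambda>i. - (\<mu> i * c i))"
    unfolding d by (intro comb_cong) (metis minus_minus)
qed

text \<open>The assumption says that \<open>f\<close> has the pairings \<open>w i\<close> with the
  basis. In this form the linearity of the integral, which needs integrability of \<open>f\<close>
  against the basis, is left to the caller.\<close>

lemma l2proj_comb:
  assumes "\<And>c d. l2ip \<Omega> (\<lambda>x. f x - comb c x) (comb d) = (\<Sum>i<n. (w i - c i) * d i)"
  shows "l2proj \<Omega> V f = comb w"
  unfolding l2proj_def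
proof (rule the_equality)
  show "comb w \<in> V \<and> (\<forall>\<psi>\<in>V. l2ip \<Omega> (\<lambda>x. f x - comb w x) \<psi> = 0)"
    by (auto simp: V_comb assms)
  fix v assume v: "v \<in> V \<and> (\<forall>\<psi>\<in>V. l2ip \<Omega> (\<lambda>x. f x - v x) \<psi> = 0)"
  then obtain d where d: "v = comb d" by (auto simp: V_comb)
  have "(\<Sum>i<n. (w i - d i) * g i) = (\<Sum>i<n. 0 * g i)" for g
  proof -
    have "l2ip \<Omega> (\<lambda>x. f x - comb d x) (comb g) = 0" using v d by simp
    then show ?thesis by (simp add: assms)
  qed
  then have "w j - d j = 0" if "j < n" for j
    using that by (rule coeff_eqI)
  then show "v = comb w"
    unfolding d by (intro comb_cong) simp
qed

end

lemma partition_less: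
  assumes "\<And>m. m < M \<Longrightarrow> t m < (t (Suc m) :: real)" "i < j" "j \<le> M"
  shows "t i < t j"
  using assms(2,3)
proof (induction j)
  case (Suc j)
  then have "t j < t (Suc j)" by (intro assms(1)) simp
  then show ?case using Suc by (cases "i = j") auto
qed simp

text \<open>\<open>P l i\<close> is the polynomial in time whose values on the \<open>l\<close>-th interval are the coefficients of
  \<open>u\<close> with respect to \<open>e i\<close>.\<close>
locale dg_function = fe_diag +
  fixes M :: nat and t :: "nat \<Rightarrow> real" and u :: "real \<Rightarrow> 'a \<Rightarrow> real" and P :: "nat \<Rightarrow> nat \<Rightarrow> real poly"
  assumes inc: "m < M \<Longrightarrow> t m < t (Suc m)"
    and rep: "1 \<le> l \<Longrightarrow> l \<le> M \<Longrightarrow> s \<in> {t (l - 1)<..t l} \<Longrightarrow> u s = comb (\<lambda>i. poly (P l i) s)"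
begin

lemma less: "i < j \<Longrightarrow> j \<le> M \<Longrightarrow> t i < t j"
  using partition_less inc by blast

lemma less_eq: "i \<le> j \<Longrightarrow> j \<le> M \<Longrightarrow> t i \<le> t j"
  using less[of i j] by (cases "i = j") auto

lemma step_less: "1 \<le> l \<Longrightarrow> l \<le> M \<Longrightarrow> t (l - 1) < t l"
  by (rule less) auto

lemma comb_vector_derivative:
  "((\<lambda>s. comb (\<lambda>i. poly (p i) s) x) has_vector_derivative comb (\<lambda>i. poly (pderiv (p i)) s) x) (at s within S)"
  unfolding has_real_derivative_iff_has_vector_derivative[symmetric] comb_def
  by (auto intro!: DERIV_sum derivative_eq_intros DERIV_subset[OF poly_DERIV])

lemma comb_tendsto:
  "((\<lambda>s. comb (\<lambda>i. poly (p i) s) x) \<longlongrightarrow> comb (\<lambda>i. poly (p i) s) x) (at s within S)"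
  unfolding comb_def by (intro tendsto_intros)

lemma dtime_eq:
  assumes l: "1 \<le> l" "l \<le> M" and s: "s \<in> {t (l - 1)<..t l}"
  shows "dtime t u l s = comb (\<lambda>i. poly (pderiv (P l i)) s)"
proof
  fix x
  have "((\<lambda>\<sigma>. u \<sigma> x) has_vector_derivative comb (\<lambda>i. poly (pderiv (P l i)) s) x) (at s within {t (l - 1)<..t l})"
    by (rule has_vector_derivative_transform[OF s _ comb_vector_derivative]) (simp add: rep[OF l])
  \<comment> \<open>The derivative is taken within the half-open interval; it is determined because
    \<open>s\<close> is a limit point from the left, even at the right end.\<close>
  moreover have "at s within {t (l - 1)<..t l} \<noteq> bot"
  proof -
    have "{t (l - 1)<..<s} \<subseteq> {t (l - 1)<..t l}" using s by auto
    then have "s islimpt {t (l - 1)<..t l}"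
      using islimpt_greaterThanLessThan2[of "t (l - 1)" s] s islimpt_subset by auto
    then show ?thesis by (simp add: trivial_limit_within)
  qed
  ultimately show "dtime t u l s x = comb (\<lambda>i. poly (pderiv (P l i)) s) x"
    unfolding dtime_def by (rule vector_derivative_within[rotated])
qed

lemma dg_plus_eq:
  assumes l: "1 \<le> l" "l \<le> M"
  shows "dg_plus t u (l - 1) = comb (\<lambda>i. poly (P l i) (t (l - 1)))"
proof
  fix x
  have "\<forall>\<^sub>F s in at_right (t (l - 1)). comb (\<lambda>i. poly (P l i) s) x = u s x"
    using eventually_at_right_real[OF step_less[OF l]]
    by eventually_elim (simp add: rep[OF l])
  then have "((\<lambda>s. u s x) \<longlongrightarrow> comb (\<lambda>i. poly (P l i) (t (l - 1))) x) (at_right (t (l - 1)))"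
    by (rule Lim_transform_eventually[OF comb_tendsto])
  then show "dg_plus t u (l - 1) x = comb (\<lambda>i. poly (P l i) (t (l - 1))) x"
    unfolding dg_plus_def by (intro tendsto_Lim) auto
qed

lemma dg_minus_eq:
  assumes l: "1 \<le> l" "l \<le> M"
  shows "dg_minus t u l = comb (\<lambda>i. poly (P l i) (t l))"
proof
  fix x
  have "\<forall>\<^sub>F s in at_left (t l). comb (\<lambda>i. poly (P l i) s) x = u s x"
    using eventually_at_left_real[OF step_less[OF l]]
    by eventually_elim (simp add: rep[OF l])
  then have "((\<lambda>s. u s x) \<longlongrightarrow> comb (\<lambda>i. poly (P l i) (t l)) x) (at_left (t l))"
    by (rule Lim_transform_eventually[OF comb_tendsto])
  then show "dg_minus t u l x = comb (\<lambda>i. poly (P l i) (t l)) x"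
    unfolding dg_minus_def by (intro tendsto_Lim) auto
qed

lemma jump_eq:
  assumes l: "2 \<le> l" "l \<le> M"
  shows "jump t u (l - 1) = comb (\<lambda>i. poly (P l i) (t (l - 1)) - poly (P (l - 1) i) (t (l - 1)))"
proof -
  have "1 \<le> l" "1 \<le> l - 1" "l - 1 \<le> M" using l by auto
  then show ?thesis
    unfolding jump_def using l(2) by (simp only: dg_plus_eq dg_minus_eq comb_diff)
qed

lemma has_integral_poly: "(poly p has_integral integral {a..b} (poly p)) {a..b::real}"
  by (rule integrable_integral[OF poly_integrable])

text \<open>Supported in one time interval and in one eigenmode, so that testing with it isolates a
  scalar problem on a single step.\<close>

definition test_function :: "nat \<Rightarrow> nat \<Rightarrow> real poly \<Rightarrow> real \<Rightarrow> 'a \<Rightarrow> real" where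
  "test_function m j r s = (if s \<in> {t (m - 1)<..t m} then comb (\<lambda>i. if i = j then poly r s else 0) else (\<lambda>x. 0))"

lemma test_function_dg:
  "dg_function \<Omega> V n e \<mu> M t (test_function m j r) (\<lambda>l i. if l = m \<and> i = j then r else 0)"
  if m: "1 \<le> m" "m \<le> M"
proof unfold_locales
  fix l s assume l: "1 \<le> l" "l \<le> M" and s: "s \<in> {t (l - 1)<..t l}"
  have "s \<notin> {t (m - 1)<..t m}" if "l \<noteq> m"
  proof (cases "l < m")
    case True
    then have "t l \<le> t (m - 1)" using m by (intro less_eq) linarith+
    then show ?thesis using s by auto
  next
    case False
    then have "t m \<le> t (l - 1)" using that l by (intro less_eq) linarith+
    then show ?thesis using s by auto
  qed
  then show "test_function m j r s = comb (\<lambda>i. poly (if l = m \<and> i = j then r else 0) s)"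
    using s by (cases "l = m") (auto simp: test_function_def comb_zero if_distrib[of "\<lambda>p. poly p s"] cong: if_cong)
qed (rule inc)

text \<open>Intervals are open on the left, so the right limit of the test function at
  \<open>t (l - 1)\<close> vanishes unless \<open>l = m\<close>, and a single jump survives. For
  \<open>m = 1\<close> there is no earlier value: the initial datum stands on the right-hand side of
  the scheme.\<close>

lemma bilin_test_function:
  assumes m: "1 \<le> m" "m \<le> M" and j: "j < n"
  shows "bilin \<Omega> M t u (test_function m j r) =
    integral {t (m - 1)..t m} (poly ((pderiv (P m j) + smult (\<mu> j) (P m j)) * r))
    + (poly (P m j) (t (m - 1)) - (if m = 1 then 0 else poly (P (m - 1) j) (t (m - 1)))) * poly r (t (m - 1))"
proof -
  let ?J = "(poly (P m j) (t (m - 1)) - poly (P (m - 1) j) (t (m - 1))) * poly r (t (m - 1))"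
  let ?E = "integral {t (m - 1)..t m} (poly (smult (\<mu> j) (P m j) * r))"
  let ?D = "integral {t (m - 1)..t m} (poly (pderiv (P m j) * r))"
  let ?\<phi> = "test_function m j r"
  interpret \<phi>: dg_function \<Omega> V n e \<mu> M t ?\<phi> "\<lambda>l i. if l = m \<and> i = j then r else 0"
    by (rule test_function_dg[OF m])
  have poly_if: "poly (if b then r else 0) s = (if b then poly r s else 0)" for b s by simp
  have deriv: "integral {t (l - 1)..t l} (\<lambda>s. l2ip \<Omega> (dtime t u l s) (?\<phi> s)) =
      (if l = m then ?D else 0)" if l: "l \<in> {1..M}" for l
  proof -
    have "integral {t (l - 1)..t l} (\<lambda>s. l2ip \<Omega> (dtime t u l s) (?\<phi> s)) =
        integral {t (l - 1)..t l} (\<lambda>s. if l = m then poly (pderiv (P m j) * r) s else 0)"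
    proof (rule integral_spike[of "{t (l - 1)}"])
      fix s assume "s \<in> {t (l - 1)..t l} - {t (l - 1)}"
      then have s: "s \<in> {t (l - 1)<..t l}" by auto
      show "(if l = m then poly (pderiv (P m j) * r) s else 0) = l2ip \<Omega> (dtime t u l s) (?\<phi> s)"
        using l j s by (auto simp: dtime_eq \<phi>.rep l2_comb poly_if sum_unit)
    qed simp
    then show ?thesis by (cases "l = m") (simp_all del: poly_mult)
  qed
  have stiff: "integral {t 0..t M} (\<lambda>s. h1ip \<Omega> (u s) (?\<phi> s)) = ?E"
  proof (rule integral_unique)
    let ?f = "\<lambda>s. if s \<in> {t (m - 1)..t m} then poly (smult (\<mu> j) (P m j) * r) s else 0"
    have sub: "{t (m - 1)..t m} \<subseteq> {t 0..t M}"
      using less_eq[of 0 "m - 1"] less_eq[of m M] m diff_le_self[of m 1] order_trans[of "m - 1" m M] by auto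
    have "(?f has_integral ?E) {t 0..t M}"
    proof (rule has_integral_on_superset[OF _ _ sub])
      show "(?f has_integral ?E) {t (m - 1)..t m}"
        by (rule has_integral_eq[OF _ has_integral_poly]) simp
    qed auto
    then show "((\<lambda>s. h1ip \<Omega> (u s) (?\<phi> s)) has_integral ?E) {t 0..t M}"
    \<comment> \<open>At \<open>t 0\<close> the value of \<open>u\<close> is unconstrained; at
      \<open>t (m - 1)\<close> the test function is 0 while \<open>?f\<close> need not be.\<close>
    proof (rule has_integral_spike_finite[of "{t 0, t (m - 1)}", rotated 2])
      fix s assume s: "s \<in> {t 0..t M} - {t 0, t (m - 1)}"
      show "h1ip \<Omega> (u s) (?\<phi> s) = ?f s"
      proof (cases "s \<in> {t (m - 1)<..t m}")
        case True
        then show ?thesis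
          using m j by (simp add: rep[OF m] \<phi>.rep[OF m] h1_comb poly_if sum_unit)
      next
        case False
        then have "?\<phi> s = (\<lambda>x. 0)" by (auto simp: test_function_def)
        have "\<exists>l. 1 \<le> l \<and> l \<le> M \<and> s \<in> {t (l - 1)<..t l}"
        proof -
          define l where "l = (LEAST l. s \<le> t l)"
          have "s \<le> t M" using s by simp
          then have l: "s \<le> t l" "l \<le> M" by (auto simp: l_def intro: LeastI Least_le)
          have "l \<noteq> 0" using l s by (intro notI) auto
          moreover have "\<not> s \<le> t (l - 1)"
            using \<open>l \<noteq> 0\<close> not_less_Least[of "l - 1" "\<lambda>l. s \<le> t l"] by (simp add: l_def[symmetric])
          ultimately show ?thesis using l by (intro exI[of _ l]) auto
        qed
        then obtain l where l: "1 \<le> l" "l \<le> M" "s \<in> {t (l - 1)<..t l}" by blast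
        then have "h1ip \<Omega> (u s) (?\<phi> s) = h1ip \<Omega> (comb (\<lambda>i. poly (P l i) s)) (comb (\<lambda>i. 0))"
          using rep[OF l] \<open>?\<phi> s = (\<lambda>x. 0)\<close> by (simp add: comb_zero)
        also have "\<dots> = 0" by (simp add: h1_comb)
        finally show ?thesis using False s by auto
      qed
    qed simp
  qed
  have jumps: "(\<Sum>l=2..M. l2ip \<Omega> (jump t u (l - 1)) (dg_plus t ?\<phi> (l - 1))) =
     (if m = 1 then 0 else ?J)"
  proof -
    have "(\<Sum>l=2..M. l2ip \<Omega> (jump t u (l - 1)) (dg_plus t ?\<phi> (l - 1))) =
      (\<Sum>l=2..M. if l = m then ?J else 0)"
    proof (intro sum.cong refl)
      fix l assume "l \<in> {2..M}"
      then have l: "2 \<le> l" "l \<le> M" "1 \<le> l" by auto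
      show "l2ip \<Omega> (jump t u (l - 1)) (dg_plus t ?\<phi> (l - 1)) =
        (if l = m then ?J else 0)"
        unfolding jump_eq[OF l(1,2)] \<phi>.dg_plus_eq[OF l(3,2)] l2_comb
        using j by (auto simp: poly_if sum_unit)
    qed
    then show ?thesis using m by auto
  qed
  have init: "l2ip \<Omega> (dg_plus t u 0) (dg_plus t ?\<phi> 0) = (if m = 1 then poly (P 1 j) (t 0) * poly r (t 0) else 0)"
    using dg_plus_eq[of 1] \<phi>.dg_plus_eq[of 1] m j by (auto simp: l2_comb poly_if sum_unit)
  have "(\<Sum>l=1..M. integral {t (l - 1)..t l} (\<lambda>s. l2ip \<Omega> (dtime t u l s) (?\<phi> s)))
      = (\<Sum>l=1..M. if l = m then ?D else 0)"
    by (intro sum.cong refl deriv)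
  then have "(\<Sum>l=1..M. integral {t (l - 1)..t l} (\<lambda>s. l2ip \<Omega> (dtime t u l s) (?\<phi> s)))
      = ?D"
    using m by simp
  moreover have "integral {t (m - 1)..t m} (poly ((pderiv (P m j) + smult (\<mu> j) (P m j)) * r))
     = ?D + ?E"
    unfolding distrib_right integral_add[OF poly_integrable poly_integrable, symmetric]
    by (rule arg_cong[of _ _ "integral _"]) (simp add: fun_eq_iff)
  ultimately show ?thesis
    unfolding bilin_def stiff jumps init by (cases "m = 1") (auto simp: algebra_simps)
qed

lemma test_function_dG_space:
  assumes m: "1 \<le> m" "m \<le> M" and r: "degree r \<le> q"
  shows "test_function m j r \<in> dG_space V q M t"
  unfolding dG_space_def
proof (intro CollectI ballI)
  fix l assume "l \<in> {1..M}"
  then have l: "1 \<le> l" "l \<le> M" by auto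
  interpret \<phi>: dg_function \<Omega> V n e \<mu> M t "test_function m j r" "\<lambda>l i. if l = m \<and> i = j then r else 0"
    by (rule test_function_dg[OF m])
  define a where "a k = comb (\<lambda>i. if l = m \<and> i = j then coeff r k else 0)" for k
  have "test_function m j r s = (\<lambda>x. \<Sum>k\<le>q. s ^ k * a k x)" if s: "s \<in> {t (l - 1)<..t l}" for s
  proof
    fix x
    have "poly r s = (\<Sum>k\<le>q. coeff r k * s ^ k)"
      by (subst poly_as_sum_of_monoms'[OF r, symmetric]) (simp add: poly_sum poly_monom)
    then have "poly (if l = m \<and> i = j then r else 0) s = (\<Sum>k\<le>q. s ^ k * (if l = m \<and> i = j then coeff r k else 0))" for i
      by (cases "l = m \<and> i = j") (auto simp: mult.commute)
    then have "test_function m j r s x = (\<Sum>i<n. (\<Sum>k\<le>q. s ^ k * (if l = m \<and> i = j then coeff r k else 0)) * e i x)"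
      unfolding \<phi>.rep[OF l s] comb_def by simp
    also have "\<dots> = (\<Sum>k\<le>q. s ^ k * a k x)"
      unfolding a_def comb_def sum_distrib_left sum_distrib_right mult.assoc by (rule sum.swap)
    finally show "test_function m j r s x = (\<Sum>k\<le>q. s ^ k * a k x)" .
  qed
  then show "\<exists>a. (\<forall>k\<le>q. a k \<in> V) \<and>
      (\<forall>s\<in>{t (l - 1)<..t l}. test_function m j r s = (\<lambda>x. \<Sum>k\<le>q. s ^ k * a k x))"
    by (intro exI[of _ a]) (simp add: a_def)
qed

end

lemma (in fe_diag) dG_space_rep:
  assumes "u \<in> dG_space V q M t"
  shows "\<exists>P. (\<forall>l i. degree (P l i) \<le> q) \<and>
    (\<forall>l s. 1 \<le> l \<longrightarrow> l \<le> M \<longrightarrow> s \<in> {t (l - 1)<..t l} \<longrightarrow> u s = comb (\<lambda>i. poly (P l i) s))"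
proof -
  have "\<forall>l\<in>{1..M}. \<exists>p. (\<forall>i. degree (p i) \<le> q) \<and> (\<forall>s\<in>{t (l - 1)<..t l}. u s = comb (\<lambda>i. poly (p i) s))"
  proof
    fix l assume "l \<in> {1..M}"
    then obtain a where a: "\<forall>k\<le>q. a k \<in> V" "\<forall>s\<in>{t (l - 1)<..t l}. u s = (\<lambda>x. \<Sum>k\<le>q. s ^ k * a k x)"
      using assms unfolding dG_space_def by blast
    have "\<forall>k\<in>{..q}. \<exists>c. a k = comb c" using a(1) by (auto simp: V_comb)
    then obtain c where c: "\<And>k. k \<le> q \<Longrightarrow> a k = comb (c k)" by (metis atMost_iff)
    define p where "p i = (\<Sum>k\<le>q. Polynomial.monom (c k i) k)" for i
    have "degree (p i) \<le> q" for i
      unfolding p_def by (intro degree_sum_le) (auto intro: order_trans[OF degree_monom_le])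
    moreover have "u s = comb (\<lambda>i. poly (p i) s)" if s: "s \<in> {t (l - 1)<..t l}" for s
    proof
      fix x
      have "u s x = (\<Sum>k\<le>q. s ^ k * comb (c k) x)" using a(2) s c by simp
      also have "\<dots> = (\<Sum>i<n. \<Sum>k\<le>q. s ^ k * (c k i * e i x))"
        unfolding comb_def sum_distrib_left by (rule sum.swap)
      also have "\<dots> = comb (\<lambda>i. poly (p i) s) x"
        by (simp add: comb_def p_def poly_sum poly_monom sum_distrib_right sum_distrib_left mult_ac)
      finally show "u s x = comb (\<lambda>i. poly (p i) s) x" .
    qed
    ultimately show "\<exists>p. (\<forall>i. degree (p i) \<le> q) \<and> (\<forall>s\<in>{t (l - 1)<..t l}. u s = comb (\<lambda>i. poly (p i) s))"
      by blast
  qed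
  then obtain p where p: "\<And>l. l \<in> {1..M} \<Longrightarrow> (\<forall>i. degree (p l i) \<le> q) \<and> (\<forall>s\<in>{t (l - 1)<..t l}. u s = comb (\<lambda>i. poly (p l i) s))"
    by metis
  show ?thesis
    by (intro exI[of _ "\<lambda>l i. if l \<in> {1..M} then p l i else 0"]) (use p in auto)
qed

lemma polyval_unit: "polyval q (\<lambda>j. if j = q then b else 0) z = of_real b * z ^ q"
  by (simp add: polyval_def if_distrib[of of_real] if_distrib[of "\<lambda>x. x * _"] cong: if_cong)

section \<open>Formulas for the solution on each time interval\<close>

locale dg_solution = dg_function +
  fixes w :: "nat \<Rightarrow> real" and q :: nat
  assumes t0: "t 0 = 0"
    and degree_P: "degree (P l i) \<le> q"
    and solves: "1 \<le> m \<Longrightarrow> m \<le> M \<Longrightarrow> j < n \<Longrightarrow> degree r \<le> q \<Longrightarrow>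
      bilin \<Omega> M t u (test_function m j r) = (if m = 1 then w j * poly r 0 else 0)"
begin

definition initial :: "nat \<Rightarrow> nat \<Rightarrow> real" where
  "initial m j = (if m = 1 then w j else poly (P (m - 1) j) (t (m - 1)))"

text \<open>Transport to the unit interval gives the model problem with parameter
  \<open>k * \<mu> j\<close>. Each test polynomial \<open>r\<close> there is the transport of an
  admissible one, \<open>r'\<close>, on the actual interval.\<close>

lemma local_solution:
  assumes m: "1 \<le> m" "m \<le> M" and j: "j < n"
  defines "k \<equiv> t m - t (m - 1)"
  shows "poly (P m j) (t (m - 1) + k * \<theta>) = initial m j * polyval q (dg_ncoeff q \<theta>) (k * \<mu> j) / dg_den q (k * \<mu> j)"
proof -
  define a where "a = t (m - 1)"
  have k: "0 < k" using step_less[OF m] by (simp add: k_def)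
  have tm: "t m = a + k" by (simp add: a_def k_def)
  define p where "p = pcompose (P m j) [:a, k:]"
  have dp: "pderiv p = smult k (pcompose (pderiv (P m j)) [:a, k:])"
    by (simp add: p_def pderiv_pcompose pderiv_pCons mult.commute)
  have "poly p \<theta> = initial m j * polyval q (dg_ncoeff q \<theta>) (k * \<mu> j) / dg_den q (k * \<mu> j)"
  proof (rule dg_solution_unique)
    show "0 \<le> k * \<mu> j" using k nonneg_ev[OF j] by simp
    show "degree p \<le> q" using degree_P k by (simp add: p_def degree_pcompose)
    fix r :: "real poly" assume r: "degree r \<le> q"
    define r' where "r' = pcompose r [:- a / k, 1 / k:]"
    have rr: "pcompose r' [:a, k:] = r"
    proof -
      have "pcompose [:- a / k, 1 / k:] [:a, k:] = [:0, 1:]"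
        using k by (simp add: pcompose_pCons)
      then show ?thesis unfolding r'_def pcompose_assoc[symmetric] by simp
    qed
    have "degree r' \<le> q" using r k by (simp add: r'_def degree_pcompose)
    from solves[OF m j this] have
      "integral {a..a + k} (poly ((pderiv (P m j) + smult (\<mu> j) (P m j)) * r')) + (poly (P m j) a - initial m j) * poly r' a
       + (if m = 1 then w j * poly r' a else 0) = (if m = 1 then w j * poly r' 0 else 0)"
      unfolding bilin_test_function[OF m j] tm a_def[symmetric]
      by (cases "m = 1") (auto simp: initial_def a_def algebra_simps)
    moreover have "m = 1 \<Longrightarrow> a = 0" using t0 by (simp add: a_def)
    ultimately have "integral {a..a + k} (poly ((pderiv (P m j) + smult (\<mu> j) (P m j)) * r')) + poly (P m j) a * poly r' a
       = initial m j * poly r' a"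
      by (cases "m = 1") (auto simp: algebra_simps)
    moreover have "integral {a..a + k} (poly ((pderiv (P m j) + smult (\<mu> j) (P m j)) * r'))
        = poly_int ((pderiv p + smult (k * \<mu> j) p) * r)"
    proof -
      have "(pderiv p + smult (k * \<mu> j) p) * r = smult k (pcompose ((pderiv (P m j) + smult (\<mu> j) (P m j)) * r') [:a, k:])"
        unfolding dp pcompose_mult rr pcompose_add pcompose_smult p_def[symmetric]
        by (simp add: smult_add_right algebra_simps)
      then show ?thesis
        unfolding integral_poly_affine[OF k] by (simp only: poly_int_smult)
    qed
    moreover have "poly r' a = poly r 0" "poly (P m j) a = poly p 0"
      using k by (simp_all add: r'_def p_def poly_pcompose)
    ultimately show "poly_int ((pderiv p + smult (k * \<mu> j) p) * r) + poly p 0 * poly r 0 = initial m j * poly r 0"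
      by simp
  qed
  then show ?thesis by (simp add: p_def poly_pcompose a_def mult.commute)
qed

text \<open>By \<open>pderiv_dg_comb\<close> the derivative on the unit interval has a factor
  \<open>z = k * \<mu> j\<close>. Returning to the actual interval divides by \<open>k\<close> and
  leaves the factor \<open>\<mu> j\<close> that the functional calculus requires.\<close>

lemma local_derivative:
  assumes m: "1 \<le> m" "m \<le> M" and j: "j < n"
  defines "k \<equiv> t m - t (m - 1)"
  shows "poly (pderiv (P m j)) (t (m - 1) + k * \<theta>) = initial m j * \<mu> j *
    polyval q (dg_dcoeff q \<theta>) (k * \<mu> j) / dg_den q (k * \<mu> j)"
proof -
  define z where "z = k * \<mu> j"
  define c where "c = initial m j / dg_den q z"
  have k: "0 < k" using step_less[OF m] by (simp add: k_def)
  have "pcompose (P m j) [:t (m - 1), k:] = smult c (dg_comb q (\<lambda>i. z ^ i))"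
    using local_solution[OF m j]
    by (intro poly_eq_poly_eq_iff[THEN iffD1] ext) (simp add: poly_pcompose c_def z_def k_def polyval_dg_ncoeff_real mult.commute)
  then have "pderiv (pcompose (P m j) [:t (m - 1), k:]) = smult c (pderiv (dg_comb q (\<lambda>i. z ^ i)))"
    by (simp add: pderiv_smult)
  then have "k * poly (pderiv (P m j)) (t (m - 1) + k * \<theta>) = c * (z ^ Suc q * poly (dg_delta q) \<theta> - z * polyval q (dg_ncoeff q \<theta>) z)"
    unfolding pderiv_dg_comb
    by (simp add: pderiv_pcompose pderiv_pCons poly_pcompose dg_comb_mult polyval_dg_ncoeff_real mult.commute fun_eq_iff flip: poly_eq_poly_eq_iff)
  also have "\<dots> = k * (c * \<mu> j * (z ^ q * poly (dg_delta q) \<theta> - polyval q (dg_ncoeff q \<theta>) z))"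
    by (simp add: z_def algebra_simps)
  also have "z ^ q * poly (dg_delta q) \<theta> - polyval q (dg_ncoeff q \<theta>) z
      = polyval q (dg_dcoeff q \<theta>) z"
    using polyval_unit[of q "poly (dg_delta q) \<theta>" z]
    by (simp add: polyval_def dg_dcoeff_def left_diff_distrib sum_subtractf mult.commute[of "z ^ q"])
  finally have "poly (pderiv (P m j)) (t (m - 1) + k * \<theta>)
      = c * \<mu> j * polyval q (dg_dcoeff q \<theta>) z"
    using k by (simp only: mult_cancel_left) simp
  then show ?thesis by (simp add: c_def z_def)
qed

text \<open>At the left end the numerator falls short of the denominator by
  \<open>z ^ Suc q\<close>. One factor \<open>z = k * \<mu> j\<close> is split off, because the jump
  will be divided by the step length.\<close>

lemma local_jump:
  assumes m: "1 \<le> m" "m \<le> M" and j: "j < n"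
  defines "k \<equiv> t m - t (m - 1)"
  shows "poly (P m j) (t (m - 1)) - initial m j = - (k * (initial m j * \<mu> j *
    polyval q (\<lambda>i. if i = q then 1 else 0) (k * \<mu> j) / dg_den q (k * \<mu> j)))"
proof -
  define z where "z = k * \<mu> j"
  have "0 \<le> z" using step_less[OF m] nonneg_ev[OF j] by (simp add: z_def k_def)
  then have "dg_den q z \<noteq> 0" by (rule dg_den_real_nonzero)
  moreover have "poly (P m j) (t (m - 1)) = initial m j * (dg_den q z - z ^ Suc q) / dg_den q z"
    using local_solution[OF m j, of 0] by (simp add: dg_den_def z_def k_def)
  ultimately have "poly (P m j) (t (m - 1)) - initial m j = - (initial m j * z ^ Suc q / dg_den q z)"
    by (simp add: field_simps)
  then show ?thesis
    using polyval_unit[of q 1 z] by (simp add: z_def mult_ac)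
qed

lemma initial_eq:
  assumes "1 \<le> m" "m \<le> M" "j < n"
  shows "initial m j = w j * (\<Prod>l\<in>{0<..<m}. polyval q (dg_ncoeff q 1) ((t l - t (l - 1)) * \<mu> j) / dg_den q ((t l - t (l - 1)) * \<mu> j))"
  using assms(1,2)
proof (induction m rule: dec_induct)
  case base
  have "{0<..<1::nat} = {}" by auto
  then show ?case by (simp add: initial_def)
next
  case (step m)
  have "{0<..<Suc m} = insert m {0<..<m}" using step by auto
  moreover have "initial (Suc m) j = initial m j * (polyval q (dg_ncoeff q 1) ((t m - t (m - 1)) * \<mu> j) / dg_den q ((t m - t (m - 1)) * \<mu> j))"
    using local_solution[of m j 1] step assms(3) by (simp add: initial_def)
  ultimately show ?case using step by simp
qed

lemma symbol_eq:
  assumes "1 \<le> m" "m \<le> M" "j < n"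
  shows "initial m j * polyval q a ((t m - t (m - 1)) * \<mu> j) / dg_den q ((t m - t (m - 1)) * \<mu> j)
    = w j * dg_symbol q t m a (\<mu> j)"
  unfolding initial_eq[OF assms] dg_symbol_def by simp

lemma values_eq:
  assumes m: "1 \<le> m" "m \<le> M" and s: "s \<in> {t (m - 1)<..t m}"
  obtains \<theta> where "0 \<le> \<theta>" "\<theta> \<le> 1"
    "u s = comb (\<lambda>i. w i * dg_symbol q t m (dg_ncoeff q \<theta>) (\<mu> i))"
    "dtime t u m s = comb (\<lambda>i. \<mu> i * dg_symbol q t m (dg_dcoeff q \<theta>) (\<mu> i) * w i)"
proof (rule that)
  define k where "k = t m - t (m - 1)"
  define \<theta> where "\<theta> = (s - t (m - 1)) / k"
  have k: "0 < k" using step_less[OF m] by (simp add: k_def)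
  have "k * \<theta> = s - t (m - 1)" using k by (simp add: \<theta>_def)
  then have s_eq: "s = t (m - 1) + (t m - t (m - 1)) * \<theta>" by (simp add: k_def)
  show "0 \<le> \<theta>" "\<theta> \<le> 1" using s k by (auto simp: \<theta>_def k_def)
  show "u s = comb (\<lambda>i. w i * dg_symbol q t m (dg_ncoeff q \<theta>) (\<mu> i))"
    unfolding rep[OF m s]
  proof (rule comb_cong)
    fix i assume i: "i < n"
    show "poly (P m i) s = w i * dg_symbol q t m (dg_ncoeff q \<theta>) (\<mu> i)"
      by (subst s_eq) (simp only: local_solution[OF m i] symbol_eq[OF m i])
  qed
  show "dtime t u m s = comb (\<lambda>i. \<mu> i * dg_symbol q t m (dg_dcoeff q \<theta>) (\<mu> i) * w i)"
    unfolding dtime_eq[OF m s]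
  proof (rule comb_cong)
    fix i assume i: "i < n"
    show "poly (pderiv (P m i)) s = \<mu> i * dg_symbol q t m (dg_dcoeff q \<theta>) (\<mu> i) * w i"
      by (subst s_eq) (simp only: local_derivative[OF m i] mult.assoc mult.left_commute[of _ "\<mu> i"] times_divide_eq_right[symmetric]
         symbol_eq[OF m i, unfolded times_divide_eq_right[symmetric]] mult.commute[of "w i"])
  qed
qed

lemma jump_values:
  assumes m: "1 \<le> m" "m \<le> M" and w: "l2proj \<Omega> V u0 = comb w"
  shows "jump_ic \<Omega> V u0 t u (m - 1) = comb (\<lambda>i. - ((t m - t (m - 1)) *
    (\<mu> i * dg_symbol q t m (\<lambda>l. if l = q then 1 else 0) (\<mu> i) * w i)))"
proof -
  have "jump_ic \<Omega> V u0 t u (m - 1) = comb (\<lambda>i. poly (P m i) (t (m - 1)) - initial m i)"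
  proof (cases "m = 1")
    case True
    then show ?thesis
      using dg_plus_eq[of 1] m w by (simp add: jump_ic_def initial_def comb_diff)
  next
    case False
    then show ?thesis
      using jump_eq[of m] m by (simp add: jump_ic_def initial_def)
  qed
  also have "\<dots> = comb (\<lambda>i. - ((t m - t (m - 1)) *
    (\<mu> i * dg_symbol q t m (\<lambda>l. if l = q then 1 else 0) (\<mu> i) * w i)))"
  proof (rule comb_cong)
    fix i assume i: "i < n"
    have "initial m i * \<mu> i * polyval q (\<lambda>i. if i = q then 1 else 0) ((t m - t (m - 1)) * \<mu> i) / dg_den q ((t m - t (m - 1)) * \<mu> i)
      = \<mu> i * dg_symbol q t m (\<lambda>l. if l = q then 1 else 0) (\<mu> i) * w i"
      using symbol_eq[OF m i, of "\<lambda>i. if i = q then 1 else 0"]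
      by (simp only: mult.assoc mult.left_commute[of _ "\<mu> i"] times_divide_eq_right[symmetric] mult.commute[of "w i"])
    then show "poly (P m i) (t (m - 1)) - initial m i = - ((t m - t (m - 1)) *
      (\<mu> i * dg_symbol q t m (\<lambda>l. if l = q then 1 else 0) (\<mu> i) * w i))"
      unfolding local_jump[OF m i] by simp
  qed
  finally show ?thesis .
qed

end

section \<open>The smoothing estimate\<close>

lemma fe_diag_fe_space:
  fixes \<Omega> :: "'d::euclidean_space set"
  assumes "open \<Omega>" "bounded \<Omega>" "mesh_partition \<Omega> \<T>" "finite A"
  obtains n e \<mu> where "fe_diag \<Omega> (fe_space \<Omega> \<T> A) n e \<mu>" "\<And>i. i < n \<Longrightarrow> e i \<in> fe_space \<Omega> \<T> A"
proof -
  let ?V = "fe_space \<Omega> \<T> A"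
  obtain n :: nat and e \<mu> where e: "\<And>i. i < n \<Longrightarrow> e i \<in> ?V" "\<And>i. i < n \<Longrightarrow> 0 \<le> \<mu> i"
    "\<And>i j. i < n \<Longrightarrow> j < n \<Longrightarrow> l2ip \<Omega> (e i) (e j) = (if i = j then 1 else 0)"
    "\<And>i j. i < n \<Longrightarrow> j < n \<Longrightarrow> h1ip \<Omega> (e i) (e j) = (if i = j then \<mu> i else 0)"
    "\<And>v. v \<in> ?V \<Longrightarrow> v = (\<Sum>i<n. fun_scale (l2ip \<Omega> v (e i)) (e i))"
    using fe_eigenbasis[OF assms] by blast
  interpret l2: inner_form ?V "l2ip \<Omega>" by (rule fe_l2_form[OF assms(1-3)])
  interpret h1: sym_form ?V "h1ip \<Omega>" by (rule fe_h1_form[OF assms(1-3)])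
  have comb: "(\<lambda>x. \<Sum>i<n. c i * e i x) = (\<Sum>i<n. fun_scale (c i) (e i))" for c
    by (auto simp: sum_fun_apply fun_scale_def)
  have expand: "B (\<lambda>x. \<Sum>i<n. c i * e i x) (\<lambda>x. \<Sum>i<n. d i * e i x) = (\<Sum>i<n. c i * (\<Sum>j<n. d j * B (e i) (e j)))"
    if B: "sym_form ?V B" for B c d
  proof -
    interpret B: sym_form ?V B by (rule B)
    have "B (\<Sum>i<n. fun_scale (c i) (e i)) (\<Sum>i<n. fun_scale (d i) (e i))
        = (\<Sum>i<n. c i * B (e i) (\<Sum>i<n. fun_scale (d i) (e i)))"
      by (rule B.comb_left) (auto intro: e B.comb_in)
    also have "\<dots> = (\<Sum>i<n. c i * (\<Sum>j<n. d j * B (e i) (e j)))"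
    proof (intro sum.cong refl)
      fix i assume "i \<in> {..<n}"
      then have "B (e i) (\<Sum>i<n. fun_scale (d i) (e i)) = (\<Sum>j<n. d j * B (e i) (e j))"
        by (intro B.comb_right) (auto intro: e)
      then show "c i * B (e i) (\<Sum>i<n. fun_scale (d i) (e i)) = c i * (\<Sum>j<n. d j * B (e i) (e j))" by simp
    qed
    finally show ?thesis unfolding comb .
  qed
  have delta: "(\<Sum>j<n. d j * B (e i) (e j)) = d i * a"
    if "i < n" "\<And>j. j < n \<Longrightarrow> B (e i) (e j) = (if i = j then a else 0)" for B i a and d :: "nat \<Rightarrow> real"
  proof -
    have "(\<Sum>j<n. d j * B (e i) (e j)) = (\<Sum>j<n. if i = j then d j * a else 0)"
      by (intro sum.cong) (use that in auto)
    then show ?thesis using that(1) by simp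
  qed
  have "fe_diag \<Omega> ?V n e \<mu>"
  proof
    show "0 \<le> \<mu> i" if "i < n" for i by (rule e(2)[OF that])
    show "v \<in> ?V \<longleftrightarrow> (\<exists>c. v = (\<lambda>x. \<Sum>i<n. c i * e i x))" for v
      unfolding comb using e(1,5) l2.comb_in[of "{..<n}" e] by (metis lessThan_iff)
    show "l2ip \<Omega> (\<lambda>x. \<Sum>i<n. c i * e i x) (\<lambda>x. \<Sum>i<n. d i * e i x) = (\<Sum>i<n. c i * d i)" for c d
      unfolding expand[OF l2.sym_form_axioms] by (intro sum.cong) (simp_all add: delta[where B = "l2ip \<Omega>", OF _ e(3)])
    show "h1ip \<Omega> (\<lambda>x. \<Sum>i<n. c i * e i x) (\<lambda>x. \<Sum>i<n. d i * e i x) = (\<Sum>i<n. \<mu> i * c i * d i)" for c d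
      unfolding expand[OF h1.sym_form_axioms] by (intro sum.cong) (simp_all add: delta[where B = "h1ip \<Omega>", OF _ e(4)])
  qed
  then show ?thesis using that e(1) by blast
qed

lemma l2ip_sum_right:
  fixes n :: nat
  assumes "\<And>i. i < n \<Longrightarrow> set_integrable lebesgue \<Omega> (\<lambda>x. f x * e i x)"
  shows "set_integrable lebesgue \<Omega> (\<lambda>x. f x * (\<Sum>i<n. d i * e i x)) \<and>
    l2ip \<Omega> f (\<lambda>x. \<Sum>i<n. d i * e i x) = (\<Sum>i<n. l2ip \<Omega> f (e i) * d i)"
  using assms
proof (induction n)
  case 0
  then show ?case by (simp add: l2ip_def set_integrable_def)
next
  case (Suc n)
  have "set_integrable lebesgue \<Omega> (\<lambda>x. d n * (f x * e n x))"
    using Suc.prems[of n] by simp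
  moreover have "set_integrable lebesgue \<Omega> (\<lambda>x. f x * (\<Sum>i<n. d i * e i x))"
    and "l2ip \<Omega> f (\<lambda>x. \<Sum>i<n. d i * e i x) = (\<Sum>i<n. l2ip \<Omega> f (e i) * d i)"
    using Suc by auto
  moreover have "(\<lambda>x. f x * (\<Sum>i<Suc n. d i * e i x)) = (\<lambda>x. f x * (\<Sum>i<n. d i * e i x) + d n * (f x * e n x))"
    by (simp add: algebra_simps)
  ultimately show ?case
    using set_integral_add[of lebesgue \<Omega> "\<lambda>x. f x * (\<Sum>i<n. d i * e i x)" "\<lambda>x. d n * (f x * e n x)"]
    by (simp add: l2ip_def mult.commute del: sum.lessThan_Suc) simp
qed

section \<open>Complex coefficients, the resolvent and the given norm in the eigenbasis\<close>

context fe_diag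
begin

definition ccomb :: "(nat \<Rightarrow> complex) \<Rightarrow> 'd \<Rightarrow> complex" where
  "ccomb c = (\<lambda>x. \<Sum>i<n. c i * of_real (e i x))"

lemma ccomb_cong: "(\<And>i. i < n \<Longrightarrow> c i = d i) \<Longrightarrow> ccomb c = ccomb d"
  by (simp add: ccomb_def)

lemma cpx_comb: "cpx (comb c) = ccomb (\<lambda>i. of_real (c i))"
  by (simp add: cpx_def comb_def ccomb_def)

lemma Re_ccomb: "Re (ccomb c x) = comb (\<lambda>i. Re (c i)) x"
  by (simp add: ccomb_def comb_def)

lemma Im_ccomb: "Im (ccomb c x) = comb (\<lambda>i. Im (c i)) x"
  by (simp add: ccomb_def comb_def)

lemma cplx_space_iff: "f \<in> cplx_space V \<longleftrightarrow> (\<exists>c. f = ccomb c)"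
proof
  assume "f \<in> cplx_space V"
  then obtain a b where "f = (\<lambda>x. complex_of_real (comb a x) + \<i> * complex_of_real (comb b x))"
    unfolding cplx_space_def by (auto simp: V_comb)
  then have "f = ccomb (\<lambda>i. Complex (a i) (b i))"
    by (auto simp: fun_eq_iff complex_eq_iff Re_ccomb Im_ccomb)
  then show "\<exists>c. f = ccomb c" by blast
next
  assume "\<exists>c. f = ccomb c"
  then obtain c where "f = ccomb c" by blast
  then have "f = (\<lambda>x. complex_of_real (comb (\<lambda>i. Re (c i)) x) + \<i> * complex_of_real (comb (\<lambda>i. Im (c i)) x))"
    by (auto simp: fun_eq_iff complex_eq_iff Re_ccomb Im_ccomb)
  then show "f \<in> cplx_space V"
    unfolding cplx_space_def using comb_in_V by blast
qed

lemma ccomb_in [simp]: "ccomb c \<in> cplx_space V"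
  by (auto simp: cplx_space_iff)

lemma ccomb_inject:
  assumes "ccomb c = ccomb d" "j < n"
  shows "c j = d j"
proof -
  have "comb (\<lambda>i. Re (c i)) = comb (\<lambda>i. Re (d i))" "comb (\<lambda>i. Im (c i)) = comb (\<lambda>i. Im (d i))"
    by (auto simp: fun_eq_iff assms(1) simp flip: Re_ccomb Im_ccomb)
  from this[THEN comb_inject, OF assms(2)] show ?thesis by (simp add: complex_eq_iff)
qed

lemma cplx_lap_ccomb: "cplx_lap \<Omega> V (ccomb c) = ccomb (\<lambda>i. - (of_real (\<mu> i) * c i))"
proof -
  have "(\<lambda>y. Re (ccomb c y)) = comb (\<lambda>i. Re (c i))" "(\<lambda>y. Im (ccomb c y)) = comb (\<lambda>i. Im (c i))"
    by (auto simp: Re_ccomb Im_ccomb)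
  then show ?thesis
    by (auto simp: cplx_lap_def disc_lap_comb fun_eq_iff complex_eq_iff Re_ccomb Im_ccomb)
qed

lemma resolvent_ccomb:
  assumes z: "\<And>i. i < n \<Longrightarrow> z \<noteq> of_real (\<mu> i)"
  shows "resolvent \<Omega> V z (ccomb c) = ccomb (\<lambda>i. c i / (z - of_real (\<mu> i)))"
proof -
  have act: "(\<lambda>x. z * ccomb d x + cplx_lap \<Omega> V (ccomb d) x) = ccomb (\<lambda>i. (z - of_real (\<mu> i)) * d i)" for d
    unfolding cplx_lap_ccomb by (simp add: ccomb_def sum_distrib_left algebra_simps sum_subtractf sum_negf)
  show ?thesis
    unfolding resolvent_def
  proof (rule the_equality)
    show "ccomb (\<lambda>i. c i / (z - of_real (\<mu> i))) \<in> cplx_space V \<and>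
      (\<lambda>x. z * ccomb (\<lambda>i. c i / (z - of_real (\<mu> i))) x + cplx_lap \<Omega> V (ccomb (\<lambda>i. c i / (z - of_real (\<mu> i)))) x) = ccomb c"
      unfolding act using z by (auto simp: cplx_space_iff intro!: ccomb_cong)
    fix f assume f: "f \<in> cplx_space V \<and> (\<lambda>x. z * f x + cplx_lap \<Omega> V f x) = ccomb c"
    then obtain d where d: "f = ccomb d" by (auto simp: cplx_space_iff)
    have eq: "ccomb (\<lambda>i. (z - of_real (\<mu> i)) * d i) = ccomb c"
      using f unfolding d act by simp
    have "d i = c i / (z - of_real (\<mu> i))" if "i < n" for i
      using ccomb_inject[OF eq that] z[OF that] by (simp add: field_simps)
    then show "f = ccomb (\<lambda>i. c i / (z - of_real (\<mu> i)))"
      unfolding d by (rule ccomb_cong)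
  qed
qed

lemma fin_seminorm_norm:
  assumes "is_norm_on (cplx_space V) N"
  shows "fin_seminorm n (\<lambda>c. N (ccomb c))"
proof
  show "N (ccomb (\<lambda>i. a i + b i)) \<le> N (ccomb a) + N (ccomb b)" for a b
  proof -
    have "ccomb (\<lambda>i. a i + b i) = (\<lambda>x. ccomb a x + ccomb b x)"
      by (simp add: ccomb_def distrib_right sum.distrib)
    then show ?thesis
      using assms unfolding is_norm_on_def by simp
  qed
  show "N (ccomb (\<lambda>i. c * a i)) = cmod c * N (ccomb a)" for c a
  proof -
    have "ccomb (\<lambda>i. c * a i) = (\<lambda>x. c * ccomb a x)"
      by (simp add: ccomb_def sum_distrib_left mult.assoc)
    then show ?thesis
      using assms unfolding is_norm_on_def by simp
  qed
  show "N (ccomb a) = N (ccomb b)" if "\<And>i. i < n \<Longrightarrow> a i = b i" for a b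
    using ccomb_cong[OF that] by simp
qed

text \<open>Testing the resolvent estimate with an eigenfunction shows \<^term>\<open>1 / 2 \<le> Mh\<close> unless \<^term>\<open>n = 0\<close>.\<close>
lemma norm_le_resolvent_bound:
  assumes N: "is_norm_on (cplx_space V) N" and \<gamma>: "\<gamma> < pi"
    and res: "\<forall>\<psi>\<in>cplx_space V. \<forall>z. z \<notin> sector \<gamma> \<longrightarrow> N (resolvent \<Omega> V z \<psi>) \<le> Mh / cmod z * N \<psi>"
  shows "N (ccomb v) \<le> 2 * (Mh * N (ccomb v))"
proof (cases "n = 0")
  case True
  interpret fin_seminorm n "\<lambda>c. N (ccomb c)" by (rule fin_seminorm_norm[OF N])
  have "N (ccomb v) = 0" using cong[of v "\<lambda>i. 0"] zero True by simp
  then show ?thesis by simp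
next
  case False
  interpret fin_seminorm n "\<lambda>c. N (ccomb c)" by (rule fin_seminorm_norm[OF N])
  \<comment> \<open>On the eigenfunction of index 0 the resolvent is division by
    \<open>- (2 * \<mu> 0 + 1)\<close>. Comparison with \<open>Mh / (\<mu> 0 + 1)\<close> gives
    \<open>Mh \<ge> (\<mu> 0 + 1) / (2 * \<mu> 0 + 1)\<close>, which is at least 1/2 whatever the
    eigenvalue.\<close>
  define z where "z = complex_of_real (- (\<mu> 0 + 1))"
  define d where "d i = (if i = 0 then 1 else 0 :: complex)" for i :: nat
  have \<mu>0: "0 \<le> \<mu> 0" using nonneg_ev[of 0] False by simp
  have zs: "z \<notin> sector \<gamma>"
    using \<mu>0 \<gamma> unfolding z_def sector_def by (simp only: mem_Collect_eq Arg_of_real) simp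
  have z\<mu>: "z \<noteq> of_real (\<mu> i)" if "i < n" for i
    using \<mu>0 nonneg_ev[OF that] unfolding z_def of_real_eq_iff by simp
  have "ccomb d \<noteq> (\<lambda>x. 0)"
  proof
    assume "ccomb d = (\<lambda>x. 0)"
    then have "ccomb d = ccomb (\<lambda>i. 0)" by (simp add: ccomb_def)
    then have "d 0 = 0" using ccomb_inject[of d "\<lambda>i. 0" 0] False by simp
    then show False by (simp add: d_def)
  qed
  then have "N (ccomb d) \<noteq> 0" using N ccomb_in[of d] unfolding is_norm_on_def by blast
  then have pos: "0 < N (ccomb d)" using nonneg[of d] by simp
  have "N (ccomb (\<lambda>i. d i / (z - of_real (\<mu> i)))) \<le> Mh / cmod z * N (ccomb d)"
    using res[rule_format, OF ccomb_in zs, of d] resolvent_ccomb[OF z\<mu>, of d] by simp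
  also have "N (ccomb (\<lambda>i. d i / (z - of_real (\<mu> i)))) = N (ccomb (\<lambda>i. inverse (z - of_real (\<mu> 0)) * d i))"
    by (rule cong) (auto simp: d_def divide_inverse)
  also have "\<dots> = inverse (2 * \<mu> 0 + 1) * N (ccomb d)"
  proof -
    have "z - of_real (\<mu> 0) = of_real (- (2 * \<mu> 0 + 1))" by (simp add: z_def)
    then have "cmod (z - of_real (\<mu> 0)) = \<bar>2 * \<mu> 0 + 1\<bar>" by (simp only: norm_of_real abs_minus_cancel)
    then show ?thesis using \<mu>0 by (simp add: homogeneous norm_inverse)
  qed
  also have "cmod z = \<mu> 0 + 1" unfolding z_def norm_of_real using \<mu>0 by simp
  finally have "inverse (2 * \<mu> 0 + 1) \<le> Mh / (\<mu> 0 + 1)"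
    by (rule mult_right_le_imp_le[OF _ pos])
  then have "(\<mu> 0 + 1) / (2 * \<mu> 0 + 1) \<le> Mh" using \<mu>0 by (simp add: field_simps)
  moreover have "1 / 2 \<le> (\<mu> 0 + 1) / (2 * \<mu> 0 + 1)" using \<mu>0 by (simp add: field_simps)
  ultimately have "1 \<le> 2 * Mh" by linarith
  then have "1 * N (ccomb v) \<le> 2 * Mh * N (ccomb v)" using nonneg[of v] by (intro mult_right_mono) auto
  then show ?thesis by simp
qed

end

text \<open>The coefficients are polynomials in \<open>\<theta>\<close> on a compact interval. Their
  common bound is what makes the final estimate uniform in time within a step.\<close>

lemma dg_ncoeff_bounded: "\<exists>K\<ge>0. \<forall>\<theta>\<in>{0..1}. \<forall>j\<le>q. \<bar>dg_ncoeff q \<theta> j\<bar> \<le> K"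
proof -
  have "\<exists>K. \<forall>\<theta>\<in>{0..1}. \<bar>dg_ncoeff q \<theta> j\<bar> \<le> K" for j
  proof -
    have "compact ((\<lambda>\<theta>. dg_ncoeff q \<theta> j) ` {0..1})"
      unfolding dg_ncoeff_def by (intro compact_continuous_image continuous_intros) auto
    then have "bounded ((\<lambda>\<theta>. dg_ncoeff q \<theta> j) ` {0..1})" by (rule compact_imp_bounded)
    then show ?thesis by (auto simp: bounded_iff)
  qed
  then obtain K where K: "\<And>j \<theta>. \<theta> \<in> {0..1} \<Longrightarrow> \<bar>dg_ncoeff q \<theta> j\<bar> \<le> K j" by metis
  have K0: "0 \<le> K j" for j using order_trans[OF abs_ge_zero K[of 0 j]] by simp
  have "\<bar>dg_ncoeff q \<theta> j\<bar> \<le> (\<Sum>j\<le>q. K j)" if "\<theta> \<in> {0..1}" "j \<le> q" for \<theta> j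
    using K[OF that(1), of j] member_le_sum[of j "{..q}" K] K0 that(2) by force
  then show ?thesis using K0 by (intro exI[of _ "\<Sum>j\<le>q. K j"]) (auto intro: sum_nonneg)
qed

text \<open>The resolvent estimate excludes the closed sector, so the rays take an angle strictly
  larger than \<open>\<gamma>\<close>; being smaller than \<open>pi / 2\<close>, it has a finite
  slope. On the negative real axis the argument is \<open>pi\<close>.\<close>

lemma not_in_sector:
  assumes \<gamma>: "0 < \<gamma>" "\<gamma> < pi / 2"
    and z: "(0 < Re z \<and> \<bar>Im z\<bar> = tan ((\<gamma> + pi / 2) / 2) * Re z) \<or> (Re z < 0 \<and> Im z = 0)"
  shows "z \<notin> sector \<gamma>"
  using z
proof
  assume z: "0 < Re z \<and> \<bar>Im z\<bar> = tan ((\<gamma> + pi / 2) / 2) * Re z"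
  define \<alpha> where "\<alpha> = (\<gamma> + pi / 2) / 2"
  have \<alpha>: "0 < \<alpha>" "\<alpha> < pi / 2" "\<gamma> < \<alpha>" using \<gamma> by (auto simp: \<alpha>_def)
  have "Im z / Re z = tan \<alpha> \<or> Im z / Re z = - tan \<alpha>"
    using z by (auto simp: \<alpha>_def field_simps abs_if split: if_splits)
  moreover have "arctan (tan \<alpha>) = \<alpha>" using \<alpha> by (intro arctan_tan) auto
  ultimately have "\<bar>Arg z\<bar> = \<alpha>"
    using arg_conv_arctan[of z] z \<alpha> by (auto simp: arctan_minus)
  then show ?thesis using \<alpha> by (simp add: sector_def)
next
  assume "Re z < 0 \<and> Im z = 0"
  then have "Arg z = pi" by (simp add: Arg_eq_pi)
  then show ?thesis using \<gamma> by (simp add: sector_def)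
qed

lemma admissible_ratio:
  assumes adm: "admissible T c \<beta> \<kappa> M t" and \<kappa>: "0 < \<kappa>" and l: "1 \<le> l" "l < M"
  shows "t (Suc l) - t l \<le> \<kappa> * (t l - t (l - 1))" "t l - t (l - 1) \<le> \<kappa> * (t (Suc l) - t l)"
proof -
  have tp: "\<forall>m<M. t m < t (Suc m)" using adm by (simp add: admissible_def time_partition_def)
  have 1: "0 < t l - t (l - 1)" using tp[rule_format, of "l - 1"] l by simp
  have 2: "0 < t (Suc l) - t l" using tp l by simp
  have "1 / \<kappa> \<le> (t l - t (l - 1)) / (t (Suc l) - t l)" "(t l - t (l - 1)) / (t (Suc l) - t l) \<le> \<kappa>"
    using adm l by (auto simp: admissible_def step_def)
  then show "t (Suc l) - t l \<le> \<kappa> * (t l - t (l - 1))" "t l - t (l - 1) \<le> \<kappa> * (t (Suc l) - t l)"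
    using 1 2 \<kappa> by (simp_all add: field_simps)
qed

theorem theorem13:
  fixes \<Omega> :: "'d::euclidean_space set" and T \<gamma> c \<beta> \<kappa> :: real and q r :: nat
    and A :: "('d \<Rightarrow> nat) set"
  assumes "lipschitz_domain \<Omega>" and "DIM('d) \<in> {2, 3}" and "T > 0"
    and "r \<ge> 1" and "A = P_idx r \<or> A = Q_idx r"
    and "0 < \<gamma>" and "\<gamma> < pi / 2"
    and "c > 0" and "\<beta> > 0" and "\<kappa> > 0"
  shows "\<exists>C::real. \<forall>(\<T>::'d set set) (N::('d \<Rightarrow> complex) \<Rightarrow> real) (Mh::real) (M::nat)
            (t::nat \<Rightarrow> real) (u0::'d \<Rightarrow> real) (u::real \<Rightarrow> 'd \<Rightarrow> real).
     let V = fe_space \<Omega> \<T> A in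
     mesh_partition \<Omega> \<T> \<longrightarrow>
     is_norm_on (cplx_space V) N \<longrightarrow>
     (\<forall>\<psi>\<in>cplx_space V. \<forall>z. z \<notin> sector \<gamma> \<longrightarrow>
         N (resolvent \<Omega> V z \<psi>) \<le> Mh / cmod z * N \<psi>) \<longrightarrow>
     admissible T c \<beta> \<kappa> M t \<longrightarrow>
     u0 \<in> borel_measurable (lebesgue_on \<Omega>) \<longrightarrow>
     integrable (lebesgue_on \<Omega>) (\<lambda>x. (u0 x)\<^sup>2) \<longrightarrow>
     u \<in> dG_space V q M t \<longrightarrow>
     (\<forall>\<phi>\<in>dG_space V q M t. bilin \<Omega> M t u \<phi> = l2ip \<Omega> u0 (dg_plus t \<phi> 0)) \<longrightarrow>
     (\<forall>m\<in>{1..M}.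
        (SUP s\<in>{t (m - 1)<..t m}. N (cpx (dtime t u m s)))
        + (SUP s\<in>{t (m - 1)<..t m}. N (cpx (disc_lap \<Omega> V (u s))))
        + N (cpx (jump_ic \<Omega> V u0 t u (m - 1))) / step t m
      \<le> C * Mh / t m * N (cpx (l2proj \<Omega> V u0)))"
proof -
  have dom: "open \<Omega>" "bounded \<Omega>" using assms(1) by (auto simp: lipschitz_domain_def)
  have A: "finite A" using assms(5) finite_P_idx finite_Q_idx by auto
  define \<tau> where "\<tau> = tan ((\<gamma> + pi / 2) / 2)"
  have \<tau>: "0 < \<tau>" unfolding \<tau>_def using assms(6,7) by (intro tan_gt_zero) auto
  obtain K0 where K0: "0 \<le> K0" "\<And>\<theta> j. 0 \<le> \<theta> \<Longrightarrow> \<theta> \<le> 1 \<Longrightarrow> j \<le> q \<Longrightarrow> \<bar>dg_ncoeff q \<theta> j\<bar> \<le> K0"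
    using dg_ncoeff_bounded[of q] by auto
  have "\<bar>poly (dg_delta q) \<theta>\<bar> \<le> K0" if "0 \<le> \<theta>" "\<theta> \<le> 1" for \<theta>
    using K0(2)[OF that order_refl] by (simp add: dg_ncoeff_def)
  then have K1: "\<bar>dg_dcoeff q \<theta> j\<bar> \<le> 2 * K0 + 1"
    if "0 \<le> \<theta>" "\<theta> \<le> 1" "j \<le> q" for \<theta> j
    using K0(2)[OF that] K0(1) that by (auto simp: dg_dcoeff_def abs_le_iff) (smt (verit))+
  have K2: "\<bar>dg_ncoeff q \<theta> j\<bar> \<le> 2 * K0 + 1" if "0 \<le> \<theta>" "\<theta> \<le> 1" "j \<le> q" for \<theta> j
    using K0(2)[OF that] K0(1) by simp
  \<comment> \<open>A single bound for the three families of numerators: \<open>K0\<close> for the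
    values, \<open>2 * K0\<close> for the derivative and 1 for the unit vector of the jump.\<close>
  have "0 \<le> 2 * K0 + 1" using K0(1) by simp
  then obtain C where C: "\<And>n \<Phi> \<mu> v R t m a. spectral_estimate n \<Phi> \<mu> v R \<tau> \<Longrightarrow> graded_steps \<kappa> t m \<Longrightarrow> 1 \<le> m \<Longrightarrow>
     (\<forall>j\<le>q. \<bar>a j\<bar> \<le> 2 * K0 + 1) \<Longrightarrow>
     \<Phi> (\<lambda>i. of_real (\<mu> i) * dg_symbol q t m a (of_real (\<mu> i)) * v i) \<le> C * R / t m"
    using dg_smoothing[OF _ \<tau> assms(10), of "2 * K0 + 1" q] by blast
  show ?thesis
    unfolding Let_def
  proof (intro exI[of _ "3 * C"] allI impI ballI)
    fix \<T> N Mh M t u0 u m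
    assume mesh: "mesh_partition \<Omega> \<T>" and N: "is_norm_on (cplx_space (fe_space \<Omega> \<T> A)) N"
      and res: "\<forall>\<psi>\<in>cplx_space (fe_space \<Omega> \<T> A). \<forall>z. z \<notin> sector \<gamma> \<longrightarrow>
         N (resolvent \<Omega> (fe_space \<Omega> \<T> A) z \<psi>) \<le> Mh / cmod z * N \<psi>"
      and adm: "admissible T c \<beta> \<kappa> M t"
      and u0: "u0 \<in> borel_measurable (lebesgue_on \<Omega>)" "integrable (lebesgue_on \<Omega>) (\<lambda>x. (u0 x)\<^sup>2)"
      and u: "u \<in> dG_space (fe_space \<Omega> \<T> A) q M t"
      and eq: "\<forall>\<phi>\<in>dG_space (fe_space \<Omega> \<T> A) q M t. bilin \<Omega> M t u \<phi> = l2ip \<Omega> u0 (dg_plus t \<phi> 0)"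
      and "m \<in> {1..M}"
    then have m: "1 \<le> m" "m \<le> M" by auto
    define V where "V = fe_space \<Omega> \<T> A"
    obtain n e \<mu> where diag: "fe_diag \<Omega> V n e \<mu>" and e: "\<And>i. i < n \<Longrightarrow> e i \<in> V"
      using fe_diag_fe_space[OF dom mesh A] unfolding V_def by blast
    interpret fe_diag \<Omega> V n e \<mu> by (rule diag)
    have tp: "t 0 = 0" "\<And>l. l < M \<Longrightarrow> t l < t (Suc l)"
      using adm by (auto simp: admissible_def time_partition_def)
    define w where "w i = l2ip \<Omega> u0 (e i)" for i
    have int_e: "set_integrable lebesgue \<Omega> (\<lambda>x. u0 x * e i x)" if "i < n" for i
      using l2_fe_integrable[OF dom mesh u0] e[OF that] unfolding V_def by blast
    have u0_comb: "l2ip \<Omega> u0 (comb d) = (\<Sum>i<n. w i * d i)" "set_integrable lebesgue \<Omega> (\<lambda>x. u0 x * comb d x)" for d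
      using l2ip_sum_right[of n \<Omega> u0 e d] int_e by (auto simp: comb_def w_def)
    have proj: "l2proj \<Omega> V u0 = comb w"
    proof (rule l2proj_comb)
      fix c d
      have "set_integrable lebesgue \<Omega> (\<lambda>x. comb c x * comb d x)"
        using fe_l2_integrable[OF dom mesh] comb_in_V unfolding V_def by blast
      then have "l2ip \<Omega> (\<lambda>x. u0 x - comb c x) (comb d) = l2ip \<Omega> u0 (comb d) - l2ip \<Omega> (comb c) (comb d)"
        using set_integral_diff(2)[OF u0_comb(2)[of d]] by (simp add: l2ip_def left_diff_distrib)
      then show "l2ip \<Omega> (\<lambda>x. u0 x - comb c x) (comb d) = (\<Sum>i<n. (w i - c i) * d i)"
        by (simp add: u0_comb l2_comb left_diff_distrib sum_subtractf)
    qed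
    obtain P where P: "\<forall>l i. degree (P l i) \<le> q"
      "\<forall>l s. 1 \<le> l \<longrightarrow> l \<le> M \<longrightarrow> s \<in> {t (l - 1)<..t l} \<longrightarrow> u s = comb (\<lambda>i. poly (P l i) s)"
      using dG_space_rep u unfolding V_def[symmetric] by blast
    interpret dg_function \<Omega> V n e \<mu> M t u P
      by unfold_locales (use tp P in auto)
    interpret dg_solution \<Omega> V n e \<mu> M t u P w q
    proof unfold_locales
      show "t 0 = 0" by (rule tp)
      show "degree (P l i) \<le> q" for l i using P by blast
      fix l j and p :: "real poly" assume l: "1 \<le> l" "l \<le> M" and j: "j < n" and p: "degree p \<le> q"
      interpret \<phi>: dg_function \<Omega> V n e \<mu> M t "test_function l j p" "\<lambda>k i. if k = l \<and> i = j then p else 0"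
        by (rule test_function_dg[OF l])
      \<comment> \<open>The index 0 is written \<open>1 - 1\<close> to match
        \<open>dg_plus_eq\<close>, which speaks of the left end of interval \<open>l\<close> as
        \<open>l - 1\<close>.\<close>
      have "bilin \<Omega> M t u (test_function l j p) = l2ip \<Omega> u0 (dg_plus t (test_function l j p) (1 - 1))"
        using eq test_function_dG_space[OF l p] unfolding V_def by simp
      also have "\<dots> = (\<Sum>i<n. w i * poly (if 1 = l \<and> i = j then p else 0) (t (1 - 1)))"
        using l by (subst \<phi>.dg_plus_eq) (auto simp: u0_comb)
      also have "\<dots> = (if l = 1 then w j * poly p 0 else 0)"
      proof (cases "l = 1")
        case True
        then have "(\<Sum>i<n. w i * poly (if 1 = l \<and> i = j then p else 0) (t (1 - 1)))
            = (\<Sum>i<n. w i * (if i = j then poly p 0 else 0))"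
          using tp by (intro sum.cong) auto
        then show ?thesis using True j by (simp add: sum_unit)
      qed auto
      finally show "bilin \<Omega> M t u (test_function l j p) = (if l = 1 then w j * poly p 0 else 0)" .
    qed
    define \<Phi> where "\<Phi> c = N (ccomb c)" for c
    define v where "v i = complex_of_real (w i)" for i
    \<comment> \<open>Putting \<open>Mh\<close> into \<open>R\<close> makes the smoothing estimate
      linear in \<open>Mh\<close>, with a constant independent of it.\<close>
    define R where "R = Mh * \<Phi> v"
    have \<Phi>: "fin_seminorm n \<Phi>"
      using fin_seminorm_norm[of N] N unfolding V_def[symmetric] \<Phi>_def[abs_def] by blast
    have v2: "\<Phi> v \<le> 2 * R"
      using norm_le_resolvent_bound[of N \<gamma> Mh v] N res assms(7) pi_gt_zero
      unfolding V_def[symmetric] R_def \<Phi>_def by simp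
    have rv: "\<Phi> (\<lambda>i. v i / (z - of_real (\<mu> i))) \<le> R / cmod z"
      if z: "(0 < Re z \<and> \<bar>Im z\<bar> = \<tau> * Re z) \<or> (Re z < 0 \<and> Im z = 0)" for z
    proof -
      have zs: "z \<notin> sector \<gamma>" using not_in_sector[OF assms(6,7), of z] z unfolding \<tau>_def by blast
      have "z \<noteq> of_real (\<mu> i)" if "i < n" for i
        using z \<tau> nonneg_ev[OF that] by auto
      then have "resolvent \<Omega> V z (ccomb v) = ccomb (\<lambda>i. v i / (z - of_real (\<mu> i)))"
        by (rule resolvent_ccomb)
      then show ?thesis
        using res[unfolded V_def[symmetric], rule_format, OF ccomb_in zs, of v] unfolding \<Phi>_def R_def by simp
    qed
    have est: "spectral_estimate n \<Phi> \<mu> v R \<tau>"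
      using \<Phi> nonneg_ev v2 rv by (intro spectral_estimate.intro spectral_estimate_axioms.intro)
    have steps: "graded_steps \<kappa> t m"
      using tp m admissible_ratio[OF adm assms(10)] by (auto simp: graded_steps_def)
    have smooth: "N (cpx (comb (\<lambda>i. \<mu> i * dg_symbol q t m a (\<mu> i) * w i))) \<le> C * R / t m"
      if "\<forall>j\<le>q. \<bar>a j\<bar> \<le> 2 * K0 + 1" for a
    proof -
      have "\<Phi> (\<lambda>i. of_real (\<mu> i) * dg_symbol q t m a (of_real (\<mu> i)) * v i) \<le> C * R / t m"
        by (rule C[OF est steps m(1) that])
      then show ?thesis by (simp add: cpx_comb \<Phi>_def v_def dg_symbol_of_real)
    qed
    have neg: "N (cpx (comb (\<lambda>i. - f i))) = N (cpx (comb f))" for f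
      using fin_seminorm.homogeneous[OF \<Phi>, of "-1" "\<lambda>i. of_real (f i)"] by (simp add: \<Phi>_def cpx_comb)
    have step: "0 < t m - t (m - 1)" using step_less[OF m] by simp
    have ne: "{t (m - 1)<..t m} \<noteq> {}" using step by auto
    let ?S3 = "N (cpx (jump_ic \<Omega> V u0 t u (m - 1))) / step t m"
    let ?S2 = "(SUP s\<in>{t (m - 1)<..t m}. N (cpx (disc_lap \<Omega> V (u s))))"
    let ?S1 = "(SUP s\<in>{t (m - 1)<..t m}. N (cpx (dtime t u m s)))"
    have "?S1 \<le> C * R / t m"
    proof (rule cSUP_least[OF ne])
      fix s assume "s \<in> {t (m - 1)<..t m}"
      from values_eq[OF m this] obtain \<theta> where "0 \<le> \<theta>" "\<theta> \<le> 1"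
        "dtime t u m s = comb (\<lambda>i. \<mu> i * dg_symbol q t m (dg_dcoeff q \<theta>) (\<mu> i) * w i)"
        by blast
      then show "N (cpx (dtime t u m s)) \<le> C * R / t m"
        using smooth K1 by simp
    qed
    moreover have "?S2 \<le> C * R / t m"
    proof (rule cSUP_least[OF ne])
      fix s assume "s \<in> {t (m - 1)<..t m}"
      from values_eq[OF m this] obtain \<theta> where \<theta>: "0 \<le> \<theta>" "\<theta> \<le> 1"
        "u s = comb (\<lambda>i. w i * dg_symbol q t m (dg_ncoeff q \<theta>) (\<mu> i))"
        by blast
      have "disc_lap \<Omega> V (u s) = comb (\<lambda>i. - (\<mu> i * dg_symbol q t m (dg_ncoeff q \<theta>) (\<mu> i) * w i))"
        unfolding \<theta>(3) disc_lap_comb by (simp add: mult_ac)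
      then show "N (cpx (disc_lap \<Omega> V (u s))) \<le> C * R / t m"
        unfolding neg using smooth K2 \<theta>(1,2) by (simp add: neg)
    qed
    moreover have "?S3 \<le> C * R / t m"
    proof -
      define k where "k = t m - t (m - 1)"
      have k: "0 < k" using step by (simp add: k_def)
      let ?f = "\<lambda>i. \<mu> i * dg_symbol q t m (\<lambda>l. if l = q then 1 else 0) (\<mu> i) * w i"
      have "N (cpx (jump_ic \<Omega> V u0 t u (m - 1))) = N (cpx (comb (\<lambda>i. k * ?f i)))"
        unfolding jump_values[OF m proj] neg k_def ..
      also have "\<dots> = k * N (cpx (comb ?f))"
        using fin_seminorm.homogeneous[OF \<Phi>, of "of_real k" "\<lambda>i. of_real (?f i)"] k
        by (simp add: \<Phi>_def cpx_comb k_def[symmetric])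
      finally have "?S3 = N (cpx (comb ?f))"
        using k by (simp add: step_def k_def)
      also have "\<dots> \<le> C * R / t m" using K0(1) by (intro smooth) auto
      finally show ?thesis .
    qed
    ultimately have "?S1
        + ?S2
        + ?S3 \<le> 3 * (C * R / t m)"
      by linarith
    also have "\<dots> = 3 * C * Mh / t m * N (cpx (l2proj \<Omega> V u0))"
      unfolding R_def \<Phi>_def v_def proj cpx_comb by simp
    finally show "?S1
        + (SUP s\<in>{t (m - 1)<..t m}. N (cpx (disc_lap \<Omega> (fe_space \<Omega> \<T> A) (u s))))
        + N (cpx (jump_ic \<Omega> (fe_space \<Omega> \<T> A) u0 t u (m - 1))) / step t m
      \<le> 3 * C * Mh / t m * N (cpx (l2proj \<Omega> (fe_space \<Omega> \<T> A) u0))"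
      unfolding V_def .
  qed
qed

end
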